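(* For $n\ge 2$ let $D_n$ be the number of descents of a permutation chosen uniformly at random in the symmetric group $\mathcal{S}_n$. The sequence $(D_n)$ satisfies a sharp large deviation principle of any order. More precisely, for any $x\in\,]1/2,1[$ and for any integer $p\ge 1$, there exists a sequence $d_{n,1}(x),\ldots,d_{n,p}(x)$ such that, for $n$ large enough, $$ \mathbb{P}\Big(\frac{D_n}{n}\ge x\Big)=\frac{\exp\big(-nI_D(x)-\{nx\}t_x\big)}{\sigma_x t_x\sqrt{2\pi n}}\left[1+\sum_{k=1}^p\frac{d_{n,k}(x)}{n^k}+O\Big(\frac{1}{n^{p+1}}\Big)\right], $$ where $t_x$ is the unique solution of $L_D'(t_x)=x$, $\sigma_x^2=L_D''(t_x)$, and the coefficients $d_{n,1}(x),\ldots,d_{n,p}(x)$ are bounded in $n$ and may be explicitly calculated as functions of the derivatives of $L_D$ at the point $t_x$. For example, the first coefficient $d_{n,1}(x)$ is given by $$ d_{n,1}(x)=\frac{1}{\sigma_x^2}\left(-\frac{1}{t_x^2}-\frac{\{nx\}}{t_x}-\frac{\{nx\}^2}{2}-\frac{\{nx\}\,\ell_D(3)}{6\sigma_x^2}-\frac{\ell_D(3)}{2\sigma_x^2t_x}+\frac{\ell_D(4)}{8\sigma_x^2}-\frac{5\,\ell_D(3)^2}{24\sigma_x^4}\right), $$ where $\ell_D(3)=L_D^{(3)}(t_x)$ and $\ell_D(4)=L_D^{(4)}(t_x)$.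
   Context: A permutation $\pi\in\mathcal{S}_n$ (the symmetric group on $\{1,\ldots,n\}$) has a descent at position $k\in\{1,\ldots,n-1\}$ if $\pi(k)>\pi(k+1)$; thus $D_n=\sum_{k=1}^{n-1}\mathbf{1}_{\{\pi_n(k)>\pi_n(k+1)\}}$ with $\pi_n$ uniform on $\mathcal{S}_n$. For a positive real number $y$, the notation $\{y\}$ means $\{y\}=\lceil y\rceil-y$ (not the usual fractional part). The function $L_D:\mathbb{R}\to\mathbb{R}$ is $L_D(t)=\log\big(\frac{e^t-1}{t}\big)$ for $t\neq0$, with $L_D(0)=0$ (smooth extension), and $I_D(x)=\sup_{t\in\mathbb{R}}\{xt-L_D(t)\}$. Here $\sigma_x$ denotes the positive square root of $\sigma_x^2$. The $O$ term is understood as $n\to\infty$ with $x$ and $p$ fixed.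
   Formalization: In the formula for d_{n,1}(x), the summand -{nx} l_D(3)/(6 sigma_x^2) is replaced by -{nx} l_D(3)/(2 sigma_x^2); with the printed 6 the expansion fails for every x, since l_D(3)<0 and {nx} does not tend to 0. *)

theory Defs
  imports
    "HOL-Probability.Probability"
    "HOL-Combinatorics.Permutations"
    "HOL-Library.Landau_Symbols"
begin

definition descents :: "nat \<Rightarrow> (nat \<Rightarrow> nat) \<Rightarrow> nat" where
  "descents n \<pi> = card {k \<in> {1..n - 1}. \<pi> k > \<pi> (k + 1)}"

definition uniform_perm :: "nat \<Rightarrow> (nat \<Rightarrow> nat) pmf" where
  "uniform_perm n = pmf_of_set {\<pi>. \<pi> permutes {1..n}}"

(* The distance up to the next integer, not the usual fractional part. *)
definition ceil_frac :: "real \<Rightarrow> real" where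
  "ceil_frac y = of_int \<lceil>y\<rceil> - y"

definition L_D :: "real \<Rightarrow> real" where
  "L_D t = (if t = 0 then 0 else ln ((exp t - 1) / t))"

(* A real-valued supremum: the set is bounded above exactly for 0 < x < 1, so outside
   this range the value (mathematically infinite) is unspecified. *)
definition I_D :: "real \<Rightarrow> real" where
  "I_D x = (SUP t. x * t - L_D t)"

definition t_of :: "real \<Rightarrow> real" where
  "t_of x = (THE t. deriv L_D t = x)"

definition ell :: "nat \<Rightarrow> real \<Rightarrow> real" where
  "ell j x = (deriv ^^ j) L_D (t_of x)"

definition sigma_of :: "real \<Rightarrow> real" where
  "sigma_of x = sqrt (ell 2 x)"

(* The fourth summand is misprinted in the source, with 6 in place of 2 in the
   denominator; that version is incompatible with the expansion: {nx} and 1 / t_x have to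
   enter the terms with the third derivative in the same way, as both come from
   exp (- s {nx}) / (1 + s / t_x) = 1 - s ({nx} + 1 / t_x) + O(s^2). *)
definition first_coeff :: "nat \<Rightarrow> real \<Rightarrow> real" where
  "first_coeff n x =
     (let a = ceil_frac (real n * x); t = t_of x; s = sigma_of x in
       1 / s^2 *
       (- 1 / t^2 - a / t - a^2 / 2 - a * ell 3 x / (2 * s^2)
        - ell 3 x / (2 * s^2 * t) + ell 4 x / (8 * s^2)
        - 5 * (ell 3 x)^2 / (24 * s^4)))"

(* Explicit formulas in {nx}, t_x and the derivatives of L_D at t_x. A formula mentions
   neither n nor x, so its value depends on them only through these quantities.
   The index of Deriv is shifted by one to exclude L_D itself. *)
datatype coeff_formula =
    Const rat
  | CeilFrac
  | Saddle
  | Deriv nat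
  | Plus coeff_formula coeff_formula
  | Times coeff_formula coeff_formula
  | Inverse coeff_formula

primrec formula_value :: "coeff_formula \<Rightarrow> nat \<Rightarrow> real \<Rightarrow> real" where
  "formula_value (Const c) n x = of_rat c"
| "formula_value CeilFrac n x = ceil_frac (real n * x)"
| "formula_value Saddle n x = t_of x"
| "formula_value (Deriv j) n x = ell (Suc j) x"
| "formula_value (Plus f g) n x = formula_value f n x + formula_value g n x"
| "formula_value (Times f g) n x = formula_value f n x * formula_value g n x"
| "formula_value (Inverse f) n x = inverse (formula_value f n x)"

end

theory Submission
  imports
    Defs
    "HOL-Complex_Analysis.Complex_Analysis"
    "HOL-Real_Asymp.Real_Asymp"
begin

text \<open>
  Inserting the largest value into a permutation gives a recurrence in \<open>n\<close> and \<open>m\<close> for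
  \<open>P(D_n \<ge> m)\<close>. The vertical line integral
  \<open>1 / (2 \<pi>) \<integral> (e^z - 1)^n e^(-m z) / z^(n+1) dv\<close>, \<open>z = t + i v\<close>, satisfies the same recurrence
  (integrate by parts) and the same initial condition at \<open>n = 1\<close> (residue theorem), so the two agree
  for every \<open>t > 0\<close>. For \<open>t = t_x\<close> and \<open>m = n x + {n x}\<close> the exponent is stationary on the line at
  \<open>v = 0\<close>, and the integral equals the claimed prefactor times
  \<open>sqrt (n \<sigma>\<^sup>2 / (2 \<pi>)) \<integral> exp (- n \<sigma>\<^sup>2 v\<^sup>2 / 2 + n h(i v)) e^(-i v {n x}) / (1 + i v / t) dv\<close>
  near \<open>0\<close>, where \<open>h\<close> vanishes to order three and has the derivatives of \<open>L_D\<close> as Taylor coefficients.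
  Laplace's method, with remainders that are uniform in \<open>{n x}\<close>, gives the expansion; away from \<open>0\<close>
  the integrand is exponentially small.
\<close>

text \<open>The integral has a probabilistic origin: \<open>D_n\<close> is distributed as the
  integer part of a sum of \<open>n\<close> independent uniform variables on [0,1]. The kernel is
  the moment generating function of that sum times \<open>e^(-m z) / z\<close>, and the line
  integral is the Bromwich formula for its tail; so \<open>L_D\<close> is the cumulant function of a
  single uniform variable. Matching recurrences replace a proof of this identity in law. They start
  at \<open>n = 1\<close>, since at \<open>n = 0\<close> the kernel decays only like
  \<open>1 / |z|\<close> and is not absolutely integrable.

  The obstacle is \<open>{n x}\<close>, which in general does not converge, so Laplace's method has
  to treat a whole family of integrands at once. Only the amplitude
  \<open>exp (- a w) / (1 + w / t)\<close> depends on \<open>a = {n x}\<close>, and it is bounded on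
  a fixed disc for all \<open>a\<close> in [0,1]; the phase \<open>h\<close> is the same for all
  \<open>n\<close>. Moreover the coefficients must come from formulas chosen before \<open>n\<close>
  and \<open>x\<close>. They do, because each is a fixed finite sum of products of Taylor
  coefficients, rational numbers and inverse powers of \<open>ell 2 x\<close>.\<close>

section \<open>The recurrence for the tail of the descent statistic\<close>

text \<open>\<open>\<pi> \<circ> rotation_to n j\<close> is \<open>\<pi>\<close>, a permutation of \<open>{1..n}\<close>, with the value \<open>n + 1\<close> inserted at
  position \<open>j\<close>.\<close>

definition rotation_to :: "nat \<Rightarrow> nat \<Rightarrow> nat \<Rightarrow> nat" where
  "rotation_to n j i = (if i < j \<or> i > Suc n then i else if i = j then Suc n else i - 1)"

lemma rotation_to_permutes:
  assumes "j \<in> {1..Suc n}"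
  shows "rotation_to n j permutes {1..Suc n}"
proof (rule bij_imp_permutes)
  have "inj_on (rotation_to n j) {1..Suc n}"
    using assms by (auto simp: inj_on_def rotation_to_def split: if_splits)
  moreover have "rotation_to n j ` {1..Suc n} \<subseteq> {1..Suc n}"
    using assms by (auto simp: rotation_to_def)
  ultimately show "bij_betw (rotation_to n j) {1..Suc n} {1..Suc n}"
    by (simp add: bij_betw_def endo_inj_surj)
qed (use assms in \<open>auto simp: rotation_to_def\<close>)

lemma card_permutes_atLeastAtMost: "card {\<pi>. \<pi> permutes {1..n::nat}} = fact n"
  by (rule card_permutations) auto

text \<open>The position of the value \<open>n + 1\<close> determines \<open>j\<close>, and then the
  rotation can be cancelled; this gives injectivity. Surjectivity follows by counting, as
  \<open>(n + 1) * n! = (n + 1)!\<close>.\<close>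

lemma bij_betw_insert_maximum:
  "bij_betw (\<lambda>(j, \<pi>). \<pi> \<circ> rotation_to n j)
     ({1..Suc n} \<times> {\<pi>. \<pi> permutes {1..n}}) {\<pi>. \<pi> permutes {1..Suc n}}"
proof -
  let ?A = "{1..Suc n} \<times> {\<pi>. \<pi> permutes {1..n}}"
  let ?f = "\<lambda>(j, \<pi>). \<pi> \<circ> rotation_to n j"
  have top: "\<pi> (Suc n) = Suc n" if "\<pi> permutes {1..n}" for \<pi>
    using that by (simp add: permutes_not_in)
  have ext: "\<pi> permutes {1..Suc n}" if "\<pi> permutes {1..n}" for \<pi>
    using that by (rule permutes_subset) auto
  have sub: "?f ` ?A \<subseteq> {\<pi>. \<pi> permutes {1..Suc n}}"
    using ext rotation_to_permutes by (auto intro: permutes_compose)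
  have inj: "inj_on ?f ?A"
  proof (rule inj_onI, clarify)
    fix j \<pi> j' \<pi>'
    assume j: "j \<in> {1..Suc n}" and j': "j' \<in> {1..Suc n}"
      and \<pi>: "\<pi> permutes {1..n}" and \<pi>': "\<pi>' permutes {1..n}"
      and eq: "\<pi> \<circ> rotation_to n j = \<pi>' \<circ> rotation_to n j'"
    \<comment> \<open>Both sides equal \<open>Suc n\<close>: the left one because
      \<open>\<pi>'\<close> fixes \<open>Suc n\<close>, the right one because by \<open>eq\<close>
      it is also \<open>\<pi> (Suc n)\<close>.\<close>
    have "(\<pi>' \<circ> rotation_to n j') j' = (\<pi>' \<circ> rotation_to n j') j"
      unfolding eq[symmetric]
      using top[OF \<pi>] top[OF \<pi>'] j j' fun_cong[OF eq, of j] fun_cong[OF eq, of j']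
      by (simp add: rotation_to_def)
    note e = this
    have i: "inj (\<pi>' \<circ> rotation_to n j')"
      using permutes_compose[OF rotation_to_permutes[OF j'] ext[OF \<pi>']] by (rule permutes_inj)
    have jj: "j = j'"
      using injD[OF i e] by (rule sym)
    have "surj (rotation_to n j)"
      using rotation_to_permutes[OF j] by (rule permutes_surj)
    moreover have "\<pi> \<circ> rotation_to n j = \<pi>' \<circ> rotation_to n j"
      using eq jj by simp
    ultimately have "\<pi> = \<pi>'"
      by (metis fun.map_comp comp_id surj_iff)
    with jj show "j = j' \<and> \<pi> = \<pi>'" ..
  qed
  have "card (?f ` ?A) = card {\<pi>. \<pi> permutes {1..Suc n}}"
    by (simp add: card_image[OF inj] card_cartesian_product card_permutes_atLeastAtMost
        del: One_nat_def)
  then have "?f ` ?A = {\<pi>. \<pi> permutes {1..Suc n}}"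
    using sub by (intro card_subset_eq) (auto intro: finite_permutations)
  then show ?thesis
    using inj by (simp add: bij_betw_def)
qed

definition descent_set :: "nat \<Rightarrow> (nat \<Rightarrow> nat) \<Rightarrow> nat set" where
  "descent_set n \<pi> = {k \<in> {1..n - 1}. \<pi> k > \<pi> (k + 1)}"

lemma descents_eq_card: "descents n \<pi> = card (descent_set n \<pi>)"
  by (simp add: descents_def descent_set_def)

lemma finite_descent_set [simp]: "finite (descent_set n \<pi>)"
  by (simp add: descent_set_def)

lemma descent_set_subset: "descent_set n \<pi> \<subseteq> {1..n - 1}"
  by (auto simp: descent_set_def)

text \<open>A maximum at the end creates no descent. At \<open>j \<le> n\<close> it creates one at
  \<open>j\<close> and destroys the one between the former neighbours at \<open>j - 1\<close> and
  \<open>j\<close>, if they formed a descent. So the count survives exactly in the gaps that are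
  descents, and at the end.\<close>

lemma descents_rotation_to:
  assumes \<pi>: "\<pi> permutes {1..n}" and j: "j \<in> {1..Suc n}"
  shows "descents (Suc n) (\<pi> \<circ> rotation_to n j) =
    (if j \<in> insert (Suc n) (Suc ` descent_set n \<pi>) then descents n \<pi> else Suc (descents n \<pi>))"
proof -
  let ?D = "descent_set n \<pi>"
  have top: "\<pi> (Suc n) = Suc n"
    using \<pi> by (simp add: permutes_not_in)
  have le: "\<pi> i \<le> n" if "1 \<le> i" "i \<le> n" for i
    using permutes_in_image[OF \<pi>, of i] that by auto
  show ?thesis
  proof (cases "j = Suc n")
    case True
    have "descent_set (Suc n) (\<pi> \<circ> rotation_to n j) = ?D"
    proof (intro set_eqI)
      fix k
      show "k \<in> descent_set (Suc n) (\<pi> \<circ> rotation_to n j) \<longleftrightarrow> k \<in> ?D"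
        using True top le[of k] by (cases "k = n") (auto simp: descent_set_def rotation_to_def)
    qed
    then show ?thesis
      using True by (simp add: descents_eq_card)
  next
    case False
    with j have jn: "1 \<le> j" "j \<le> n" by auto
    \<comment> \<open>\<open>?s\<close> moves the old positions past the new letter. Position
      \<open>j - 1\<close> is dropped: the letter there is now followed by the maximum.\<close>
    let ?s = "\<lambda>k. if k < j then k else Suc k"
    have "descent_set (Suc n) (\<pi> \<circ> rotation_to n j) = insert j (?s ` (?D - {j - 1}))"
    proof (intro set_eqI)
      fix k
      consider "k = 0" | "0 < k" "k < j - 1" | "j > 1" "k = j - 1" | "k = j" | "k > j" 
        using jn by linarith
      then show "k \<in> descent_set (Suc n) (\<pi> \<circ> rotation_to n j) \<longleftrightarrow> k \<in> insert j (?s ` (?D - {j - 1}))"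
      proof cases
        case 1
        then show ?thesis using jn
          by (auto simp: descent_set_def split: if_splits)
      next
        case 2
        then show ?thesis using jn
          by (auto simp: descent_set_def rotation_to_def image_iff)
      next
        case 3
        then show ?thesis using jn top le[of k]
          by (auto simp: descent_set_def rotation_to_def image_iff)
      next
        case 4
        then show ?thesis using jn top le[of j]
          by (auto simp: descent_set_def rotation_to_def)
      next
        case 5
        then obtain l where l: "k = Suc l" "j \<le> l"
          by (metis Suc_le_D Suc_le_mono less_eq_Suc_le)
        then show ?thesis using jn 5
          by (auto simp: descent_set_def rotation_to_def image_iff)
      qed
    qed
    moreover have "card (insert j (?s ` (?D - {j - 1}))) = Suc (card (?D - {j - 1}))"
    proof -
      have inj: "inj_on ?s (?D - {j - 1})"
        by (auto simp: inj_on_def)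
      have "j \<notin> ?s ` (?D - {j - 1})"
        by (auto split: if_splits)
      then show ?thesis
        by (subst card_insert_disjoint) (auto simp only: card_image[OF inj] finite_imageI
          finite_Diff finite_descent_set)
    qed
    \<comment> \<open>For \<open>j = 1\<close> the right side asks for 0, which is never in
      \<open>?D\<close>; this is correct, since nothing precedes the maximum then.\<close>
    moreover have "j \<in> insert (Suc n) (Suc ` ?D) \<longleftrightarrow> j - 1 \<in> ?D"
      using False jn by (cases j) (auto simp: descent_set_def)
    moreover have "Suc (card (?D - {j - 1})) = (if j - 1 \<in> ?D then card ?D else Suc (card ?D))"
      by (auto simp: card_Suc_Diff1 Diff_triv simp del: card_Diff_insert card_Diff_singleton)
    ultimately show ?thesis
      by (simp add: descents_eq_card)
  qed
qed

lemma descents_le: "descents n \<pi> \<le> n - 1"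
  unfolding descents_eq_card using card_mono[OF _ descent_set_subset, of n \<pi>] by simp

lemma card_maximum_positions:
  "card (insert (Suc n) (Suc ` descent_set n \<pi>)) = Suc (descents n \<pi>)"
proof -
  have "Suc n \<notin> Suc ` descent_set n \<pi>"
    by (auto simp: descent_set_def)
  then show ?thesis
    by (simp add: descents_eq_card card_image)
qed

text \<open>These are the weights of the Eulerian recurrence. The function \<open>f\<close> is left
  arbitrary so that the indicator of a tail event can be inserted.\<close>

lemma sum_descents_rotation_to:
  fixes f :: "nat \<Rightarrow> real"
  assumes \<pi>: "\<pi> permutes {1..n}" and n: "n \<ge> 1"
  shows "(\<Sum>j\<in>{1..Suc n}. f (descents (Suc n) (\<pi> \<circ> rotation_to n j))) =
    (real (descents n \<pi>) + 1) * f (descents n \<pi>) +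
    (real n - real (descents n \<pi>)) * f (Suc (descents n \<pi>))"
proof -
  let ?S = "insert (Suc n) (Suc ` descent_set n \<pi>)"
  let ?d = "descents n \<pi>"
  have sub: "?S \<subseteq> {1..Suc n}"
    by (auto simp: descent_set_def)
  have "(\<Sum>j\<in>{1..Suc n}. f (descents (Suc n) (\<pi> \<circ> rotation_to n j))) =
      (\<Sum>j\<in>{1..Suc n}. if j \<in> ?S then f ?d else f (Suc ?d))"
    by (intro sum.cong refl) (use descents_rotation_to[OF \<pi>] in auto)
  also have "\<dots> = real (card ?S) * f ?d + real (card ({1..Suc n} - ?S)) * f (Suc ?d)"
    using sub
    by (simp only: sum.If_cases finite_atLeastAtMost Collect_mem_eq sum_constant Int_absorb1 Diff_eq)
  also have "card ({1..Suc n} - ?S) = n - ?d"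
    using sub by (subst card_Diff_subset) (auto simp: card_maximum_positions)
  also have "real (n - ?d) = real n - real ?d"
    using descents_le[of n \<pi>] n by (simp add: of_nat_diff)
  also have "real (card ?S) = real ?d + 1"
    by (simp add: card_maximum_positions)
  finally show ?thesis .
qed

text \<open>The threshold is an integer because the recurrence lowers it to \<open>m - 1\<close>,
  which must not be cut off at 0.\<close>

definition descent_tail :: "nat \<Rightarrow> int \<Rightarrow> real" where
  "descent_tail n m = measure_pmf.prob (uniform_perm n) {\<pi>. m \<le> int (descents n \<pi>)}"

lemma descent_tail_eq_sum:
  "descent_tail n m = (\<Sum>\<pi> | \<pi> permutes {1..n}. of_bool (m \<le> int (descents n \<pi>))) / fact n"
proof -
  have *: "{\<pi>. \<pi> permutes {1..n}} \<noteq> {}"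
    using permutes_id by blast
  have "{x. x permutes {1..n}} \<inter> {x. m \<le> int (descents n x)} =
     {x. x permutes {1..n} \<and> m \<le> int (descents n x)}" by auto
  then show ?thesis
    unfolding descent_tail_def uniform_perm_def
    by (subst measure_pmf_of_set[OF *])
      (simp_all add: finite_permutations card_permutes_atLeastAtMost of_bool_def sum.If_cases
        Int_def del: One_nat_def)
qed

text \<open>The Eulerian weights depend on the number \<open>d\<close> of descents, yet for tails
  they reduce to functions of \<open>m\<close>. If \<open>d \<ge> m\<close>, both weights count and
  add up to \<open>n + 1\<close>, as do \<open>m\<close> and \<open>n + 1 - m\<close>. If
  \<open>d = m - 1\<close>, only the second counts, and \<open>n - d = n + 1 - m\<close>. Smaller
  \<open>d\<close> contribute nothing.\<close>

lemma descent_tail_Suc: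
  assumes "n \<ge> 1"
  shows "descent_tail (Suc n) m =
    (real_of_int m * descent_tail n m + (real n + 1 - real_of_int m) * descent_tail n (m - 1)) / real (Suc n)"
proof -
  let ?P = "{\<pi>. \<pi> permutes {1..n}}"
  let ?b = "\<lambda>m \<pi>. of_bool (m \<le> int (descents n \<pi>)) :: real"
  have "(\<Sum>\<pi> | \<pi> permutes {1..Suc n}. of_bool (m \<le> int (descents (Suc n) \<pi>))) =
      (\<Sum>(j, \<pi>)\<in>{1..Suc n} \<times> ?P. of_bool (m \<le> int (descents (Suc n) (\<pi> \<circ> rotation_to n j))) :: real)"
    by (subst sum.reindex_bij_betw[OF bij_betw_insert_maximum, symmetric]) (simp add: case_prod_unfold)
  also have "\<dots> = (\<Sum>\<pi>\<in>?P. \<Sum>j\<in>{1..Suc n}. of_bool (m \<le> int (descents (Suc n) (\<pi> \<circ> rotation_to n j))))"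
    by (subst sum.cartesian_product[symmetric], subst sum.swap) simp
  also have "\<dots> = (\<Sum>\<pi>\<in>?P. real_of_int m * ?b m \<pi> + (real n + 1 - real_of_int m) * ?b (m - 1) \<pi>)"
  proof (intro sum.cong refl)
    fix \<pi> assume "\<pi> \<in> ?P"
    then have \<pi>: "\<pi> permutes {1..n}" by simp
    have "(\<Sum>j\<in>{1..Suc n}. of_bool (m \<le> int (descents (Suc n) (\<pi> \<circ> rotation_to n j)))) =
        (real (descents n \<pi>) + 1) * ?b m \<pi> +
        (real n - real (descents n \<pi>)) * of_bool (m \<le> int (Suc (descents n \<pi>)))"
      by (rule sum_descents_rotation_to[OF \<pi> assms])
    also have "\<dots> = real_of_int m * ?b m \<pi> + (real n + 1 - real_of_int m) * ?b (m - 1) \<pi>"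
    proof -
      consider "m \<le> int (descents n \<pi>)" | "m = int (descents n \<pi>) + 1" | "m > int (descents n \<pi>) + 1"
        by linarith
      then show ?thesis
        by cases simp_all
    qed
    finally show "(\<Sum>j\<in>{1..Suc n}. of_bool (m \<le> int (descents (Suc n) (\<pi> \<circ> rotation_to n j)))) =
       real_of_int m * ?b m \<pi> + (real n + 1 - real_of_int m) * ?b (m - 1) \<pi>" .
  qed
  also have "\<dots> = real_of_int m * sum (?b m) ?P + (real n + 1 - real_of_int m) * sum (?b (m - 1)) ?P"
    by (simp only: sum.distrib sum_distrib_left)
  finally have "descent_tail (Suc n) m =
      (real_of_int m * sum (?b m) ?P + (real n + 1 - real_of_int m) * sum (?b (m - 1)) ?P) / fact (Suc n)"
    by (simp only: descent_tail_eq_sum)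
  then show ?thesis
    by (simp only: descent_tail_eq_sum fact_Suc add_divide_distrib times_divide_eq_right
        divide_divide_eq_left of_nat_mult mult.commute[of "fact n"])
qed

lemma descent_tail_1: "descent_tail 1 m = of_bool (m \<le> 0)"
  using descents_le[of 1] card_permutes_atLeastAtMost[of 1]
  by (simp add: descent_tail_eq_sum)

section \<open>The tail as a vertical line integral\<close>

lemma integrable_inverse_sum_squares:
  assumes "t > 0"
  shows "integrable lborel (\<lambda>v::real. 1 / (t\<^sup>2 + v\<^sup>2))"
proof -
  have "integrable lborel (\<lambda>v::real. inverse (1 + v\<^sup>2))"
    using integrable_inverse_1_plus_square by (simp add: set_integrable_def einterval_def)
  then have "integrable lborel (\<lambda>v::real. inverse (1 + (0 + (1 / t) * v)\<^sup>2))"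
    using assms by (intro lborel_integrable_real_affine) auto
  then have "integrable lborel (\<lambda>v::real. inverse (t\<^sup>2) * inverse (1 + (0 + (1 / t) * v)\<^sup>2))"
    by (rule integrable_mult_right)
  also have "(\<lambda>v::real. inverse (t\<^sup>2) * inverse (1 + (0 + (1 / t) * v)\<^sup>2)) = (\<lambda>v. 1 / (t\<^sup>2 + v\<^sup>2))"
  proof
    fix v :: real
    have "t\<^sup>2 * (1 + (0 + (1 / t) * v)\<^sup>2) = t\<^sup>2 + v\<^sup>2"
      using assms by (simp add: distrib_left power_divide)
    then show "inverse (t\<^sup>2) * inverse (1 + (0 + (1 / t) * v)\<^sup>2) = 1 / (t\<^sup>2 + v\<^sup>2)"
      by (metis inverse_mult_distrib inverse_eq_divide)
  qed
  finally show ?thesis .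
qed

lemma tendsto_integral_symmetric:
  fixes f :: "real \<Rightarrow> 'a :: {banach, second_countable_topology}"
  assumes f: "integrable lborel f"
  shows "((\<lambda>R. \<integral>x. indicator {-R..R} x *\<^sub>R f x \<partial>lborel) \<longlongrightarrow> (\<integral>x. f x \<partial>lborel)) at_top"
proof (rule integral_dominated_convergence_at_top[where w = "\<lambda>x. norm (f x)"])
  show "AE x in lborel. ((\<lambda>R. indicator {-R..R} x *\<^sub>R f x) \<longlongrightarrow> f x) at_top"
  proof (intro AE_I2)
    fix x :: real
    have "\<forall>\<^sub>F R in at_top. indicator {-R..R} x *\<^sub>R f x = f x"
      using eventually_ge_at_top[of "\<bar>x\<bar>"] by eventually_elim (auto simp: indicator_def)
    then show "((\<lambda>R. indicator {-R..R} x *\<^sub>R f x) \<longlongrightarrow> f x) at_top"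
      by (rule tendsto_eventually)
  qed
  show "\<forall>\<^sub>F R in at_top. AE x in lborel. norm (indicator {-R..R} x *\<^sub>R f x) \<le> norm (f x)"
    by (intro always_eventually allI AE_I2) (auto simp: indicator_def)
qed (use f in auto)

text \<open>Integration by parts without boundary terms: integrability allows the whole integral to
  be computed as a limit over \<open>[-R, R]\<close>.\<close>

lemma integral_derivative_eq_0:
  fixes F f :: "real \<Rightarrow> complex"
  assumes F: "\<And>v. (F has_vector_derivative f v) (at v)"
    and cont: "continuous_on UNIV f" and f: "integrable lborel f"
    and top: "(F \<longlongrightarrow> 0) at_top" and bot: "(F \<longlongrightarrow> 0) at_bot"
  shows "(\<integral>v. f v \<partial>lborel) = 0"
proof -
  have "((\<lambda>R. F R - F (- R)) \<longlongrightarrow> 0 - 0) at_top"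
    by (intro tendsto_diff top filterlim_compose[OF bot] filterlim_uminus_at_bot_at_top)
  then have "((\<lambda>R. \<integral>x. indicator {-R..R} x *\<^sub>R f x \<partial>lborel) \<longlongrightarrow> 0 - 0) at_top"
  proof (rule Lim_transform_eventually)
    show "\<forall>\<^sub>F R in at_top. F R - F (- R) = (\<integral>x. indicator {-R..R} x *\<^sub>R f x \<partial>lborel)"
      using eventually_ge_at_top[of 0]
    proof eventually_elim
      case (elim R)
      then show ?case
        by (subst integral_FTC_atLeastAtMost[of _ _ F])
          (auto intro: has_vector_derivative_at_within F continuous_on_subset[OF cont])
    qed
  qed
  from tendsto_unique[OF _ this tendsto_integral_symmetric[OF f]] show ?thesis
    by simp
qed

section \<open>The Bromwich integral and its recurrence\<close>

definition bromwich_kernel :: "nat \<Rightarrow> real \<Rightarrow> complex \<Rightarrow> complex" where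
  "bromwich_kernel n m z = (exp z - 1) ^ n * exp (- of_real m * z) / z ^ Suc n"

lemma norm_complex_eq: "(cmod (Complex t v))\<^sup>2 = t\<^sup>2 + v\<^sup>2"
  by (simp add: cmod_power2)

lemma Complex_neq_0: "t > 0 \<Longrightarrow> Complex t v \<noteq> 0"
  by (simp add: complex_eq_iff)

lemma continuous_on_Complex [continuous_intros]: "continuous_on S (Complex t)"
proof -
  have "Complex t = (\<lambda>v. of_real t + \<i> * of_real v)"
    by (simp add: fun_eq_iff complex_eq_iff)
  then show ?thesis
    by (simp add: continuous_intros)
qed

lemma continuous_bromwich_kernel:
  assumes "t > 0"
  shows "continuous_on UNIV (\<lambda>v. bromwich_kernel n m (Complex t v))"
  unfolding bromwich_kernel_def using Complex_neq_0[OF assms] by (intro continuous_intros) auto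

lemma norm_exp_minus_1_le: "cmod (exp (Complex t v) - 1) \<le> exp t + 1"
  using norm_triangle_ineq4[of "exp (Complex t v)" 1] by simp

lemma norm_bromwich_kernel_le:
  assumes "t > 0"
  shows "cmod (bromwich_kernel n m (Complex t v)) \<le> (exp t + 1) ^ n * exp (- m * t) / cmod (Complex t v) ^ Suc n"
proof -
  have "cmod (bromwich_kernel n m (Complex t v)) =
      cmod (exp (Complex t v) - 1) ^ n * exp (- m * t) / cmod (Complex t v) ^ Suc n"
    by (simp add: bromwich_kernel_def norm_divide norm_mult norm_power del: power_Suc complex_norm)
  also have "\<dots> \<le> (exp t + 1) ^ n * exp (- m * t) / cmod (Complex t v) ^ Suc n"
    using norm_exp_minus_1_le[of t v]
    by (intro divide_right_mono mult_right_mono power_mono) auto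
  finally show ?thesis .
qed

text \<open>Two of the \<open>n + 1\<close> powers of \<open>|z|\<close> in the denominator supply
  \<open>t^2 + v^2\<close>; the other \<open>n - 1\<close> are bounded below by powers of
  \<open>t\<close>. This is where \<open>n \<ge> 1\<close> enters.\<close>

lemma integrable_bromwich_kernel:
  assumes t: "t > 0" and n: "n \<ge> 1"
  shows "integrable lborel (\<lambda>v. bromwich_kernel n m (Complex t v))"
proof (rule Bochner_Integration.integrable_bound)
  let ?C = "(exp t + 1) ^ n * exp (- m * t) / t ^ (n - 1)"
  show "integrable lborel (\<lambda>v. ?C * (1 / (t\<^sup>2 + v\<^sup>2)))"
    by (intro integrable_mult_right integrable_inverse_sum_squares t)
  show "(\<lambda>v. bromwich_kernel n m (Complex t v)) \<in> borel_measurable lborel"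
    using borel_measurable_continuous_onI[OF continuous_bromwich_kernel[OF t]] by simp
  show "AE v in lborel. norm (bromwich_kernel n m (Complex t v)) \<le> norm (?C * (1 / (t\<^sup>2 + v\<^sup>2)))"
  proof (intro AE_I2)
    fix v
    let ?r = "cmod (Complex t v)"
    have "t \<le> ?r"
      using abs_Re_le_cmod[of "Complex t v"] t by simp
    then have r: "t ^ (n - 1) \<le> ?r ^ (n - 1)"
      using t by (intro power_mono) auto
    have "Suc n = (n - 1) + 2"
      using n by simp
    then have "?r ^ Suc n = ?r ^ (n - 1) * (t\<^sup>2 + v\<^sup>2)"
      by (simp only: power_add norm_complex_eq)
    also have "\<dots> \<ge> t ^ (n - 1) * (t\<^sup>2 + v\<^sup>2)"
      using r by (intro mult_right_mono) auto
    finally have "(exp t + 1) ^ n * exp (- m * t) / ?r ^ Suc n \<le>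
        (exp t + 1) ^ n * exp (- m * t) / (t ^ (n - 1) * (t\<^sup>2 + v\<^sup>2))"
      using t \<open>t \<le> ?r\<close> by (intro divide_left_mono mult_pos_pos zero_less_power add_pos_nonneg) auto
    with norm_bromwich_kernel_le[OF t, of n m v]
    show "norm (bromwich_kernel n m (Complex t v)) \<le> norm (?C * (1 / (t\<^sup>2 + v\<^sup>2)))"
      using t by (simp add: abs_mult)
  qed
qed

definition bromwich :: "nat \<Rightarrow> real \<Rightarrow> real \<Rightarrow> complex" where
  "bromwich n t m = (\<integral>v. bromwich_kernel n m (Complex t v) \<partial>lborel) / (2 * pi)"

lemma has_vector_derivative_Complex:
  assumes "(g has_field_derivative g') (at (Complex t v))"
  shows "((\<lambda>v. g (Complex t v)) has_vector_derivative \<i> * g') (at v)"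
proof -
  have "(Complex t has_vector_derivative \<i>) (at v)"
  proof -
    have "Complex t = (\<lambda>v. of_real t + \<i> * of_real v)"
      by (simp add: fun_eq_iff complex_eq_iff)
    then show ?thesis
      by (auto intro!: derivative_eq_intros simp: has_vector_derivative_def scaleR_conv_of_real)
  qed
  from field_vector_diff_chain_at[OF this assms] show ?thesis
    by (simp add: o_def)
qed

text \<open>The difference of the two sides is, up to a constant, the integral of a total derivative
  along the line, so it vanishes. The shift to \<open>m - 1\<close> arises from
  \<open>exp z * exp (- m z) = exp (- (m - 1) z)\<close>.\<close>

lemma bromwich_Suc:
  assumes t: "t > 0" and n: "n \<ge> 1"
  shows "bromwich (Suc n) t m =
    (of_real m * bromwich n t m + (of_nat n + 1 - of_real m) * bromwich n t (m - 1)) / of_nat (Suc n)"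
proof -
  \<comment> \<open>The antiderivative is the kernel for \<open>n + 1\<close> with one power of
    \<open>z\<close> less in the denominator, so it still decays like
    \<open>1 / |v|\<close>.\<close>
  define w where "w z = (exp z - 1) ^ Suc n * exp (- of_real m * z) / z ^ Suc n" for z :: complex
  define f where "f v = \<i> * (of_real m * bromwich_kernel n m (Complex t v)
    + (of_nat n + 1 - of_real m) * bromwich_kernel n (m - 1) (Complex t v)
    - of_nat (Suc n) * bromwich_kernel (Suc n) m (Complex t v))" for v
  have w': "(w has_field_derivative
      (of_real m * bromwich_kernel n m z + (of_nat n + 1 - of_real m) * bromwich_kernel n (m - 1) z
       - of_nat (Suc n) * bromwich_kernel (Suc n) m z)) (at z)" if "z \<noteq> 0" for z
  proof -
    have e: "exp (- of_real (m - 1) * z) = exp z * exp (- of_real m * z)"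
      by (simp add: algebra_simps flip: exp_add)
    have "(w has_field_derivative
       (((of_nat (Suc n) * (exp z - 1) ^ n * exp z) * exp (- of_real m * z)
         + (exp z - 1) ^ Suc n * (exp (- of_real m * z) * (- of_real m))) * z ^ Suc n
         - (exp z - 1) ^ Suc n * exp (- of_real m * z) * (of_nat (Suc n) * z ^ n)) / (z ^ Suc n * z ^ Suc n)) (at z)"
    proof -
      have d1: "((\<lambda>z. (exp z - 1) ^ Suc n) has_field_derivative of_nat (Suc n) * (exp z - 1) ^ n * exp z) (at z)"
        by (rule derivative_eq_intros refl)+ simp
      have d2: "((\<lambda>z. exp (- of_real m * z)) has_field_derivative exp (- of_real m * z) * (- of_real m)) (at z)"
        by (rule derivative_eq_intros refl)+ simp
      have d3: "((\<lambda>z. z ^ Suc n) has_field_derivative of_nat (Suc n) * z ^ n) (at z)"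
        by (rule derivative_eq_intros refl)+ simp
      have "z ^ Suc n \<noteq> 0"
        using that by simp
      from DERIV_divide[OF DERIV_mult[OF d1 d2] d3 this] show ?thesis
        unfolding w_def by (simp only: mult.commute[of "exp (- of_real m * z) * (- of_real m)"])
    qed
    also have "(((of_nat (Suc n) * (exp z - 1) ^ n * exp z) * exp (- of_real m * z)
         + (exp z - 1) ^ Suc n * (exp (- of_real m * z) * (- of_real m))) * z ^ Suc n
         - (exp z - 1) ^ Suc n * exp (- of_real m * z) * (of_nat (Suc n) * z ^ n)) / (z ^ Suc n * z ^ Suc n)
       = of_real m * bromwich_kernel n m z + (of_nat n + 1 - of_real m) * bromwich_kernel n (m - 1) z
       - of_nat (Suc n) * bromwich_kernel (Suc n) m z"
    proof -
      define E where "E = exp (- of_real m * z)"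
      define X where "X = (exp z - 1) ^ n"
      define Z where "Z = z ^ n"
      have "Z \<noteq> 0" using that by (simp add: Z_def)
      \<comment> \<open>With \<open>E\<close>, \<open>X\<close>, \<open>Z\<close> opaque and
        \<open>N = n + 1\<close>, \<open>a = exp z\<close>, \<open>c = m\<close>, the quotient rule
        result is compared as a rational function.\<close>
      have "((N * X * a * E + (a - 1) * X * (E * - c)) * (z * Z) - (a - 1) * X * E * (N * Z)) / (z * Z * (z * Z))
          = c * (X * E / (z * Z)) + (N - c) * (X * (a * E) / (z * Z)) - N * ((a - 1) * X * E / (z * (z * Z)))"
        for N a c :: complex
      proof -
        have q: "(A * (z * Z) - B * (N * Z)) / (z * Z * (z * Z)) = A / (z * Z) - N * (B / (z * (z * Z)))" for A B
          using that \<open>Z \<noteq> 0\<close> by (simp add: field_simps)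
        have p: "N * X * a * E + (a - 1) * X * (E * - c) = c * (X * E) + (N - c) * (X * (a * E))"
          by (simp add: algebra_simps)
        show ?thesis
          unfolding q unfolding p by (simp only: add_divide_distrib times_divide_eq_right)
      qed
      from this[of "of_nat (Suc n)" "exp z" "of_real m"] show ?thesis
        unfolding bromwich_kernel_def e power_Suc E_def[symmetric] X_def[symmetric] Z_def[symmetric]
        by (simp only: of_nat_Suc add.commute[of 1])
    qed
    finally show ?thesis .
  qed
  have int: "integrable lborel f"
    unfolding f_def
    by (intro Bochner_Integration.integrable_diff Bochner_Integration.integrable_add
        integrable_mult_right integrable_bromwich_kernel t) (use n in auto)
  \<comment> \<open>One factor of the denominator is bounded below by \<open>|v|\<close> to obtain
    decay, the remaining \<open>n\<close> factors by \<open>t\<close>.\<close>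
  have bound: "norm (w (Complex t v)) \<le> (exp t + 1) ^ Suc n * exp (- m * t) / t ^ n * (1 / \<bar>v\<bar>)"
    if "v \<noteq> 0" for v
  proof -
    let ?r = "cmod (Complex t v)"
    have r: "t \<le> ?r" "\<bar>v\<bar> \<le> ?r"
      using abs_Re_le_cmod[of "Complex t v"] abs_Im_le_cmod[of "Complex t v"] t by simp_all
    have "norm (w (Complex t v)) = cmod (exp (Complex t v) - 1) ^ Suc n * exp (- m * t) / ?r ^ Suc n"
      by (simp add: w_def norm_divide norm_mult norm_power del: complex_norm power_Suc)
    also have "\<dots> \<le> (exp t + 1) ^ Suc n * exp (- m * t) / (t ^ n * \<bar>v\<bar>)"
      using r t that norm_exp_minus_1_le[of t v] unfolding power_Suc2[of ?r]
      by (intro frac_le mult_right_mono power_mono mult_mono) auto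
    finally show ?thesis by simp
  qed
  \<comment> \<open>Stated for any filter along which \<open>|v|\<close> tends to infinity, so that
    it serves both ends of the line.\<close>
  have lim: "((\<lambda>v. w (Complex t v)) \<longlongrightarrow> 0) F" if F: "filterlim abs at_top F" for F
  proof (rule Lim_null_comparison)
    show "\<forall>\<^sub>F v in F. norm (w (Complex t v)) \<le> (exp t + 1) ^ Suc n * exp (- m * t) / t ^ n * (1 / \<bar>v\<bar>)"
    proof -
      have "\<forall>\<^sub>F v in F. 1 \<le> \<bar>v\<bar>"
        using F unfolding filterlim_at_top by blast
      then show ?thesis
        by eventually_elim (rule bound, simp)
    qed
    have "((\<lambda>v. 1 / \<bar>v\<bar>) \<longlongrightarrow> (0::real)) F"
      using tendsto_divide_0[OF tendsto_const filterlim_at_top_imp_at_infinity[OF F]] by simp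
    from tendsto_mult_right_zero[OF this]
    show "((\<lambda>v. (exp t + 1) ^ Suc n * exp (- m * t) / t ^ n * (1 / \<bar>v\<bar>)) \<longlongrightarrow> 0) F" .
  qed
  have "(\<integral>v. f v \<partial>lborel) = 0"
  proof (rule integral_derivative_eq_0[where F = "\<lambda>v. w (Complex t v)"])
    show "((\<lambda>v. w (Complex t v)) has_vector_derivative f v) (at v)" for v
      unfolding f_def by (rule has_vector_derivative_Complex[OF w']) (rule Complex_neq_0[OF t])
    show "continuous_on UNIV f"
      unfolding f_def by (intro continuous_intros continuous_bromwich_kernel t)
    have "filterlim (\<lambda>v::real. \<bar>v\<bar>) at_top at_bot"
      using filterlim_compose[OF filterlim_abs_real filterlim_uminus_at_top_at_bot] by simp
    then show "((\<lambda>v. w (Complex t v)) \<longlongrightarrow> 0) at_bot"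
      by (rule lim)
  qed (auto intro: lim int filterlim_abs_real)
  moreover have "(\<integral>v. f v \<partial>lborel) = \<i> * (of_real m * (\<integral>v. bromwich_kernel n m (Complex t v) \<partial>lborel)
    + (of_nat n + 1 - of_real m) * (\<integral>v. bromwich_kernel n (m - 1) (Complex t v) \<partial>lborel)
    - of_nat (Suc n) * (\<integral>v. bromwich_kernel (Suc n) m (Complex t v) \<partial>lborel))"
    unfolding f_def using n
    by (simp add: integrable_bromwich_kernel[OF t] del: of_nat_Suc)
  ultimately have "of_nat (Suc n) * (\<integral>v. bromwich_kernel (Suc n) m (Complex t v) \<partial>lborel) =
    of_real m * (\<integral>v. bromwich_kernel n m (Complex t v) \<partial>lborel)
    + (of_nat n + 1 - of_real m) * (\<integral>v. bromwich_kernel n (m - 1) (Complex t v) \<partial>lborel)"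
    by simp
  then have "of_nat (Suc n) * bromwich (Suc n) t m =
    of_real m * bromwich n t m + (of_nat n + 1 - of_real m) * bromwich n t (m - 1)"
    unfolding bromwich_def times_divide_eq_right by (simp only: add_divide_distrib)
  then show ?thesis
    by (simp add: nonzero_eq_divide_eq mult.commute del: of_nat_Suc)
qed

section \<open>The initial value at \<open>n = 1\<close> by residues\<close>

definition ramp_kernel :: "real \<Rightarrow> complex \<Rightarrow> complex" where
  "ramp_kernel c z = exp (of_real c * z) / z\<^sup>2"

lemma continuous_on_ramp_kernel: "0 \<notin> S \<Longrightarrow> continuous_on S (ramp_kernel c)"
  unfolding ramp_kernel_def by (auto intro!: continuous_intros)

lemma holomorphic_on_ramp_kernel: "0 \<notin> S \<Longrightarrow> ramp_kernel c holomorphic_on S"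
  unfolding ramp_kernel_def by (auto intro!: holomorphic_intros)

lemma norm_ramp_kernel_side_le:
  assumes R: "R > 0" and seg: "\<And>z. z \<in> closed_segment p q \<Longrightarrow> R \<le> cmod z \<and> c * Re z \<le> K"
  shows "cmod (contour_integral (linepath p q) (ramp_kernel c)) \<le> exp K / R\<^sup>2 * cmod (q - p)"
proof (rule contour_integral_bound_linepath)
  have "0 \<notin> closed_segment p q"
    using seg[of 0] R by auto
  then show "ramp_kernel c contour_integrable_on linepath p q"
    by (intro contour_integrable_continuous_linepath continuous_on_ramp_kernel)
  fix z assume "z \<in> closed_segment p q"
  then have z: "R \<le> cmod z" "c * Re z \<le> K"
    using seg by auto
  show "cmod (ramp_kernel c z) \<le> exp K / R\<^sup>2"
    unfolding ramp_kernel_def norm_divide norm_power norm_exp_eq_Re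
    using z R by (intro frac_le power_mono) auto
qed simp

lemma contour_integral_rectpath_split:
  assumes "0 \<notin> path_image (rectpath a b)" "Re a \<le> Re b" "Im a \<le> Im b"
  shows "contour_integral (rectpath a b) (ramp_kernel c) =
    contour_integral (linepath a (Complex (Re b) (Im a))) (ramp_kernel c) +
    contour_integral (linepath (Complex (Re b) (Im a)) b) (ramp_kernel c) +
    contour_integral (linepath b (Complex (Re a) (Im b))) (ramp_kernel c) +
    contour_integral (linepath (Complex (Re a) (Im b)) a) (ramp_kernel c)"
proof -
  have "path_image (rectpath a b) = closed_segment a (Complex (Re b) (Im a)) \<union>
      closed_segment (Complex (Re b) (Im a)) b \<union> closed_segment b (Complex (Re a) (Im b)) \<union>
      closed_segment (Complex (Re a) (Im b)) a"
    by (simp add: rectpath_def Let_def path_image_join Un_assoc)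
  then have "ramp_kernel c contour_integrable_on linepath a (Complex (Re b) (Im a))"
    "ramp_kernel c contour_integrable_on linepath (Complex (Re b) (Im a)) b"
    "ramp_kernel c contour_integrable_on linepath b (Complex (Re a) (Im b))"
    "ramp_kernel c contour_integrable_on linepath (Complex (Re a) (Im b)) a"
    using assms(1) by (auto intro!: contour_integrable_continuous_linepath continuous_on_ramp_kernel)
  then show ?thesis
    by (simp add: rectpath_def Let_def contour_integrable_joinI)
qed

lemma contour_integral_vertical:
  assumes t: "t > 0" and R: "R > 0"
  shows "contour_integral (linepath (Complex t (-R)) (Complex t R)) (ramp_kernel c) =
    \<i> * (\<integral>v. indicator {-R..R} v *\<^sub>R ramp_kernel c (Complex t v) \<partial>lborel)"
proof -
  have "continuous_on {-R..R} (\<lambda>v. ramp_kernel c (Complex t v))"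
    unfolding ramp_kernel_def using Complex_neq_0[OF t] by (auto intro!: continuous_intros)
  then have "set_integrable lborel {-R..R} (\<lambda>v. ramp_kernel c (Complex t v))"
    by (intro borel_integrable_atLeastAtMost')
  from set_borel_integral_eq_integral(2)[OF this] show ?thesis
    using R by (subst contour_integral_linepath_same_Re[of _ t _ "-R" R])
      (auto simp: set_lebesgue_integral_def)
qed

lemma integrable_ramp_kernel:
  assumes t: "t > 0"
  shows "integrable lborel (\<lambda>v. ramp_kernel c (Complex t v))"
proof (rule Bochner_Integration.integrable_bound)
  show "integrable lborel (\<lambda>v. exp (c * t) * (1 / (t\<^sup>2 + v\<^sup>2)))"
    by (intro integrable_mult_right integrable_inverse_sum_squares t)
  have "continuous_on UNIV (\<lambda>v. ramp_kernel c (Complex t v))"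
    unfolding ramp_kernel_def using Complex_neq_0[OF t] by (auto intro!: continuous_intros)
  from borel_measurable_continuous_onI[OF this]
  show "(\<lambda>v. ramp_kernel c (Complex t v)) \<in> borel_measurable lborel"
    by simp
  show "AE v in lborel. norm (ramp_kernel c (Complex t v)) \<le> norm (exp (c * t) * (1 / (t\<^sup>2 + v\<^sup>2)))"
    by (intro AE_I2) (simp add: ramp_kernel_def norm_divide norm_power cmod_power2 del: complex_norm)
qed

text \<open>The rectangle is closed on the side of the line where the exponential is bounded; on the
  left it encloses the double pole at the origin.\<close>

lemma contour_integral_ramp_kernel:
  assumes t: "t > 0" and R: "R > t"
  shows "cmod (\<i> * (\<integral>v. indicator {-R..R} v *\<^sub>R ramp_kernel c (Complex t v) \<partial>lborel)
      - 2 * pi * \<i> * of_real (max c 0)) \<le> 6 * exp (max (c * t) 0) / R"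
proof -
  let ?I = "\<lambda>p q. contour_integral (linepath p q) (ramp_kernel c)"
  let ?K = "max (c * t) 0"
  have R0: "R > 0" using t R by simp
  have vert: "?I (Complex t (-R)) (Complex t R) =
      \<i> * (\<integral>v. indicator {-R..R} v *\<^sub>R ramp_kernel c (Complex t v) \<partial>lborel)"
    by (rule contour_integral_vertical[OF t R0])
  have norm_ge: "R \<le> cmod z" if "R \<le> \<bar>Re z\<bar> \<or> R \<le> \<bar>Im z\<bar>" for z
    using that abs_Re_le_cmod[of z] abs_Im_le_cmod[of z] by linarith
  \<comment> \<open>A side has length at most \<open>2 * R\<close> (as \<open>t < R\<close>) and
    carries an integrand of size at most \<open>exp ?K / R^2\<close>. The three sides other than the
    line together give the constant 6.\<close>
  have side: "cmod (?I p q) \<le> 2 * exp ?K / R" if "\<bar>Re (q - p)\<bar> + \<bar>Im (q - p)\<bar> \<le> 2 * R"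
    "\<And>z. z \<in> closed_segment p q \<Longrightarrow> (R \<le> \<bar>Re z\<bar> \<or> R \<le> \<bar>Im z\<bar>) \<and> c * Re z \<le> ?K" for p q
  proof -
    have "cmod (?I p q) \<le> exp ?K / R\<^sup>2 * cmod (q - p)"
      using that(2) norm_ge by (intro norm_ramp_kernel_side_le R0) auto
    also have "\<dots> \<le> exp ?K / R\<^sup>2 * (2 * R)"
      using that(1) cmod_le[of "q - p"] by (intro mult_left_mono) auto
    also have "\<dots> = 2 * exp ?K / R"
      using R0 by (simp add: power2_eq_square)
    finally show ?thesis .
  qed
  show ?thesis
  proof (cases "c > 0")
    case True
    let ?a = "Complex (-R) (-R)" and ?b = "Complex t R"
    have c: "c * x \<le> ?K" if "x \<le> t" for x
      using True that by (simp add: le_max_iff_disj)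
    have box: "0 \<in> box ?a ?b"
      using t R0 by (simp add: in_box_complex_iff)
    have path: "path_image (rectpath ?a ?b) = cbox ?a ?b - box ?a ?b"
      using t R0 by (intro path_image_rectpath_cbox_minus_box) auto
    have "contour_integral (rectpath ?a ?b) (ramp_kernel c) =
        2 * pi * \<i> * (\<Sum>p\<in>{0}. winding_number (rectpath ?a ?b) p * residue (ramp_kernel c) p)"
      by (rule Residue_theorem[of UNIV])
        (use box path in \<open>auto intro: holomorphic_on_ramp_kernel\<close>)
    moreover have "winding_number (rectpath ?a ?b) 0 = 1"
      using box by (intro winding_number_rectpath)
    moreover have "residue (ramp_kernel c) 0 = of_real c"
    proof -
      have "(\<lambda>z. exp (of_real c * z)) holomorphic_on UNIV"
        by (intro holomorphic_intros)
      from residue_holomorphic_over_power'[OF open_UNIV UNIV_I this, of 1]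
      have "residue (\<lambda>z. exp (of_real c * z) / z ^ Suc 1) 0 = deriv (\<lambda>z. exp (of_real c * z)) 0"
        by simp
      also have "deriv (\<lambda>z. exp (of_real c * z)) (0::complex) = of_real c"
        by (rule DERIV_imp_deriv) (auto intro!: derivative_eq_intros)
      finally show ?thesis
        by (simp add: ramp_kernel_def[abs_def] numeral_2_eq_2)
    qed
    moreover have "contour_integral (rectpath ?a ?b) (ramp_kernel c) =
        ?I ?a (Complex t (-R)) + ?I (Complex t (-R)) ?b + ?I ?b (Complex (-R) R) + ?I (Complex (-R) R) ?a"
      using contour_integral_rectpath_split[of ?a ?b c] box path t R0 by auto
    ultimately have "?I (Complex t (-R)) ?b - 2 * pi * \<i> * of_real c =
        - (?I ?a (Complex t (-R)) + ?I ?b (Complex (-R) R) + ?I (Complex (-R) R) ?a)"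
      by (simp add: algebra_simps)
    also have "cmod \<dots> \<le> 2 * exp ?K / R + 2 * exp ?K / R + 2 * exp ?K / R"
      unfolding norm_minus_cancel using t R c c[of "-R"]
      by (intro order_trans[OF norm_triangle_ineq] add_mono side)
        (auto simp: closed_segment_same_Re closed_segment_same_Im closed_segment_eq_real_ivl)
    finally show ?thesis
      using True by (simp add: vert max_def)
  next
    case False
    let ?a = "Complex t (-R)" and ?b = "Complex (t + R) R"
    have c: "c * x \<le> ?K" if "t \<le> x" for x
      using False that t by (simp add: le_max_iff_disj mult_nonpos_nonneg)
    have path: "path_image (rectpath ?a ?b) \<subseteq> {z. Re z > 0}"
      using path_image_rectpath_subset_cbox[of ?a ?b] t R0 by (force simp: in_cbox_complex_iff)
    have "(ramp_kernel c has_contour_integral 0) (rectpath ?a ?b)"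
      by (rule Cauchy_theorem_convex_simple[of _ "{z. Re z > 0}"])
        (use path in \<open>auto intro: holomorphic_on_ramp_kernel convex_halfspace_Re_gt\<close>)
    then have "0 = contour_integral (rectpath ?a ?b) (ramp_kernel c)"
      by (simp add: contour_integral_unique)
    also have "\<dots> = ?I ?a (Complex (t + R) (-R)) + ?I (Complex (t + R) (-R)) ?b + ?I ?b (Complex t R) + ?I (Complex t R) ?a"
      using path t R0 by (subst contour_integral_rectpath_split) auto
    also have "?I (Complex t R) ?a = - ?I ?a (Complex t R)"
    proof -
      have "continuous_on (closed_segment (Complex t R) ?a) (ramp_kernel c)"
        using t by (auto intro!: continuous_on_ramp_kernel simp: closed_segment_same_Re)
      from contour_integral_reverse_linepath[OF this] show ?thesis
        by simp
    qed
    finally have "?I ?a (Complex t R) =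
        ?I ?a (Complex (t + R) (-R)) + ?I (Complex (t + R) (-R)) ?b + ?I ?b (Complex t R)"
      by (simp add: algebra_simps)
    also have "cmod \<dots> \<le> 2 * exp ?K / R + 2 * exp ?K / R + 2 * exp ?K / R"
      using t R c c[of "t + R"]
      by (intro order_trans[OF norm_triangle_ineq] add_mono side)
        (auto simp: closed_segment_same_Re closed_segment_same_Im closed_segment_eq_real_ivl)
    finally show ?thesis
      using False by (simp add: vert max_def)
  qed
qed

text \<open>The inverse Laplace transform of \<open>1 / z^2\<close> is the ramp function
  \<open>max c 0\<close>. It is the limit of the truncated estimate as \<open>R\<close>
  grows.\<close>

lemma integral_ramp_kernel:
  assumes t: "t > 0"
  shows "(\<integral>v. ramp_kernel c (Complex t v) \<partial>lborel) = of_real (2 * pi * max c 0)"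
proof -
  let ?J = "\<lambda>R. \<integral>v. indicator {-R..R} v *\<^sub>R ramp_kernel c (Complex t v) \<partial>lborel"
  have "((\<lambda>R. \<i> * ?J R - 2 * pi * \<i> * of_real (max c 0)) \<longlongrightarrow> 0) at_top"
  proof (rule Lim_null_comparison)
    show "\<forall>\<^sub>F R in at_top. norm (\<i> * ?J R - 2 * pi * \<i> * of_real (max c 0)) \<le> 6 * exp (max (c * t) 0) / R"
      using eventually_gt_at_top[of t] by eventually_elim (rule contour_integral_ramp_kernel[OF t])
    show "((\<lambda>R. 6 * exp (max (c * t) 0) / R) \<longlongrightarrow> 0) at_top"
      by (intro tendsto_divide_0[OF tendsto_const] filterlim_at_top_imp_at_infinity filterlim_ident)
  qed
  moreover have "((\<lambda>R. \<i> * ?J R - 2 * pi * \<i> * of_real (max c 0)) \<longlongrightarrow>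
      \<i> * (\<integral>v. ramp_kernel c (Complex t v) \<partial>lborel) - 2 * pi * \<i> * of_real (max c 0)) at_top"
    by (intro tendsto_intros tendsto_integral_symmetric integrable_ramp_kernel t)
  ultimately have "\<i> * (\<integral>v. ramp_kernel c (Complex t v) \<partial>lborel) - 2 * pi * \<i> * of_real (max c 0) = 0"
    by (intro tendsto_unique[OF trivial_limit_at_top_linorder])
  then have "\<i> * (\<integral>v. ramp_kernel c (Complex t v) \<partial>lborel) = \<i> * of_real (2 * pi * max c 0)"
    by (simp add: mult_ac)
  then show ?thesis
    by (simp only: mult_cancel_left) simp
qed

text \<open>The kernel is the difference of the ramp kernels at \<open>1 - m\<close> and
  \<open>- m\<close>. The difference of the two ramps is an indicator only at integers; in between
  it is linear.\<close>

lemma bromwich_1: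
  assumes "t > 0"
  shows "bromwich 1 t (of_int m) = of_bool (m \<le> 0)"
proof -
  have "bromwich_kernel 1 (of_int m) z = ramp_kernel (1 - of_int m) z - ramp_kernel (- of_int m) z" for z
    by (simp add: bromwich_kernel_def ramp_kernel_def diff_divide_distrib power2_eq_square algebra_simps
        flip: exp_add)
  then have "bromwich 1 t (of_int m) = of_real (max (1 - of_int m) 0 - max (- of_int m) 0)"
    using assms by (simp add: bromwich_def integrable_ramp_kernel integral_ramp_kernel diff_divide_distrib)
  also have "max (1 - of_int m) 0 - max (- of_int m) (0::real) = of_bool (m \<le> 0)"
    by (cases "m \<le> 0") (auto simp: max_def)
  finally show ?thesis by simp
qed

lemma descent_tail_eq_bromwich:
  assumes t: "t > 0" and n: "n \<ge> 1"
  shows "of_real (descent_tail n m) = bromwich n t (of_int m)"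
  using n
proof (induction n arbitrary: m rule: nat_induct_at_least)
  case base
  then show ?case
    using bromwich_1[OF t, of m] by (cases "m \<le> 0") (simp_all only: descent_tail_1 of_bool_def if_True if_False of_real_0 of_real_1)
next
  case (Suc n)
  show ?case
    using Suc.IH[of m] Suc.IH[of "m - 1"]
    by (simp add: descent_tail_Suc[OF Suc.hyps] bromwich_Suc[OF t Suc.hyps] add.commute del: of_nat_Suc)
qed

section \<open>The cumulant function and the saddle point\<close>

lemma mgf_pos: "t \<noteq> 0 \<Longrightarrow> (exp t - 1) / t > (0::real)"
  by (cases "t > 0") (auto simp: divide_neg_neg)

text \<open>The mean of the density proportional to \<open>exp (t u)\<close> on [0,1], which is
  \<open>L_D'\<close> for \<open>t \<noteq> 0\<close>. At 0 division by zero makes it 0 instead of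
  \<open>1 / 2\<close>, so that point is treated separately.\<close>

definition tilted_mean :: "real \<Rightarrow> real" where
  "tilted_mean t = exp t / (exp t - 1) - 1 / t"

definition tilted_variance :: "real \<Rightarrow> real" where
  "tilted_variance t = 1 / t\<^sup>2 - exp t / (exp t - 1)\<^sup>2"

lemma DERIV_L_D:
  assumes "t \<noteq> 0"
  shows "(L_D has_real_derivative tilted_mean t) (at t)"
proof -
  have "((\<lambda>t. ln ((exp t - 1) / t)) has_real_derivative
      ((exp t * t - (exp t - 1)) / (t * t)) / ((exp t - 1) / t)) (at t)"
    using assms mgf_pos[OF assms] by (auto intro!: derivative_eq_intros)
  also have "((exp t * t - (exp t - 1)) / (t * t)) / ((exp t - 1) / t) = tilted_mean t"
    using assms by (simp add: tilted_mean_def field_simps)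
  finally have "((\<lambda>t. ln ((exp t - 1) / t)) has_real_derivative tilted_mean t) (at t)" .
  then show ?thesis
    by (rule has_field_derivative_transform_within_open[where S = "- {0}"])
      (use assms in \<open>auto simp: L_D_def open_delete\<close>)
qed

lemma DERIV_L_D_0: "(L_D has_real_derivative 1 / 2) (at 0)"
proof -
  have "((\<lambda>h::real. ln ((exp h - 1) / h) / h) \<longlongrightarrow> 1 / 2) (at 0)"
    by real_asymp
  then have "((\<lambda>h::real. L_D h / h) \<longlongrightarrow> 1 / 2) (at 0)"
    by (rule Lim_transform_eventually)
      (auto simp: L_D_def eventually_at_filter)
  then show ?thesis
    by (simp add: DERIV_def L_D_def)
qed

lemma deriv_L_D: "deriv L_D t = (if t = 0 then 1 / 2 else tilted_mean t)"
  using DERIV_imp_deriv[OF DERIV_L_D[of t]] DERIV_imp_deriv[OF DERIV_L_D_0] by auto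

lemma DERIV_tilted_mean:
  assumes "t \<noteq> 0"
  shows "(tilted_mean has_real_derivative tilted_variance t) (at t)"
proof -
  have "exp t - 1 \<noteq> 0"
    using assms by simp
  then have "((\<lambda>t. exp t / (exp t - 1) - 1 / t) has_real_derivative
      (exp t * (exp t - 1) - exp t * exp t) / ((exp t - 1) * (exp t - 1)) - (0 * t - 1 * 1) / (t * t)) (at t)"
    using assms by (auto intro!: derivative_eq_intros)
  also have "(exp t * (exp t - 1) - exp t * exp t) / ((exp t - 1) * (exp t - 1)) - (0 * t - 1 * 1) / (t * t)
      = tilted_variance t"
    by (simp add: tilted_variance_def power2_eq_square algebra_simps)
  finally show ?thesis
    by (simp add: tilted_mean_def[abs_def])
qed

text \<open>After clearing denominators and taking roots the claim is
  \<open>t * exp (t / 2) < exp t - 1\<close>, that is, \<open>t / 2 < sinh (t / 2)\<close>. The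
  difference vanishes at 0 and its derivative is
  \<open>exp (u / 2) * (exp (u / 2) - 1 - u / 2) > 0\<close>.\<close>

lemma tilted_variance_pos:
  assumes "t > 0"
  shows "tilted_variance t > 0"
proof -
  have "0 < exp t - 1 - t * exp (t / 2)"
  proof -
    have "(\<lambda>u::real. exp u - 1 - u * exp (u / 2)) 0 < (\<lambda>u. exp u - 1 - u * exp (u / 2)) t"
    proof (rule DERIV_pos_imp_increasing_open[OF assms])
      fix u :: real assume u: "0 < u" "u < t"
      have "((\<lambda>u. exp u - 1 - u * exp (u / 2)) has_real_derivative
          exp u - (exp (u / 2) + u * (exp (u / 2) * (1 / 2)))) (at u)"
        by (auto intro!: derivative_eq_intros)
      moreover have "exp u = exp (u / 2) * exp (u / 2)"
        by (simp flip: exp_add)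
      then have "exp u - (exp (u / 2) + u * (exp (u / 2) * (1 / 2))) = exp (u / 2) * (exp (u / 2) - 1 - u / 2)"
        by (simp add: algebra_simps)
      moreover have "exp (u / 2) * (exp (u / 2) - 1 - u / 2) > 0"
        using exp_ge_one_plus_x_over_n_power_n[of 1 1] exp_minus_greater[of "- (u / 2)"] u by simp
      ultimately show "\<exists>y. ((\<lambda>u. exp u - 1 - u * exp (u / 2)) has_real_derivative y) (at u) \<and> 0 < y"
        by metis
    qed (auto intro!: continuous_intros)
    then show ?thesis by simp
  qed
  then have "(t * exp (t / 2))\<^sup>2 < (exp t - 1)\<^sup>2"
    using assms by (intro power_strict_mono) auto
  moreover have "(t * exp (t / 2))\<^sup>2 = t\<^sup>2 * exp t"
    by (simp add: power_mult_distrib power2_eq_square flip: exp_add)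
  ultimately have "t\<^sup>2 * exp t < (exp t - 1)\<^sup>2"
    by simp
  then show ?thesis
    using assms by (simp add: tilted_variance_def field_simps)
qed

lemma tilted_mean_strict_mono:
  assumes "0 < s" "s < t"
  shows "tilted_mean s < tilted_mean t"
  using assms(2)
proof (rule DERIV_pos_imp_increasing)
  fix u assume "s \<le> u" "u \<le> t"
  with assms show "\<exists>y. (tilted_mean has_real_derivative y) (at u) \<and> 0 < y"
    by (intro exI[of _ "tilted_variance u"] conjI DERIV_tilted_mean tilted_variance_pos) auto
qed

lemma tendsto_tilted_mean_at_right_0: "(tilted_mean \<longlongrightarrow> 1 / 2) (at_right 0)"
  unfolding tilted_mean_def[abs_def] by real_asymp

lemma tendsto_tilted_mean_at_top: "(tilted_mean \<longlongrightarrow> 1) at_top"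
  unfolding tilted_mean_def[abs_def] by real_asymp

text \<open>The limit at 0 yields only a weak inequality; comparing it first with the value at
  \<open>t / 2\<close> makes it strict at \<open>t\<close>.\<close>

lemma tilted_mean_gt_half:
  assumes "t > 0"
  shows "tilted_mean t > 1 / 2"
proof -
  have "\<forall>\<^sub>F s in at_right 0. tilted_mean s \<le> tilted_mean (t / 2)"
    using eventually_at_right_less[of 0] eventually_at_right_real[of 0 "t / 2"] assms
    by (auto elim!: eventually_mono intro!: less_imp_le tilted_mean_strict_mono)
  then have "1 / 2 \<le> tilted_mean (t / 2)"
    by (intro tendsto_upperbound[OF tendsto_tilted_mean_at_right_0]) auto
  also have "\<dots> < tilted_mean t"
    using assms by (intro tilted_mean_strict_mono) auto
  finally show ?thesis .
qed

text \<open>Reflecting the uniform law by \<open>u\<close> to \<open>1 - u\<close> reverses the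
  tilt. With this, negative arguments have mean below \<open>1 / 2\<close> and cannot compete for
  the saddle point.\<close>

lemma tilted_mean_minus: "t \<noteq> 0 \<Longrightarrow> tilted_mean (- t) = 1 - tilted_mean t"
  by (simp add: tilted_mean_def exp_minus field_simps)

lemma deriv_L_D_le_half:
  assumes "t \<le> 0"
  shows "deriv L_D t \<le> 1 / 2"
  using assms tilted_mean_gt_half[of "- t"] tilted_mean_minus[of "- t"] by (auto simp: deriv_L_D)

lemma ex_tilted_mean_eq:
  assumes "1 / 2 < x" "x < 1"
  shows "\<exists>t>0. tilted_mean t = x"
proof -
  have "\<forall>\<^sub>F s in at_right 0. tilted_mean s < x"
    using tendsto_tilted_mean_at_right_0 assms by (auto dest: order_tendstoD)
  then obtain b where b: "b > 0" "\<And>s. 0 < s \<Longrightarrow> s < b \<Longrightarrow> tilted_mean s < x"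
    by (auto simp: eventually_at_right_field)
  have "\<forall>\<^sub>F s in at_top. tilted_mean s > x"
    using tendsto_tilted_mean_at_top assms by (auto dest: order_tendstoD)
  then obtain c where c: "\<And>s. s \<ge> c \<Longrightarrow> tilted_mean s > x"
    by (auto simp: eventually_at_top_linorder)
  define u where "u = max c b"
  have "\<exists>t\<ge>b / 2. t \<le> u \<and> tilted_mean t = x"
  proof (rule IVT')
    show "tilted_mean (b / 2) \<le> x" "x \<le> tilted_mean u" "b / 2 \<le> u"
      using b c[of u] by (auto simp: u_def intro: less_imp_le)
    show "continuous_on {b / 2..u} tilted_mean"
      using b by (intro DERIV_continuous_on[where D = tilted_variance]
          has_field_derivative_at_within[OF DERIV_tilted_mean]) auto
  qed
  then show ?thesis
    using b by (metis half_gt_zero order_less_le_trans)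
qed

lemma ex1_deriv_L_D:
  assumes "1 / 2 < x" "x < 1"
  shows "\<exists>!t. deriv L_D t = x"
proof -
  obtain t where t: "t > 0" "tilted_mean t = x"
    using ex_tilted_mean_eq[OF assms] by blast
  show ?thesis
  proof (rule ex1I[of _ t])
    show "deriv L_D t = x"
      using t by (simp add: deriv_L_D)
    fix s assume s: "deriv L_D s = x"
    then have "s > 0"
      using deriv_L_D_le_half[of s] assms by linarith
    then show "s = t"
      using s t tilted_mean_strict_mono[of s t] tilted_mean_strict_mono[of t s]
      by (cases s t rule: linorder_cases) (auto simp: deriv_L_D)
  qed
qed

lemma deriv_L_D_t_of:
  assumes "1 / 2 < x" "x < 1"
  shows "deriv L_D (t_of x) = x"
  unfolding t_of_def by (rule theI'[OF ex1_deriv_L_D[OF assms]])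

lemma t_of_pos:
  assumes "1 / 2 < x" "x < 1"
  shows "t_of x > 0"
  using deriv_L_D_le_half[of "t_of x"] deriv_L_D_t_of[OF assms] assms by linarith

text \<open>The derivative \<open>x - L_D'\<close> of the objective is nonnegative up to
  \<open>t_of x\<close> and nonpositive after it. The supremum is thus attained, which also
  identifies the real-valued \<open>SUP\<close> without a separate boundedness proof.\<close>

lemma I_D_eq:
  assumes x: "1 / 2 < x" "x < 1"
  shows "I_D x = x * t_of x - L_D (t_of x)"
proof -
  define s where "s = t_of x"
  have s: "s > 0" "deriv L_D s = x"
    using t_of_pos[OF x] deriv_L_D_t_of[OF x] by (simp_all add: s_def)
  define f where "f u = x * u - L_D u" for u
  have f': "(f has_real_derivative x - deriv L_D u) (at u)" for u
    unfolding f_def using DERIV_L_D[of u] DERIV_L_D_0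
    by (cases "u = 0") (auto intro!: derivative_eq_intros simp: deriv_L_D)
  have le: "deriv L_D u \<le> x" if "u \<le> s" for u
  proof (cases "u \<le> 0")
    case True
    then show ?thesis using deriv_L_D_le_half x by force
  next
    case False
    then show ?thesis
      using that s tilted_mean_strict_mono[of u s] by (cases "u = s") (auto simp: deriv_L_D)
  qed
  have ge: "x \<le> deriv L_D u" if "s \<le> u" for u
    using that s tilted_mean_strict_mono[of s u] by (cases "u = s") (auto simp: deriv_L_D)
  have "f u \<le> f s" for u
  proof (cases "u \<le> s")
    case True
    show ?thesis
      by (rule DERIV_nonneg_imp_nondecreasing[OF True]) (meson f' le diff_ge_0_iff_ge)
  next
    case False
    then have "s \<le> u" by simp
    then show ?thesis
      by (rule DERIV_nonpos_imp_nonincreasing) (meson f' ge diff_le_0_iff_le)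
  qed
  then show ?thesis
    unfolding I_D_def by (intro cSup_eq_maximum) (auto simp: f_def s_def)
qed

lemma ell_2_eq:
  assumes x: "1 / 2 < x" "x < 1"
  shows "ell 2 x = tilted_variance (t_of x)"
proof -
  have t: "t_of x > 0" by (rule t_of_pos[OF x])
  have "(deriv L_D has_real_derivative tilted_variance (t_of x)) (at (t_of x))"
  proof (rule has_field_derivative_transform_within_open[where S = "- {0}"])
    show "(tilted_mean has_real_derivative tilted_variance (t_of x)) (at (t_of x))"
      using t by (intro DERIV_tilted_mean) auto
  qed (use t in \<open>auto simp: deriv_L_D open_delete\<close>)
  then show ?thesis
    unfolding ell_def by (simp add: numeral_2_eq_2 DERIV_imp_deriv)
qed

section \<open>Modulus of the moment generating function on vertical lines\<close>

definition cmgf :: "complex \<Rightarrow> complex" where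
  "cmgf z = (exp z - 1) / z"

text \<open>The half-angle form separates the value at \<open>v = 0\<close> from a nonnegative term
  that is at most \<open>exp t * v^2\<close>.\<close>

lemma norm_exp_minus_1_squared:
  "(cmod (exp (Complex t v) - 1))\<^sup>2 = (exp t - 1)\<^sup>2 + 4 * exp t * (sin (v / 2))\<^sup>2"
proof -
  have "cos v = 1 - 2 * (sin (v / 2))\<^sup>2"
    using cos_double_sin[of "v / 2"] by simp
  from arg_cong[OF this, of "\<lambda>y. 2 * exp t - 2 * exp t * y"]
  have c: "4 * exp t * (sin (v / 2))\<^sup>2 = 2 * exp t - 2 * exp t * cos v"
    by (simp add: algebra_simps)
  have "(cmod (exp (Complex t v) - 1))\<^sup>2 = (exp t * cos v - 1)\<^sup>2 + (exp t * sin v)\<^sup>2"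
    by (simp add: cmod_power2 Re_exp Im_exp)
  also have "\<dots> = (exp t)\<^sup>2 * ((sin v)\<^sup>2 + (cos v)\<^sup>2) - 2 * exp t * cos v + 1"
    by (simp only: power2_diff power_mult_distrib distrib_left mult_1_right power_one)
  also have "\<dots> = (exp t - 1)\<^sup>2 + 4 * exp t * (sin (v / 2))\<^sup>2"
    unfolding c by (simp add: power2_diff)
  finally show ?thesis .
qed

text \<open>This bound holds for all \<open>v\<close>: it is Gaussian near \<open>0\<close> and stays away from \<open>1\<close> elsewhere.\<close>

lemma norm_cmgf_ratio_le:
  assumes t: "t > 0"
  shows "cmod (cmgf (Complex t v) / cmgf (of_real t)) \<le>
    exp (- (tilted_variance t * v\<^sup>2 / (2 * (1 + v\<^sup>2 / t\<^sup>2))))"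
proof -
  define q where "q = cmod (cmgf (Complex t v) / cmgf (of_real t))"
  define b where "b = exp t / (exp t - 1)\<^sup>2"
  define w where "w = 1 + v\<^sup>2 / t\<^sup>2"
  have e: "exp t - 1 > 0" using t by simp
  have w: "w > 0" unfolding w_def by (simp add: add_pos_nonneg)
  have sin: "4 * (sin (v / 2))\<^sup>2 \<le> v\<^sup>2"
    using power_mono[OF abs_sin_x_le_abs_x[of "v / 2"], of 2] by (simp add: power_divide)
  have real: "cmgf (of_real t) = of_real ((exp t - 1) / t)"
    by (simp add: cmgf_def exp_of_real)
  have "q\<^sup>2 = ((cmod (exp (Complex t v) - 1))\<^sup>2 / (t\<^sup>2 + v\<^sup>2)) / ((exp t - 1) / t)\<^sup>2"
    unfolding q_def real using e t
    by (simp only: cmgf_def norm_divide power_divide norm_complex_eq norm_of_real power2_abs)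
  also have "\<dots> = (((exp t - 1)\<^sup>2 + 4 * exp t * (sin (v / 2))\<^sup>2) / (exp t - 1)\<^sup>2) / ((t\<^sup>2 + v\<^sup>2) / t\<^sup>2)"
    unfolding norm_exp_minus_1_squared by (simp add: power_divide)
  also have "(t\<^sup>2 + v\<^sup>2) / t\<^sup>2 = w"
    using t by (simp add: w_def add_divide_distrib)
  also have "((exp t - 1)\<^sup>2 + 4 * exp t * (sin (v / 2))\<^sup>2) / (exp t - 1)\<^sup>2 = 1 + b * (4 * (sin (v / 2))\<^sup>2)"
    using e by (simp add: b_def add_divide_distrib)
  also have "(1 + b * (4 * (sin (v / 2))\<^sup>2)) / w \<le> (1 + b * v\<^sup>2) / w"
    using sin w e by (intro divide_right_mono add_left_mono mult_left_mono) (auto simp: b_def)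
  \<comment> \<open>As \<open>tilted_variance t = 1 / t^2 - b\<close>, the numerator is
    \<open>w\<close> minus \<open>tilted_variance t * v^2\<close>. Then
    \<open>1 - y \<le> exp (- y)\<close> bounds \<open>q^2\<close>, and the square root contributes
    the factor 2 in the exponent.\<close>
  also have "\<dots> = 1 - tilted_variance t * v\<^sup>2 / w"
  proof -
    have "1 + b * v\<^sup>2 = w - tilted_variance t * v\<^sup>2"
      by (simp add: w_def b_def tilted_variance_def algebra_simps)
    then show ?thesis using w by (simp add: diff_divide_distrib)
  qed
  also have "\<dots> \<le> exp (- (tilted_variance t * v\<^sup>2 / w))"
    using exp_ge_add_one_self[of "- (tilted_variance t * v\<^sup>2 / w)"] by simp
  also have "\<dots> = (exp (- (tilted_variance t * v\<^sup>2 / (2 * w))))\<^sup>2"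
    by (simp add: field_simps flip: exp_double)
  finally show ?thesis
    unfolding q_def[symmetric] w_def[symmetric] by (rule power2_le_imp_le) simp
qed

section \<open>Laplace's method\<close>

text \<open>The double factorial \<open>(2 r - 1)!!\<close>, which is the moment of order
  \<open>2 r\<close> of the standard normal law.\<close>

definition gauss_moment :: "nat \<Rightarrow> real" where
  "gauss_moment r = fact (2 * r) / (2 ^ r * fact r)"

lemma exp_eq_normal_density:
  assumes "c > 0"
  shows "exp (- (c * v\<^sup>2 / 2)) = sqrt (2 * pi / c) * normal_density 0 (1 / sqrt c) v"
  using assms by (simp add: normal_density_def power_divide real_sqrt_divide field_simps)

lemma has_bochner_integral_gauss_even:
  assumes c: "c > 0"
  shows "has_bochner_integral lborel (\<lambda>v. exp (- (c * v\<^sup>2 / 2)) * v ^ (2 * r))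
    (sqrt (2 * pi / c) * (gauss_moment r / c ^ r))"
proof -
  have "has_bochner_integral lborel (\<lambda>v. sqrt (2 * pi / c) * (normal_density 0 (1 / sqrt c) v * (v - 0) ^ (2 * r)))
      (sqrt (2 * pi / c) * (fact (2 * r) / ((2 / (1 / sqrt c)\<^sup>2) ^ r * fact r)))"
    using c by (intro has_bochner_integral_mult_right normal_moment_even) auto
  then show ?thesis
    using c by (simp add: exp_eq_normal_density gauss_moment_def power_divide power_mult_distrib mult_ac)
qed

lemma has_bochner_integral_gauss_odd:
  fixes c :: real
  assumes c: "c > 0"
  shows "has_bochner_integral lborel (\<lambda>v. exp (- (c * v\<^sup>2 / 2)) * v ^ (2 * r + 1)) 0"
proof -
  have "has_bochner_integral lborel (\<lambda>v. sqrt (2 * pi / c) * (normal_density 0 (1 / sqrt c) v * (v - 0) ^ (2 * r + 1)))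
      (sqrt (2 * pi / c) * 0)"
    using c by (intro has_bochner_integral_mult_right normal_moment_odd) auto
  then show ?thesis
    using c by (simp add: exp_eq_normal_density mult_ac)
qed

lemma has_bochner_integral_gauss_monomial:
  assumes c: "c > 0"
  shows "has_bochner_integral lborel (\<lambda>v. exp (- (c * v\<^sup>2 / 2)) *\<^sub>R (\<i> * of_real v) ^ j)
    (of_real (sqrt (2 * pi / c)) * (if even j then of_real ((-1) ^ (j div 2) * gauss_moment (j div 2) / c ^ (j div 2)) else 0))"
proof (cases "even j")
  case True
  then obtain r where j: "j = 2 * r" by blast
  have "has_bochner_integral lborel (\<lambda>v. (-1) ^ r * complex_of_real (exp (- (c * v\<^sup>2 / 2)) * v ^ (2 * r)))
      ((-1) ^ r * of_real (sqrt (2 * pi / c) * (gauss_moment r / c ^ r)))"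
    by (intro has_bochner_integral_mult_right has_bochner_integral_of_real has_bochner_integral_gauss_even c)
  moreover have "(\<i> * complex_of_real v) ^ j = (-1) ^ r * of_real (v ^ (2 * r))" for v
    using power_mult_distrib[of "-1" "(complex_of_real v)\<^sup>2" r]
    by (simp add: j power_mult_distrib power_mult)
  ultimately show ?thesis
    by (simp add: j scaleR_conv_of_real mult_ac)
next
  case False
  then obtain r where j: "j = 2 * r + 1" by (meson oddE)
  have "has_bochner_integral lborel (\<lambda>v. \<i> ^ j * complex_of_real (exp (- (c * v\<^sup>2 / 2)) * v ^ (2 * r + 1)))
      (\<i> ^ j * of_real 0)"
    by (intro has_bochner_integral_mult_right has_bochner_integral_of_real has_bochner_integral_gauss_odd c)
  then show ?thesis
    using False by (simp add: j power_mult_distrib scaleR_conv_of_real mult_ac)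
qed

section \<open>Taylor remainders on the imaginary axis\<close>

lemma norm_fps_nth_le:
  assumes f: "f holomorphic_on ball 0 \<rho>" and F: "f has_fps_expansion F"
    and B: "\<And>w. w \<in> ball 0 \<rho> \<Longrightarrow> cmod (f w) \<le> B" and r: "0 < r" "r < \<rho>"
  shows "cmod (fps_nth F j) \<le> B / r ^ j"
proof -
  have sub: "cball 0 r \<subseteq> ball 0 \<rho>"
    using r by auto
  have "cmod ((deriv ^^ j) f 0) \<le> fact j * B / r ^ j"
    using r sub by (intro Cauchy_inequality B holomorphic_on_subset[OF f]
      continuous_on_subset[OF holomorphic_on_imp_continuous_on[OF f]]) auto
  then show ?thesis
    by (simp add: fps_nth_fps_expansion[OF F] norm_divide field_simps)
qed

text \<open>For \<open>\<bar>v\<bar> > \<delta>\<close> the Taylor polynomial itself is dominated by the remainder term, so cutting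
  off the function outside \<open>[-\<delta>, \<delta>]\<close> costs nothing.\<close>

lemma truncated_taylor_bound:
  assumes f: "f holomorphic_on ball 0 \<rho>" and F: "f has_fps_expansion F"
    and B: "\<And>w. w \<in> ball 0 \<rho> \<Longrightarrow> cmod (f w) \<le> B" and d: "0 < \<delta>" "2 * \<delta> < \<rho>"
  shows "cmod (indicator {-\<delta>..\<delta>} v *\<^sub>R f (\<i> * of_real v) - (\<Sum>j<N. fps_nth F j * (\<i> * of_real v) ^ j))
    \<le> 2 * B / \<delta> ^ N * \<bar>v\<bar> ^ N"
proof -
  define w where "w = \<i> * complex_of_real v"
  define x where "x = \<bar>v\<bar> / \<delta>"
  have w: "cmod w = \<delta> * x"
    using d by (simp add: w_def x_def norm_mult)
  have x0: "x \<ge> 0" using d by (simp add: x_def)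
  have B0: "B \<ge> 0"
    using B[of 0] d by (intro order_trans[OF norm_ge_zero]) auto
  \<comment> \<open>Cauchy's estimate is used at radius \<open>2 * \<delta>\<close>, twice the
    cutoff, so that the \<open>j\<close>-th term carries \<open>(x / 2) ^ j\<close>. The resulting
    geometric series is the source of the factor 2 in the bound.\<close>
  have coeff: "cmod (fps_nth F j * w ^ j) \<le> B * ((x / 2) ^ j)" for j
  proof -
    have "cmod (fps_nth F j * w ^ j) \<le> B / (2 * \<delta>) ^ j * (\<delta> * x) ^ j"
      unfolding norm_mult norm_power w
      using norm_fps_nth_le[OF f F B, of "2 * \<delta>" j] d x0 by (intro mult_right_mono) auto
    also have "\<dots> = B * ((x / 2) ^ j)"
      using d by (simp add: power_mult_distrib power_divide)
    finally show ?thesis .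
  qed
  have geo: "(\<lambda>j. B * x ^ N * (1 / 2) ^ j) sums (B * x ^ N * 2)"
    using sums_mult[OF geometric_sums[of "1 / 2 :: real"], of "B * x ^ N"] by simp
  have "cmod (indicator {-\<delta>..\<delta>} v *\<^sub>R f w - (\<Sum>j<N. fps_nth F j * w ^ j)) \<le> B * x ^ N * 2"
  proof (cases "\<bar>v\<bar> \<le> \<delta>")
    case True
    then have x1: "x \<le> 1" using d by (simp add: x_def)
    have wball: "w \<in> ball 0 \<rho>"
    proof -
      have "cmod w \<le> \<delta>"
        using x1 d by (simp add: w)
      then show ?thesis
        using d by simp
    qed
    have "(\<lambda>j. (deriv ^^ j) f 0 / fact j * (w - 0) ^ j) sums f w"
      by (rule holomorphic_power_series[OF f wball])
    then have "(\<lambda>j. fps_nth F j * w ^ j) sums f w"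
      by (simp add: fps_nth_fps_expansion[OF F])
    from sums_split_initial_segment[OF this, of N]
    have s: "(\<lambda>j. fps_nth F (j + N) * w ^ (j + N)) sums (f w - (\<Sum>j<N. fps_nth F j * w ^ j))" .
    have le: "cmod (fps_nth F (j + N) * w ^ (j + N)) \<le> B * x ^ N * (1 / 2) ^ j" for j
    proof -
      have "(x / 2) ^ (j + N) \<le> x ^ N * (1 / 2) ^ j"
      proof -
        have "(x / 2) ^ (j + N) = (x ^ N * (1 / 2) ^ j) * (x ^ j * (1 / 2) ^ N)"
          by (simp add: power_add power_divide)
        also have "\<dots> \<le> (x ^ N * (1 / 2) ^ j) * 1"
          using x0 x1 by (intro mult_left_mono mult_le_one power_le_one) auto
        finally show ?thesis by simp
      qed
      then show ?thesis
        using coeff[of "j + N"] B0 mult_left_mono[of "(x / 2) ^ (j + N)" "x ^ N * (1 / 2) ^ j" B]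
        by (simp add: mult.assoc)
    qed
    have "cmod (f w - (\<Sum>j<N. fps_nth F j * w ^ j)) \<le> (\<Sum>j. B * x ^ N * (1 / 2) ^ j)"
      unfolding sums_unique[OF s] using le sums_summable[OF geo] by (intro norm_suminf_le) auto
    also have "\<dots> = B * x ^ N * 2"
      using sums_unique[OF geo] by simp
    finally show ?thesis
      using True by (simp add: indicator_def abs_le_iff)
  next
    case False
    then have x1: "x \<ge> 1" using d by (simp add: x_def)
    have "cmod (\<Sum>j<N. fps_nth F j * w ^ j) \<le> (\<Sum>j<N. B * x ^ N * (1 / 2) ^ j)"
    proof (intro sum_norm_le)
      fix j assume "j \<in> {..<N}"
      then have "x ^ j \<le> x ^ N"
        using x1 by (intro power_increasing) auto
      then have "B * (x / 2) ^ j \<le> B * x ^ N * (1 / 2) ^ j"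
        using B0 by (simp add: power_divide mult_left_mono divide_right_mono)
      with coeff[of j] show "cmod (fps_nth F j * w ^ j) \<le> B * x ^ N * (1 / 2) ^ j"
        by linarith
    qed
    also have "\<dots> \<le> B * x ^ N * 2"
      using sum_le_suminf[OF sums_summable[OF geo], of "{..<N}"] sums_unique[OF geo] B0 x0 by simp
    finally show ?thesis
      using False by (auto simp: indicator_def)
  qed
  then show ?thesis
    using d by (simp add: w_def x_def power_divide mult_ac)
qed

section \<open>The coefficients of the expansion\<close>

text \<open>The coefficient of \<open>n ^ (- k)\<close> after expanding \<open>exp (n h) g\<close> into \<open>n ^ q h ^ q g / q!\<close> and integrating
  term by term: the Gaussian moment of \<open>(i v) ^ (2 r)\<close> carries \<open>n ^ (- r)\<close>, so \<open>r = k + q\<close>. Since \<open>h\<close>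
  vanishes to order three, only \<open>q \<le> 2 k\<close> contributes.\<close>

definition laplace_coeff :: "real \<Rightarrow> complex fps \<Rightarrow> complex fps \<Rightarrow> nat \<Rightarrow> complex" where
  "laplace_coeff c H G k = (\<Sum>q\<le>2 * k. fps_nth (H ^ q * G) (2 * (k + q)) *
     of_real ((-1) ^ (k + q) * gauss_moment (k + q) / (fact q * c ^ (k + q))))"

text \<open>Orders of vanishing add under multiplication. This limits how many powers of
  \<open>h\<close> can reach a given power of \<open>1 / n\<close>.\<close>

lemma fps_nth_power_mult_eq_0:
  fixes H G :: "'a :: idom fps"
  assumes H: "\<And>j. j < 3 \<Longrightarrow> fps_nth H j = 0" and j: "j < 3 * q"
  shows "fps_nth (H ^ q * G) j = 0"
proof (rule ccontr)
  assume *: "fps_nth (H ^ q * G) j \<noteq> 0"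
  have "H ^ q \<noteq> 0" "G \<noteq> 0"
    using * by (auto simp del: power_eq_0_iff)
  moreover have "q \<noteq> 0"
    using j by auto
  ultimately have "H \<noteq> 0"
    by auto
  then have "3 \<le> subdegree H"
    using H by (intro subdegree_geI) auto
  have "3 * q \<le> subdegree H * q"
    using \<open>3 \<le> subdegree H\<close> by (rule mult_right_mono) simp
  also have "\<dots> \<le> subdegree (H ^ q * G)"
    using \<open>H ^ q \<noteq> 0\<close> \<open>G \<noteq> 0\<close> by (simp add: mult.commute)
  also have "\<dots> \<le> j"
    using * by (rule subdegree_leI)
  finally show False
    using j by simp
qed

text \<open>Substitute \<open>r = k + q\<close>. Terms with \<open>r < q\<close> vanish by
  hypothesis, and so do those with \<open>q > 2 k\<close>, since then
  \<open>2 (k + q) < 3 q\<close>. As \<open>k \<le> p\<close>, the range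
  \<open>q \<le> 2 p + 1\<close> loses nothing.\<close>

lemma sum_rearrange_laplace:
  fixes a :: "nat \<Rightarrow> nat \<Rightarrow> complex"
  assumes a: "\<And>q r. 2 * r < 3 * q \<Longrightarrow> a q r = 0" and x: "x \<noteq> 0"
  shows "(\<Sum>q\<le>2 * p + 1. \<Sum>r\<le>p + q. a q r * x ^ q / x ^ r) = (\<Sum>k\<le>p. (\<Sum>q\<le>2 * k. a q (k + q)) / x ^ k)"
proof -
  have "(\<Sum>r\<le>p + q. a q r * x ^ q / x ^ r) = (\<Sum>k\<le>p. a q (k + q) / x ^ k)" for q
  proof -
    have "(\<Sum>r\<le>p + q. a q r * x ^ q / x ^ r) = (\<Sum>r\<in>{0 + q..p + q}. a q r * x ^ q / x ^ r)"
      by (rule sum.mono_neutral_right) (auto simp: a)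
    also have "\<dots> = (\<Sum>k\<in>{0..p}. a q (k + q) * x ^ q / x ^ (k + q))"
      by (rule sum.shift_bounds_cl_nat_ivl)
    also have "\<dots> = (\<Sum>k\<le>p. a q (k + q) / x ^ k)"
      using x by (intro sum.cong) (auto simp: power_add)
    finally show ?thesis .
  qed
  then have "(\<Sum>q\<le>2 * p + 1. \<Sum>r\<le>p + q. a q r * x ^ q / x ^ r) =
      (\<Sum>q\<le>2 * p + 1. \<Sum>k\<le>p. a q (k + q) / x ^ k)"
    by (simp only:)
  also have "\<dots> = (\<Sum>k\<le>p. \<Sum>q\<le>2 * p + 1. a q (k + q) / x ^ k)"
    by (rule sum.swap)
  also have "\<dots> = (\<Sum>k\<le>p. \<Sum>q\<le>2 * k. a q (k + q) / x ^ k)"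
    by (intro sum.cong refl sum.mono_neutral_right) (auto simp: a)
  finally show ?thesis
    by (simp only: sum_divide_distrib)
qed

text \<open>\<open>S\<close> is the Gaussian times the truncated expansion of
  \<open>exp (n h) g\<close>. Odd powers integrate to 0, and \<open>j < 2 (p + q + 1)\<close> leaves
  the even ones \<open>j = 2 r\<close> with \<open>r \<le> p + q\<close>, which is
  \<open>k \<le> p\<close> for \<open>r = k + q\<close>. The square root normalises the Gaussian to
  mass 1.\<close>

lemma laplace_main_term:
  fixes p :: nat and G H :: "complex fps"
  assumes c: "c > 0" and n: "n > 0" and H: "\<And>j. j < 3 \<Longrightarrow> fps_nth H j = 0"
  defines "S \<equiv> \<lambda>v. \<Sum>q\<le>2 * p + 1. \<Sum>j<2 * (p + q + 1). of_real (real n ^ q / fact q) * fps_nth (H ^ q * G) j *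
      (exp (- (real n * c * v\<^sup>2 / 2)) *\<^sub>R (\<i> * of_real v) ^ j)"
  shows "integrable lborel S"
    "of_real (sqrt (real n * c / (2 * pi))) * (\<integral>v. S v \<partial>lborel) = (\<Sum>k\<le>p. laplace_coeff c H G k / of_nat n ^ k)"
proof -
  have nc: "real n * c > 0" using n c by simp
  define s where "s = sqrt (2 * pi / (real n * c))"
  define I where "I j = (if even j then of_real ((-1) ^ (j div 2) * gauss_moment (j div 2) / (real n * c) ^ (j div 2)) else 0 :: complex)" for j
  have S: "has_bochner_integral lborel S
      (\<Sum>q\<le>2 * p + 1. \<Sum>j<2 * (p + q + 1). of_real (real n ^ q / fact q) * fps_nth (H ^ q * G) j * (of_real s * I j))"
    unfolding S_def s_def I_def
    by (intro has_bochner_integral_sum has_bochner_integral_mult_right has_bochner_integral_gauss_monomial nc)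
  then show "integrable lborel S"
    by (rule integrable.intros)
  have s: "sqrt (real n * c / (2 * pi)) * s = 1"
    using n c by (simp add: s_def flip: real_sqrt_mult)
  define a where "a q r = fps_nth (H ^ q * G) (2 * r) * of_real ((-1) ^ r * gauss_moment r / (fact q * c ^ r))" for q r
  have "(\<integral>v. S v \<partial>lborel) =
      (\<Sum>q\<le>2 * p + 1. \<Sum>j<2 * (p + q + 1). of_real (real n ^ q / fact q) * fps_nth (H ^ q * G) j * (of_real s * I j))"
    using S by (rule has_bochner_integral_integral_eq)
  also have "\<dots> = of_real s * (\<Sum>q\<le>2 * p + 1. \<Sum>j<2 * (p + q + 1). of_real (real n ^ q / fact q) * fps_nth (H ^ q * G) j * I j)"
    unfolding sum_distrib_left by (intro sum.cong refl) (simp only: mult_ac)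
  finally have "of_real (sqrt (real n * c / (2 * pi))) * (\<integral>v. S v \<partial>lborel) =
      of_real (sqrt (real n * c / (2 * pi)) * s) * (\<Sum>q\<le>2 * p + 1. \<Sum>j<2 * (p + q + 1). of_real (real n ^ q / fact q) * fps_nth (H ^ q * G) j * I j)"
    by (simp only: of_real_mult mult.assoc)
  also have "\<dots> = (\<Sum>q\<le>2 * p + 1. \<Sum>j<2 * (p + q + 1). of_real (real n ^ q / fact q) * fps_nth (H ^ q * G) j * I j)"
    by (simp only: s of_real_1 mult_1_left)
  also have "\<dots> = (\<Sum>q\<le>2 * p + 1. \<Sum>r\<le>p + q. a q r * of_nat n ^ q / of_nat n ^ r)"
  proof (rule sum.cong[OF refl])
    fix q
    have "(\<Sum>j<2 * (p + q + 1). of_real (real n ^ q / fact q) * fps_nth (H ^ q * G) j * I j) =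
        (\<Sum>j\<in>(\<lambda>r. 2 * r) ` {..p + q}. of_real (real n ^ q / fact q) * fps_nth (H ^ q * G) j * I j)"
      by (rule sum.mono_neutral_right) (auto simp: I_def elim!: evenE)
    also have "\<dots> = (\<Sum>r\<le>p + q. of_real (real n ^ q / fact q) * fps_nth (H ^ q * G) (2 * r) * I (2 * r))"
      by (subst sum.reindex) (auto simp: inj_on_def)
    also have "\<dots> = (\<Sum>r\<le>p + q. a q r * of_nat n ^ q / of_nat n ^ r)"
      by (intro sum.cong refl) (simp add: a_def I_def power_mult_distrib mult_ac)
    finally show "(\<Sum>j<2 * (p + q + 1). of_real (real n ^ q / fact q) * fps_nth (H ^ q * G) j * I j) =
        (\<Sum>r\<le>p + q. a q r * of_nat n ^ q / of_nat n ^ r)" .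
  qed
  also have "\<dots> = (\<Sum>k\<le>p. (\<Sum>q\<le>2 * k. a q (k + q)) / of_nat n ^ k)"
    using n by (intro sum_rearrange_laplace) (auto simp: a_def fps_nth_power_mult_eq_0[OF H])
  finally show "of_real (sqrt (real n * c / (2 * pi))) * (\<integral>v. S v \<partial>lborel) = (\<Sum>k\<le>p. laplace_coeff c H G k / of_nat n ^ k)"
    by (simp add: laplace_coeff_def a_def)
qed

text \<open>After multiplication by \<open>sqrt n\<close>, \<open>v ^ (2 r)\<close> contributes \<open>n powr - r\<close>. The powers of \<open>n\<close> in
  the remainder terms are therefore cancelled by \<open>2 * (p + q + 1)\<close> Taylor terms of \<open>h ^ q * g\<close> and by
  \<open>2 * p + 2\<close> terms of the exponential series, as \<open>h\<close> vanishes to order three.\<close>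

lemma laplace_pointwise_bound:
  fixes h g :: "complex \<Rightarrow> complex" and H G :: "complex fps"
  assumes h: "h holomorphic_on ball 0 \<rho>" "h has_fps_expansion H" and g: "g holomorphic_on ball 0 \<rho>" "g has_fps_expansion G"
    and A: "\<And>w. w \<in> ball 0 \<rho> \<Longrightarrow> cmod (h w) \<le> A" and B: "\<And>w. w \<in> ball 0 \<rho> \<Longrightarrow> cmod (g w) \<le> B"
    and \<delta>: "0 < \<delta>" "2 * \<delta> < \<rho>"
    and K: "\<And>v. \<bar>v\<bar> \<le> \<delta> \<Longrightarrow> cmod (h (\<i> * of_real v)) \<le> K * \<bar>v\<bar> ^ 3" "4 * K * \<delta> \<le> c" "K \<ge> 0"
  shows "cmod (indicator {-\<delta>..\<delta>} v *\<^sub>R (exp (- (real n * c * v\<^sup>2 / 2)) *\<^sub>R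
       (exp (of_nat n * h (\<i> * of_real v)) * g (\<i> * of_real v))) -
     (\<Sum>q\<le>2 * p + 1. \<Sum>j<2 * (p + q + 1). of_real (real n ^ q / fact q) * fps_nth (H ^ q * G) j *
       (exp (- (real n * c * v\<^sup>2 / 2)) *\<^sub>R (\<i> * of_real v) ^ j)))
    \<le> B * (real n * K) ^ (2 * p + 2) * (exp (- (real n * (c / 2) * v\<^sup>2 / 2)) * v ^ (2 * (3 * p + 3))) +
      (\<Sum>q\<le>2 * p + 1. real n ^ q * (2 * (A ^ q * B) / \<delta> ^ (2 * (p + q + 1))) *
        (exp (- (real n * c * v\<^sup>2 / 2)) * v ^ (2 * (p + q + 1))))"
proof -
  define w where "w = \<i> * complex_of_real v"
  define E where "E = exp (- (real n * c * v\<^sup>2 / 2))"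
  define i where "i = indicat_real {-\<delta>..\<delta>} v"
  define T where "T = (\<Sum>q\<le>2 * p + 1. (of_nat n * h w) ^ q / fact q)"
  define P where "P q = (\<Sum>j<2 * (p + q + 1). fps_nth (H ^ q * G) j * w ^ j)" for q
  have B0: "B \<ge> 0"
    using B[of 0] \<delta> by (intro order_trans[OF norm_ge_zero]) auto
  have A0: "A \<ge> 0"
    using A[of 0] \<delta> by (intro order_trans[OF norm_ge_zero]) auto
  have E0: "E \<ge> 0" by (simp add: E_def)
  have "(\<Sum>q\<le>2 * p + 1. \<Sum>j<2 * (p + q + 1). of_real (real n ^ q / fact q) * fps_nth (H ^ q * G) j * (E *\<^sub>R w ^ j))
      = (\<Sum>q\<le>2 * p + 1. of_real (E * (real n ^ q / fact q)) * P q)"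
    unfolding P_def sum_distrib_left by (intro sum.cong refl) (simp add: scaleR_conv_of_real mult_ac)
  \<comment> \<open>The error is split in two: the remainder of the exponential series, and for each
    \<open>q\<close> the Taylor remainder of \<open>h ^ q * g\<close>.\<close>
  moreover have "i *\<^sub>R (E *\<^sub>R (exp (of_nat n * h w) * g w)) =
      of_real (i * E) * ((exp (of_nat n * h w) - T) * g w) +
      (\<Sum>q\<le>2 * p + 1. of_real (E * (real n ^ q / fact q)) * (i *\<^sub>R (h w ^ q * g w)))"
  proof -
    have "(\<Sum>q\<le>2 * p + 1. of_real (E * (real n ^ q / fact q)) * (i *\<^sub>R (h w ^ q * g w))) = of_real (i * E) * (T * g w)"
      unfolding T_def sum_distrib_left sum_distrib_right
      by (intro sum.cong refl) (simp add: scaleR_conv_of_real power_mult_distrib mult_ac)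
    moreover have "of_real (i * E) * ((e - T) * z) + of_real (i * E) * (T * z) = i *\<^sub>R (E *\<^sub>R (e * z))" for e z
      by (simp only: left_diff_distrib right_diff_distrib diff_add_cancel scaleR_conv_of_real of_real_mult mult.assoc)
    ultimately show ?thesis
      by (simp only:)
  qed
  ultimately have "i *\<^sub>R (E *\<^sub>R (exp (of_nat n * h w) * g w)) -
      (\<Sum>q\<le>2 * p + 1. \<Sum>j<2 * (p + q + 1). of_real (real n ^ q / fact q) * fps_nth (H ^ q * G) j * (E *\<^sub>R w ^ j))
      = of_real (i * E) * ((exp (of_nat n * h w) - T) * g w) +
        (\<Sum>q\<le>2 * p + 1. of_real (E * (real n ^ q / fact q)) * (i *\<^sub>R (h w ^ q * g w) - P q))"
    by (simp only: right_diff_distrib sum_subtractf add_diff_eq)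
  also have "cmod \<dots> \<le> B * (real n * K) ^ (2 * p + 2) * (exp (- (real n * (c / 2) * v\<^sup>2 / 2)) * v ^ (2 * (3 * p + 3))) +
      (\<Sum>q\<le>2 * p + 1. real n ^ q * (2 * (A ^ q * B) / \<delta> ^ (2 * (p + q + 1))) * (E * v ^ (2 * (p + q + 1))))"
  proof (intro norm_triangle_le add_mono sum_norm_le)
    fix q
    have "cmod (i *\<^sub>R (h w ^ q * g w) - P q) \<le> 2 * (A ^ q * B) / \<delta> ^ (2 * (p + q + 1)) * \<bar>v\<bar> ^ (2 * (p + q + 1))"
      unfolding i_def P_def w_def
    proof (rule truncated_taylor_bound[where f = "\<lambda>w. h w ^ q * g w"])
      show "cmod (h w ^ q * g w) \<le> A ^ q * B" if "w \<in> ball 0 \<rho>" for w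
        unfolding norm_mult norm_power using A[OF that] B[OF that] norm_ge_zero[of "h w"]
        by (intro mult_mono power_mono) (use A0 in auto)
    qed (use h g \<delta> in \<open>auto intro!: holomorphic_intros fps_expansion_intros\<close>)
    also have "\<bar>v\<bar> ^ (2 * (p + q + 1)) = v ^ (2 * (p + q + 1))"
      by (rule power_even_abs) simp
    finally have "E * (real n ^ q / fact q) * cmod (i *\<^sub>R (h w ^ q * g w) - P q) \<le>
        E * (real n ^ q / 1) * (2 * (A ^ q * B) / \<delta> ^ (2 * (p + q + 1)) * v ^ (2 * (p + q + 1)))"
      by (intro mult_mono divide_left_mono) (use E0 in \<open>auto simp: fact_ge_1\<close>)
    moreover have "cmod (of_real (E * (real n ^ q / fact q)) * (i *\<^sub>R (h w ^ q * g w) - P q)) =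
        E * (real n ^ q / fact q) * cmod (i *\<^sub>R (h w ^ q * g w) - P q)"
      unfolding norm_mult norm_of_real by (subst abs_of_nonneg) (use E0 in auto)
    ultimately show "cmod (of_real (E * (real n ^ q / fact q)) * (i *\<^sub>R (h w ^ q * g w) - P q)) \<le>
        real n ^ q * (2 * (A ^ q * B) / \<delta> ^ (2 * (p + q + 1))) * (E * v ^ (2 * (p + q + 1)))"
      by (simp only: mult_ac div_by_1)
  next
    show "cmod (of_real (i * E) * ((exp (of_nat n * h w) - T) * g w)) \<le>
        B * (real n * K) ^ (2 * p + 2) * (exp (- (real n * (c / 2) * v\<^sup>2 / 2)) * v ^ (2 * (3 * p + 3)))"
    proof (cases "\<bar>v\<bar> \<le> \<delta>")
      case False
      then have "i = 0" by (auto simp: i_def indicator_def)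
      moreover have "0 \<le> v ^ (2 * (3 * p + 3))"
        by (rule zero_le_even_power) simp
      ultimately show ?thesis
        using B0 K(3) by (simp del: power_Suc)
    next
      case True
      have "w \<in> ball 0 \<rho>"
        using True \<delta> by (simp add: w_def norm_mult)
      then have gw: "cmod (g w) \<le> B" by (rule B)
      define y where "y = cmod (of_nat n * h w)"
      have y: "y \<le> real n * (K * \<bar>v\<bar> ^ 3)"
        unfolding y_def norm_mult using K(1)[OF True] by (simp add: w_def mult_left_mono)
      \<comment> \<open>On the cutoff interval \<open>4 K \<delta> \<le> c\<close> turns the cubic
        bound into \<open>n c v^2 / 4\<close>. This costs half of the Gaussian exponent, whence
        \<open>c / 2\<close> in place of \<open>c\<close> in the first error term.\<close>
      have "K * \<bar>v\<bar> ^ 3 = K * \<bar>v\<bar> * v\<^sup>2"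
        by (simp add: power3_eq_cube power2_eq_square)
      also have "\<dots> \<le> c / 4 * v\<^sup>2"
        using mult_left_mono[OF True, of K] K by (intro mult_right_mono) auto
      finally have y': "y \<le> real n * (c / 4 * v\<^sup>2)"
        using y by (meson mult_left_mono of_nat_0_le_iff order_trans)
      have le: "cmod (exp (of_nat n * h w) - (\<Sum>k\<le>N. (of_nat n * h w) ^ k / fact k)) \<le>
          exp (real n * (c / 4 * v\<^sup>2)) * (real n * (K * \<bar>v\<bar> ^ 3)) ^ Suc N" for N
      proof -
        have "cmod (exp (of_nat n * h w) - (\<Sum>k\<le>N. (of_nat n * h w) ^ k / fact k)) \<le>
            exp \<bar>Re (of_nat n * h w)\<bar> * y ^ Suc N / fact N"
          unfolding y_def by (rule Taylor_exp)
        also have "\<dots> \<le> exp (real n * (c / 4 * v\<^sup>2)) * (real n * (K * \<bar>v\<bar> ^ 3)) ^ Suc N / 1"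
        proof (intro frac_le mult_mono power_mono y)
          show "exp \<bar>Re (of_nat n * h w)\<bar> \<le> exp (real n * (c / 4 * v\<^sup>2))"
            using abs_Re_le_cmod[of "of_nat n * h w"] y' by (simp add: y_def)
        qed (auto simp: y_def fact_ge_1 K)
        finally show ?thesis by simp
      qed
      have "Suc (2 * p + 1) = 2 * p + 2" by simp
      then have "cmod (exp (of_nat n * h w) - T) \<le>
          exp (real n * (c / 4 * v\<^sup>2)) * (real n * (K * \<bar>v\<bar> ^ 3)) ^ (2 * p + 2)"
        using le[of "2 * p + 1"] unfolding T_def by (simp only:)
      then have "E * cmod (exp (of_nat n * h w) - T) * cmod (g w) \<le>
         E * (exp (real n * (c / 4 * v\<^sup>2)) * (real n * (K * \<bar>v\<bar> ^ 3)) ^ (2 * p + 2)) * B"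
        using gw K E0 by (intro mult_mono mult_left_mono) (auto simp del: power_Suc)
      also have "E * (exp (real n * (c / 4 * v\<^sup>2)) * (real n * (K * \<bar>v\<bar> ^ 3)) ^ (2 * p + 2)) * B =
          B * (real n * K) ^ (2 * p + 2) * ((E * exp (real n * (c / 4 * v\<^sup>2))) * (\<bar>v\<bar> ^ 3) ^ (2 * p + 2))"
        by (simp only: power_mult_distrib mult_ac)
      also have "(\<bar>v\<bar> ^ 3) ^ (2 * p + 2) = v ^ (2 * (3 * p + 3))"
      proof -
        have "(\<bar>v\<bar> ^ 3) ^ (2 * p + 2) = \<bar>v\<bar> ^ (2 * (3 * p + 3))"
          unfolding power_mult[symmetric] by (rule arg_cong[of _ _ "\<lambda>k. \<bar>v\<bar> ^ k"]) simp
        then show ?thesis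
          by (simp only: power_mult power2_abs)
      qed
      also have "E * exp (real n * (c / 4 * v\<^sup>2)) = exp (- (real n * (c / 2) * v\<^sup>2 / 2))"
        unfolding E_def exp_add[symmetric] by (rule arg_cong[of _ _ exp]) (simp add: field_simps)
      finally show ?thesis
        using True by (simp add: norm_mult i_def E_def indicator_def abs_le_iff mult_ac)
    qed
  qed
  finally show ?thesis
    by (simp only: i_def E_def w_def)
qed

text \<open>Integrating the pointwise bound turns its powers of \<open>n\<close> into
  \<open>n^(2 p + 2 - (3 p + 3))\<close> and \<open>n^(q - (p + q + 1))\<close>, both equal to
  \<open>n^(-(p + 1))\<close>. The \<open>sqrt 2\<close> stems from the Gaussian with
  \<open>c / 2\<close>. The function \<open>g\<close> enters the constant only through its bound
  \<open>B\<close>.\<close>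

lemma laplace_error_bound:
  fixes h g :: "complex \<Rightarrow> complex" and H G :: "complex fps"
  assumes h: "h holomorphic_on ball 0 \<rho>" "h has_fps_expansion H" and g: "g holomorphic_on ball 0 \<rho>" "g has_fps_expansion G"
    and A: "\<And>w. w \<in> ball 0 \<rho> \<Longrightarrow> cmod (h w) \<le> A" and B: "\<And>w. w \<in> ball 0 \<rho> \<Longrightarrow> cmod (g w) \<le> B"
    and \<delta>: "0 < \<delta>" "2 * \<delta> < \<rho>"
    and K: "\<And>v. \<bar>v\<bar> \<le> \<delta> \<Longrightarrow> cmod (h (\<i> * of_real v)) \<le> K * \<bar>v\<bar> ^ 3" "4 * K * \<delta> \<le> c" "K \<ge> 0"
    and H: "\<And>j. j < 3 \<Longrightarrow> fps_nth H j = 0" and c: "c > 0" and n: "n > 0"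
  shows "cmod (of_real (sqrt (real n * c / (2 * pi))) * (\<integral>v. indicator {-\<delta>..\<delta>} v *\<^sub>R (exp (- (real n * c * v\<^sup>2 / 2)) *\<^sub>R
       (exp (of_nat n * h (\<i> * of_real v)) * g (\<i> * of_real v))) \<partial>lborel) -
       (\<Sum>k\<le>p. laplace_coeff c H G k / of_nat n ^ k))
    \<le> (B * K ^ (2 * p + 2) * sqrt 2 * (gauss_moment (3 * p + 3) / (c / 2) ^ (3 * p + 3)) +
      (\<Sum>q\<le>2 * p + 1. 2 * (A ^ q * B) / \<delta> ^ (2 * (p + q + 1)) * (gauss_moment (p + q + 1) / c ^ (p + q + 1)))) / real n ^ (p + 1)"
proof -
  define f where "f v = indicator {-\<delta>..\<delta>} v *\<^sub>R (exp (- (real n * c * v\<^sup>2 / 2)) *\<^sub>R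
       (exp (of_nat n * h (\<i> * of_real v)) * g (\<i> * of_real v)))" for v
  define S where "S v = (\<Sum>q\<le>2 * p + 1. \<Sum>j<2 * (p + q + 1). of_real (real n ^ q / fact q) * fps_nth (H ^ q * G) j *
      (exp (- (real n * c * v\<^sup>2 / 2)) *\<^sub>R (\<i> * of_real v) ^ j))" for v
  define D where "D v = B * (real n * K) ^ (2 * p + 2) * (exp (- (real n * (c / 2) * v\<^sup>2 / 2)) * v ^ (2 * (3 * p + 3))) +
      (\<Sum>q\<le>2 * p + 1. real n ^ q * (2 * (A ^ q * B) / \<delta> ^ (2 * (p + q + 1))) *
        (exp (- (real n * c * v\<^sup>2 / 2)) * v ^ (2 * (p + q + 1))))" for v
  define s where "s = sqrt (real n * c / (2 * pi))"
  have S: "integrable lborel S" "of_real s * (\<integral>v. S v \<partial>lborel) = (\<Sum>k\<le>p. laplace_coeff c H G k / of_nat n ^ k)"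
    unfolding S_def[abs_def] s_def by (rule laplace_main_term[OF c n H]; simp)+
  have sub: "(\<lambda>v. \<i> * complex_of_real v) ` {-\<delta>..\<delta>} \<subseteq> ball 0 \<rho>"
    using \<delta> by (auto simp: norm_mult)
  have line: "continuous_on {-\<delta>..\<delta>} (\<lambda>v. \<i> * complex_of_real v)"
    by (intro continuous_intros)
  have "continuous_on {-\<delta>..\<delta>} (\<lambda>v. h (\<i> * of_real v))"
    by (rule continuous_on_compose2[OF holomorphic_on_imp_continuous_on[OF h(1)] line sub])
  moreover have "continuous_on {-\<delta>..\<delta>} (\<lambda>v. g (\<i> * of_real v))"
    by (rule continuous_on_compose2[OF holomorphic_on_imp_continuous_on[OF g(1)] line sub])
  ultimately have cont: "continuous_on {-\<delta>..\<delta>} (\<lambda>v. exp (- (real n * c * v\<^sup>2 / 2)) *\<^sub>R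
       (exp (of_nat n * h (\<i> * of_real v)) * g (\<i> * of_real v)))"
    by (intro continuous_on_scaleR continuous_on_mult continuous_on_exp continuous_on_minus continuous_on_divide
        continuous_on_power continuous_on_const continuous_on_id) auto
  from cont have "set_integrable lborel {-\<delta>..\<delta>} (\<lambda>v. exp (- (real n * c * v\<^sup>2 / 2)) *\<^sub>R
       (exp (of_nat n * h (\<i> * of_real v)) * g (\<i> * of_real v)))"
    by (rule borel_integrable_atLeastAtMost')
  then have f: "integrable lborel f"
    by (simp add: set_integrable_def f_def[abs_def])
  have nc: "real n * c > 0" "real n * (c / 2) > 0"
    using n c by auto
  have D: "has_bochner_integral lborel D
      (B * (real n * K) ^ (2 * p + 2) * (sqrt (2 * pi / (real n * (c / 2))) * (gauss_moment (3 * p + 3) / (real n * (c / 2)) ^ (3 * p + 3))) +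
      (\<Sum>q\<le>2 * p + 1. real n ^ q * (2 * (A ^ q * B) / \<delta> ^ (2 * (p + q + 1))) *
        (sqrt (2 * pi / (real n * c)) * (gauss_moment (p + q + 1) / (real n * c) ^ (p + q + 1)))))"
    unfolding D_def[abs_def]
    by (intro has_bochner_integral_add has_bochner_integral_sum has_bochner_integral_mult_right
        has_bochner_integral_gauss_even nc)
  have "cmod ((\<integral>v. f v \<partial>lborel) - (\<integral>v. S v \<partial>lborel)) = cmod (\<integral>v. f v - S v \<partial>lborel)"
    using f S by simp
  also have "\<dots> \<le> (\<integral>v. cmod (f v - S v) \<partial>lborel)"
    by (rule integral_norm_bound)
  also have "\<dots> \<le> (\<integral>v. D v \<partial>lborel)"
  proof (rule integral_mono)
    show "cmod (f v - S v) \<le> D v" for v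
      unfolding f_def S_def D_def by (rule laplace_pointwise_bound[OF h g A B \<delta> K])
    show "integrable lborel D"
      using D by (rule integrable.intros)
    show "integrable lborel (\<lambda>v. cmod (f v - S v))"
      using f S(1) by (intro integrable_norm Bochner_Integration.integrable_diff)
  qed
  finally have le: "s * cmod ((\<integral>v. f v \<partial>lborel) - (\<integral>v. S v \<partial>lborel)) \<le> s * (\<integral>v. D v \<partial>lborel)"
    by (rule mult_left_mono) (use nc in \<open>auto simp: s_def\<close>)
  have s1: "s * sqrt (2 * pi / (real n * c)) = 1"
    using n c by (simp add: s_def flip: real_sqrt_mult)
  have s2: "s * sqrt (2 * pi / (real n * (c / 2))) = sqrt 2"
    unfolding s_def real_sqrt_mult[symmetric] using n c by (intro arg_cong[of _ _ sqrt]) (simp add: field_simps)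
  have "s * (\<integral>v. D v \<partial>lborel) = B * (real n * K) ^ (2 * p + 2) *
        ((s * sqrt (2 * pi / (real n * (c / 2)))) * (gauss_moment (3 * p + 3) / (real n * (c / 2)) ^ (3 * p + 3))) +
      (\<Sum>q\<le>2 * p + 1. real n ^ q * (2 * (A ^ q * B) / \<delta> ^ (2 * (p + q + 1))) *
        ((s * sqrt (2 * pi / (real n * c))) * (gauss_moment (p + q + 1) / (real n * c) ^ (p + q + 1))))"
  proof -
    have "s * (x * (y * z)) = x * ((s * y) * z)" for x y z
      by simp
    then show ?thesis
      unfolding has_bochner_integral_integral_eq[OF D] distrib_left sum_distrib_left by (simp only:)
  qed
  also have "\<dots> = B * (real n * K) ^ (2 * p + 2) *
        (sqrt 2 * (gauss_moment (3 * p + 3) / (real n * (c / 2)) ^ (3 * p + 3))) +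
      (\<Sum>q\<le>2 * p + 1. real n ^ q * (2 * (A ^ q * B) / \<delta> ^ (2 * (p + q + 1))) *
        (gauss_moment (p + q + 1) / (real n * c) ^ (p + q + 1)))"
    by (simp only: s1 s2 mult_1_left)
  also have "\<dots> = B * K ^ (2 * p + 2) * sqrt 2 * (gauss_moment (3 * p + 3) / (c / 2) ^ (3 * p + 3)) / real n ^ (p + 1) +
      (\<Sum>q\<le>2 * p + 1. 2 * (A ^ q * B) / \<delta> ^ (2 * (p + q + 1)) * (gauss_moment (p + q + 1) / c ^ (p + q + 1)) / real n ^ (p + 1))"
  proof (intro arg_cong2[of _ _ _ _ "(+)"] sum.cong refl)
    have e: "real n ^ (3 * p + 3) = real n ^ (2 * p + 2) * real n ^ (p + 1)"
      unfolding power_add[symmetric] by (rule arg_cong[of _ _ "power (real n)"]) simp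
    have aux: "b * (N * k) * (r * (m / (N * M * l))) = b * k * r * (m / l) / M" if "N \<noteq> 0" for b N k r m M l :: real
      using that by (simp add: mult_ac)
    show "B * (real n * K) ^ (2 * p + 2) *
        (sqrt 2 * (gauss_moment (3 * p + 3) / (real n * (c / 2)) ^ (3 * p + 3))) =
        B * K ^ (2 * p + 2) * sqrt 2 * (gauss_moment (3 * p + 3) / (c / 2) ^ (3 * p + 3)) / real n ^ (p + 1)"
      unfolding power_mult_distrib e by (rule aux) (use n in simp)
  next
    fix q
    have e: "real n ^ (p + q + 1) = real n ^ q * real n ^ (p + 1)"
      unfolding power_add[symmetric] by (rule arg_cong[of _ _ "power (real n)"]) simp
    have aux: "N * r * (m / (N * M * l)) = r * (m / l) / M" if "N \<noteq> 0" for N r m M l :: real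
      using that by (simp add: mult_ac)
    show "real n ^ q * (2 * (A ^ q * B) / \<delta> ^ (2 * (p + q + 1))) *
        (gauss_moment (p + q + 1) / (real n * c) ^ (p + q + 1)) =
      2 * (A ^ q * B) / \<delta> ^ (2 * (p + q + 1)) * (gauss_moment (p + q + 1) / c ^ (p + q + 1)) / real n ^ (p + 1)"
      unfolding power_mult_distrib[of "real n" c] e by (rule aux) (use n in simp)
  qed
  finally have sD: "s * (\<integral>v. D v \<partial>lborel) = (B * K ^ (2 * p + 2) * sqrt 2 * (gauss_moment (3 * p + 3) / (c / 2) ^ (3 * p + 3)) +
      (\<Sum>q\<le>2 * p + 1. 2 * (A ^ q * B) / \<delta> ^ (2 * (p + q + 1)) * (gauss_moment (p + q + 1) / c ^ (p + q + 1)))) / real n ^ (p + 1)"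
    by (simp only: add_divide_distrib sum_divide_distrib)
  have "s \<ge> 0" using nc by (simp add: s_def)
  then have "cmod (of_real s * (\<integral>v. f v \<partial>lborel) - of_real s * (\<integral>v. S v \<partial>lborel)) =
      s * cmod ((\<integral>v. f v \<partial>lborel) - (\<integral>v. S v \<partial>lborel))"
    unfolding right_diff_distrib[symmetric] norm_mult by simp
  with le show ?thesis
    unfolding sD S(2) by (simp only: s_def f_def)
qed

text \<open>The amplitude may vary with \<open>n\<close> under a common bound. The cutoff
  \<open>\<delta>\<close> is chosen before \<open>p\<close>, so one splitting of the line serves all
  orders.\<close>

lemma laplace_expansion:
  fixes h :: "complex \<Rightarrow> complex" and g :: "nat \<Rightarrow> complex \<Rightarrow> complex"
    and H :: "complex fps" and G :: "nat \<Rightarrow> complex fps"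
  assumes \<rho>: "\<rho> > 0" and c: "c > 0"
    and h: "h holomorphic_on ball 0 \<rho>" "h has_fps_expansion H"
    and H: "\<And>j. j < 3 \<Longrightarrow> fps_nth H j = 0"
    and g: "\<And>n. g n holomorphic_on ball 0 \<rho>" "\<And>n. g n has_fps_expansion G n"
    and B: "\<And>n w. w \<in> ball 0 \<rho> \<Longrightarrow> cmod (g n w) \<le> B"
  shows "\<exists>\<delta>>0. \<delta> < \<rho> \<and> (\<forall>p. \<exists>C. \<forall>n>0.
    cmod (of_real (sqrt (real n * c / (2 * pi))) *
      (\<integral>v. indicator {-\<delta>..\<delta>} v *\<^sub>R (exp (- (real n * c * v\<^sup>2 / 2)) *\<^sub>R
        (exp (of_nat n * h (\<i> * of_real v)) * g n (\<i> * of_real v))) \<partial>lborel) -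
      (\<Sum>k\<le>p. laplace_coeff c H (G n) k / of_nat n ^ k)) \<le> C / real n ^ (p + 1))"
proof -
  \<comment> \<open>\<open>h\<close> need not be bounded on the open disc; halving the radius makes
    it so by compactness.\<close>
  have sub: "cball 0 (\<rho> / 2) \<subseteq> ball (0::complex) \<rho>" "ball 0 (\<rho> / 2) \<subseteq> ball (0::complex) \<rho>"
    using \<rho> by auto
  have "compact (h ` cball 0 (\<rho> / 2))"
    using sub by (intro compact_continuous_image continuous_on_subset[OF holomorphic_on_imp_continuous_on[OF h(1)]]) auto
  then have "bounded (h ` cball 0 (\<rho> / 2))"
    by (rule compact_imp_bounded)
  then obtain A where A: "cmod (h w) \<le> A" if "w \<in> cball 0 (\<rho> / 2)" for w
    unfolding bounded_iff ball_simps by blast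
  have hol: "h holomorphic_on ball 0 (\<rho> / 2)" "g n holomorphic_on ball 0 (\<rho> / 2)" for n
    using h(1) g(1) sub by (blast intro: holomorphic_on_subset)+
  \<comment> \<open>This is the constant of \<open>truncated_taylor_bound\<close> for three terms,
    all of them zero, with cutoff \<open>\<rho> / 8\<close>; twice this cutoff is still below
    \<open>\<rho> / 2\<close>.\<close>
  define K where "K = 2 * A / (\<rho> / 8) ^ 3"
  have "A \<ge> 0"
    using A[of 0] \<rho> by (intro order_trans[OF norm_ge_zero]) auto
  then have K0: "K \<ge> 0" using \<rho> by (simp add: K_def)
  have K: "cmod (h (\<i> * of_real v)) \<le> K * \<bar>v\<bar> ^ 3" if "\<bar>v\<bar> \<le> \<rho> / 8" for v
  proof -
    have "cmod (indicator {-(\<rho> / 8)..\<rho> / 8} v *\<^sub>R h (\<i> * of_real v) - (\<Sum>j<3. fps_nth H j * (\<i> * of_real v) ^ j))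
        \<le> K * \<bar>v\<bar> ^ 3"
      unfolding K_def using \<rho> A by (intro truncated_taylor_bound[OF hol(1) h(2)]) auto
    moreover have "(\<Sum>j<3. fps_nth H j * (\<i> * of_real v) ^ j) = 0"
      by (intro sum.neutral) (simp add: H)
    moreover have "indicat_real {-(\<rho> / 8)..\<rho> / 8} v = 1"
      using that by (auto simp: indicator_def)
    ultimately show ?thesis
      by simp
  qed
  \<comment> \<open>The second bound ensures \<open>4 * K * \<delta> \<le> c\<close>;
    \<open>K + 1\<close> avoids a division by zero when \<open>K = 0\<close>.\<close>
  define \<delta> where "\<delta> = min (\<rho> / 8) (c / (4 * (K + 1)))"
  have \<delta>: "0 < \<delta>" "\<delta> \<le> \<rho> / 8" "\<delta> \<le> c / (4 * (K + 1))"
    unfolding \<delta>_def using \<rho> c K0 by (simp, intro min.cobounded1, intro min.cobounded2)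
  have "4 * K * \<delta> \<le> 4 * (K + 1) * \<delta>"
    using \<delta> K0 by simp
  also have "\<dots> \<le> c"
    using \<delta>(3) K0 by (simp add: field_simps)
  finally have K\<delta>: "4 * K * \<delta> \<le> c" .
  have \<delta>2: "2 * \<delta> < \<rho> / 2"
    using \<delta> \<rho> by linarith
  have A': "cmod (h w) \<le> A" if "w \<in> ball 0 (\<rho> / 2)" for w
    using that A by auto
  have B': "cmod (g n w) \<le> B" if "w \<in> ball 0 (\<rho> / 2)" for n w
    using that B sub by auto
  have K': "cmod (h (\<i> * of_real v)) \<le> K * \<bar>v\<bar> ^ 3" if "\<bar>v\<bar> \<le> \<delta>" for v
    using K that \<delta> by simp
  note bound = laplace_error_bound[OF hol(1) h(2) hol(2) g(2) A' B' \<delta>(1) \<delta>2 K' K\<delta> K0 H c]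
  have "\<exists>C. \<forall>n>0.
    cmod (of_real (sqrt (real n * c / (2 * pi))) *
      (\<integral>v. indicator {-\<delta>..\<delta>} v *\<^sub>R (exp (- (real n * c * v\<^sup>2 / 2)) *\<^sub>R
        (exp (of_nat n * h (\<i> * of_real v)) * g n (\<i> * of_real v))) \<partial>lborel) -
      (\<Sum>k\<le>p. laplace_coeff c H (G n) k / of_nat n ^ k)) \<le> C / real n ^ (p + 1)" for p
  proof (rule exI, intro allI impI)
    fix n :: nat assume "n > 0"
    show "cmod (of_real (sqrt (real n * c / (2 * pi))) *
      (\<integral>v. indicator {-\<delta>..\<delta>} v *\<^sub>R (exp (- (real n * c * v\<^sup>2 / 2)) *\<^sub>R
        (exp (of_nat n * h (\<i> * of_real v)) * g n (\<i> * of_real v))) \<partial>lborel) -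
      (\<Sum>k\<le>p. laplace_coeff c H (G n) k / of_nat n ^ k)) \<le>
      (B * K ^ (2 * p + 2) * sqrt 2 * (gauss_moment (3 * p + 3) / (c / 2) ^ (3 * p + 3)) +
      (\<Sum>q\<le>2 * p + 1. 2 * (A ^ q * B) / \<delta> ^ (2 * (p + q + 1)) * (gauss_moment (p + q + 1) / c ^ (p + q + 1)))) / real n ^ (p + 1)"
      by (rule bound) (assumption | rule \<open>n > 0\<close>)+
  qed
  moreover have "\<delta> < \<rho>"
    using \<delta> \<rho> by linarith
  ultimately show ?thesis
    using \<delta>(1) by blast
qed

section \<open>The saddle point expansion\<close>

text \<open>Along the real axis the complex derivative is the derivative of a real function, so its
  imaginary part is the derivative of 0. This identifies the Taylor coefficients of the complex
  logarithm with the real derivatives in \<open>ell\<close>.\<close>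

lemma higher_deriv_of_real:
  fixes f :: "complex \<Rightarrow> complex" and F :: "real \<Rightarrow> real"
  assumes S: "open S" and f: "f holomorphic_on S" and T: "open T"
    and F: "\<And>u. u \<in> T \<Longrightarrow> of_real u \<in> S" "\<And>u. u \<in> T \<Longrightarrow> f (of_real u) = of_real (F u)"
  shows "u \<in> T \<Longrightarrow> (deriv ^^ j) f (of_real u) = of_real ((deriv ^^ j) F u)"
proof (induction j arbitrary: u)
  case 0
  then show ?case by (simp add: F)
next
  case (Suc j)
  let ?f = "(deriv ^^ j) f" and ?F = "(deriv ^^ j) F"
  have "?f holomorphic_on S"
    by (rule holomorphic_higher_deriv[OF f S])
  then have "(?f has_field_derivative deriv ?f (of_real u)) (at (of_real u))"
    by (rule holomorphic_derivI[OF _ S F(1)[OF Suc.prems]])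
  then have "((\<lambda>v. ?f (of_real v)) has_vector_derivative deriv ?f (of_real u)) (at u)"
    by (rule has_vector_derivative_real_field)
  then have d: "((\<lambda>v. of_real (?F v)) has_vector_derivative deriv ?f (of_real u)) (at u)"
    by (rule has_vector_derivative_transform_within_open[OF _ T Suc.prems]) (rule Suc.IH)
  have "(?F has_real_derivative Re (deriv ?f (of_real u))) (at u)"
    using has_field_derivative_Re[OF d] by simp
  moreover have "((\<lambda>v. 0) has_real_derivative Im (deriv ?f (of_real u))) (at u)"
    using has_field_derivative_Im[OF d] by simp
  then have "Im (deriv ?f (of_real u)) = 0"
    using DERIV_unique[OF _ DERIV_const] by blast
  ultimately show ?case
    by (simp add: complex_eq_iff DERIV_imp_deriv)
qed

text \<open>The principal logarithm is holomorphic where \<open>cmgf\<close> avoids its cut. A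
  neighbourhood of the positive axis is enough: away from the saddle only powers of
  \<open>cmgf\<close> occur, and no logarithm.\<close>

definition cumulant_domain :: "complex set" where
  "cumulant_domain = {z. Re z > 0} \<inter> cmgf -` (- \<real>\<^sub>\<le>\<^sub>0)"

definition cumulant :: "complex \<Rightarrow> complex" where
  "cumulant z = Ln (cmgf z)"

lemma holomorphic_on_cmgf: "cmgf holomorphic_on {z. Re z > 0}"
  unfolding cmgf_def by (auto intro!: holomorphic_intros)

lemma open_cumulant_domain: "open cumulant_domain"
  unfolding cumulant_domain_def
  by (intro continuous_open_preimage holomorphic_on_imp_continuous_on holomorphic_on_cmgf
      open_halfspace_Re_gt open_Compl closed_nonpos_Reals_complex)

lemma holomorphic_on_cumulant: "cumulant holomorphic_on cumulant_domain"
  unfolding cumulant_def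
  by (intro holomorphic_on_Ln' holomorphic_on_subset[OF holomorphic_on_cmgf]) (auto simp: cumulant_domain_def)

lemma cmgf_of_real: "t > 0 \<Longrightarrow> cmgf (of_real t) = of_real (exp (L_D t))"
  using mgf_pos[of t] by (simp add: cmgf_def L_D_def exp_of_real)

lemma of_real_in_cumulant_domain: "t > 0 \<Longrightarrow> of_real t \<in> cumulant_domain"
  by (simp add: cumulant_domain_def cmgf_of_real)

lemma cumulant_of_real: "t > 0 \<Longrightarrow> cumulant (of_real t) = of_real (L_D t)"
  by (simp add: cumulant_def cmgf_of_real Ln_of_real)

lemma higher_deriv_cumulant:
  assumes "t > 0"
  shows "(deriv ^^ j) cumulant (of_real t) = of_real ((deriv ^^ j) L_D t)"
  using assms by (intro higher_deriv_of_real[OF open_cumulant_domain holomorphic_on_cumulant, of "{0<..}"])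
    (auto simp: of_real_in_cumulant_domain cumulant_of_real)

lemma exp_cumulant: "z \<in> cumulant_domain \<Longrightarrow> exp (cumulant z) = cmgf z"
  unfolding cumulant_def cumulant_domain_def by (intro exp_Ln) auto

definition phase_fps :: "real \<Rightarrow> complex fps" where
  "phase_fps x = Abs_fps (\<lambda>j. if j < 3 then 0 else of_real (ell j x / fact j))"

text \<open>The factor \<open>exp (- a w)\<close> is what remains of \<open>exp (- m w)\<close> when
  \<open>m = n x + a\<close>; the other factor is \<open>t / z\<close> for
  \<open>z = t + w\<close>.\<close>

definition amplitude_fps :: "real \<Rightarrow> real \<Rightarrow> complex fps" where
  "amplitude_fps t a = fps_exp (- of_real a) * inverse (1 + fps_const (of_real (1 / t)) * fps_X)"

text \<open>The linear coefficient cancels because \<open>L_D' (t_of x) = x\<close>; the quadratic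
  one is removed because it forms the Gaussian weight.\<close>

lemma has_fps_expansion_phase:
  assumes x: "1 / 2 < x" "x < 1"
  defines "t \<equiv> t_of x"
  shows "(\<lambda>w. cumulant (of_real t + w) - of_real (L_D t) - of_real x * w - of_real (ell 2 x / 2) * w\<^sup>2)
    has_fps_expansion phase_fps x"
proof -
  have t: "t > 0" unfolding t_def by (rule t_of_pos[OF x])
  have "cumulant analytic_on {of_real t}"
    using of_real_in_cumulant_domain[OF t] open_cumulant_domain holomorphic_on_cumulant
    by (auto simp: analytic_at)
  note analytic_at_imp_has_fps_expansion[OF this, fps_expansion_intros]
  have "(\<lambda>w. cumulant (of_real t + w) - of_real (L_D t) - of_real x * w - of_real (ell 2 x / 2) * w\<^sup>2)
    has_fps_expansion (fps_expansion cumulant (of_real t) - fps_const (of_real (L_D t)) -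
      fps_const (of_real x) * fps_X - fps_const (of_real (ell 2 x / 2)) * fps_X ^ 2)"
    by (intro fps_expansion_intros)
  also have "fps_expansion cumulant (of_real t) - fps_const (of_real (L_D t)) -
      fps_const (of_real x) * fps_X - fps_const (of_real (ell 2 x / 2)) * fps_X ^ 2 = phase_fps x"
  proof (rule fps_ext)
    fix j :: nat
    have e: "fps_nth (fps_expansion cumulant (of_real t)) j = of_real ((deriv ^^ j) L_D t / fact j)" for j
      by (simp add: fps_expansion_def higher_deriv_cumulant[OF t])
    have d1: "deriv L_D t = x"
      unfolding t_def by (rule deriv_L_D_t_of[OF x])
    have l: "ell i x = (deriv ^^ i) L_D t" for i
      by (simp add: ell_def t_def)
    consider "j = 0" | "j = 1" | "j = 2" | "j \<ge> 3" by linarith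
    then show "fps_nth (fps_expansion cumulant (of_real t) - fps_const (of_real (L_D t)) -
      fps_const (of_real x) * fps_X - fps_const (of_real (ell 2 x / 2)) * fps_X ^ 2) j = fps_nth (phase_fps x) j"
      by cases (simp_all add: e d1 l phase_fps_def fps_X_power_nth)
  qed
  finally show ?thesis .
qed

lemma has_fps_expansion_amplitude:
  "(\<lambda>w. exp (- of_real a * w) * inverse (1 + of_real (1 / t) * w)) has_fps_expansion amplitude_fps t a"
  unfolding amplitude_fps_def by (intro fps_expansion_intros) auto

section \<open>Splitting the saddle point integral\<close>

lemma power_times_geometric_bounded:
  fixes q :: real
  assumes q: "0 < q" "q < 1"
  shows "\<exists>C. \<forall>n. real n ^ k * q ^ n \<le> C"
proof (cases "k = 0")
  case True
  then show ?thesis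
    using q by (auto intro!: exI[of _ 1] power_le_one)
next
  case False
  \<comment> \<open>With the \<open>k\<close>-th root of \<open>q\<close> the sequence becomes the
    \<open>k\<close>-th power of \<open>n * r ^ n\<close>, which tends to 0.\<close>
  define r where "r = root k q"
  have r: "0 < r" "r < 1" "r ^ k = q"
    using False q by (auto simp: r_def)
  have "(\<lambda>n. real n * r ^ n) \<longlonglongrightarrow> 0"
    using r powser_times_n_limit_0[of r] by simp
  then have "Bseq (\<lambda>n. real n * r ^ n)"
    by (intro convergent_imp_Bseq convergentI)
  then obtain C where C: "\<And>n. \<bar>real n * r ^ n\<bar> \<le> C"
    by (auto simp: Bseq_def)
  have "real n ^ k * q ^ n \<le> C ^ k" for n
  proof -
    have "real n ^ k * q ^ n = (real n * r ^ n) ^ k"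
      unfolding r(3)[symmetric] by (simp add: power_mult_distrib mult.commute flip: power_mult)
    also have "\<dots> \<le> C ^ k"
      using C[of n] r by (intro power_mono) auto
    finally show ?thesis .
  qed
  then show ?thesis by blast
qed

text \<open>The Bromwich kernel on the line, divided by its value at \<open>v = 0\<close>.\<close>

definition saddle_integrand :: "real \<Rightarrow> nat \<Rightarrow> real \<Rightarrow> real \<Rightarrow> complex" where
  "saddle_integrand t n m v =
     (cmgf (Complex t v) / cmgf (of_real t)) ^ n * exp (- (\<i> * of_real (m * v))) / (1 + \<i> * of_real (v / t))"

lemma bromwich_kernel_eq_saddle_integrand:
  assumes t: "t > 0"
  shows "bromwich_kernel n m (Complex t v) =
    of_real (exp (real n * L_D t - m * t) / t) * saddle_integrand t n m v"
proof -
  have z: "Complex t v = of_real t * (1 + \<i> * of_real (v / t))"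
    using t by (simp add: complex_eq_iff)
  have e: "exp (- of_real m * Complex t v) = of_real (exp (- m * t)) * exp (- (\<i> * of_real (m * v)))"
  proof -
    have "- of_real m * Complex t v = of_real (- m * t) + - (\<i> * of_real (m * v))"
      by (simp add: complex_eq_iff)
    then show ?thesis
      by (simp only: exp_add exp_of_real)
  qed
  have "exp (real n * L_D t - m * t) = exp (L_D t) ^ n * exp (- m * t)"
    by (simp add: exp_of_nat_mult[symmetric] flip: exp_add)
  then have "of_real (exp (real n * L_D t - m * t) / t) =
      cmgf (of_real t) ^ n * of_real (exp (- m * t)) / (of_real t :: complex)"
    by (simp add: cmgf_of_real[OF t])
  moreover have "cmgf (of_real t) \<noteq> 0"
    by (simp add: cmgf_of_real[OF t])
  moreover have "bromwich_kernel n m (Complex t v) =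
      cmgf (Complex t v) ^ n * exp (- of_real m * Complex t v) / Complex t v"
    by (simp add: bromwich_kernel_def cmgf_def power_divide)
  moreover have "Complex t v \<noteq> 0"
    by (rule Complex_neq_0[OF t])
  moreover have "R ^ n * (a * b) / (u * w) = M ^ n * a / u * ((R / M) ^ n * b / w)" if "M \<noteq> 0" for R M a b u w :: complex
    using that by (simp add: power_divide)
  ultimately show ?thesis
    unfolding saddle_integrand_def e by (metis z)
qed

lemma integrable_saddle_integrand:
  assumes t: "t > 0" and n: "n \<ge> 1"
  shows "integrable lborel (saddle_integrand t n m)"
proof -
  have "saddle_integrand t n m = (\<lambda>v. of_real (t / exp (real n * L_D t - m * t)) * bromwich_kernel n m (Complex t v))"
    using t by (simp add: fun_eq_iff bromwich_kernel_eq_saddle_integrand[OF t])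
  then show ?thesis
    using integrable_bromwich_kernel[OF t n] by simp
qed

text \<open>\<open>v^2 / (1 + v^2 / t^2)\<close> increases with \<open>|v|\<close>, so outside the
  cutoff the modulus of the ratio is at most its bound \<open>q\<close> at \<open>\<delta>\<close>.
  The estimate is uniform in \<open>m\<close>, which only enters through a factor of modulus
  1.\<close>

lemma saddle_integrand_tail:
  assumes t: "t > 0" and \<delta>: "\<delta> > 0"
  shows "\<exists>C q. 0 < q \<and> q < 1 \<and> (\<forall>n\<ge>1. \<forall>m.
    cmod (\<integral>v. indicator (- {-\<delta>..\<delta>}) v *\<^sub>R saddle_integrand t n m v \<partial>lborel) \<le> C * q ^ n)"
proof -
  define c where "c = tilted_variance t"
  have c: "c > 0" unfolding c_def by (rule tilted_variance_pos[OF t])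
  define q where "q = exp (- (c * (\<delta>\<^sup>2 / (1 + \<delta>\<^sup>2 / t\<^sup>2)) / 2))"
  have w: "1 + v\<^sup>2 / t\<^sup>2 > 0" for v :: real
    by (simp add: add_pos_nonneg)
  have q: "0 < q" "q < 1"
  proof -
    have "c * (\<delta>\<^sup>2 / (1 + \<delta>\<^sup>2 / t\<^sup>2)) / 2 > 0"
      using c \<delta> w[of \<delta>] by (intro divide_pos_pos mult_pos_pos) auto
    then show "0 < q" "q < 1"
      unfolding q_def by auto
  qed
  define D where "D = (exp t + 1) * t / exp (L_D t)"
  have D: "D \<ge> 0" using t by (simp add: D_def add_nonneg_nonneg)
  have bound: "cmod (indicator (- {-\<delta>..\<delta>}) v *\<^sub>R saddle_integrand t n m v) \<le> D * q ^ (n - 1) * (1 / (t\<^sup>2 + v\<^sup>2))"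
    if n: "n \<ge> 1" for n m v
  proof (cases "\<bar>v\<bar> \<le> \<delta>")
    case True
    then have "v \<in> {-\<delta>..\<delta>}" by auto
    then show ?thesis using D q by simp
  next
    case False
    let ?R = "cmod (cmgf (Complex t v) / cmgf (of_real t))" and ?r = "cmod (Complex t v)"
    have r: "?r > 0" using Complex_neq_0[OF t] by simp
    have "\<delta>\<^sup>2 \<le> v\<^sup>2"
      using False \<delta> by (subst abs_le_square_iff[symmetric]) auto
    then have "\<delta>\<^sup>2 / (1 + \<delta>\<^sup>2 / t\<^sup>2) \<le> v\<^sup>2 / (1 + v\<^sup>2 / t\<^sup>2)"
      using w[of v] w[of \<delta>] by (simp add: frac_le_eq divide_simps) (simp add: field_simps)
    then have "c * (\<delta>\<^sup>2 / (1 + \<delta>\<^sup>2 / t\<^sup>2)) / 2 \<le> c * (v\<^sup>2 / (1 + v\<^sup>2 / t\<^sup>2)) / 2"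
      using c by (intro divide_right_mono mult_left_mono) auto
    then have Rq: "?R \<le> q"
      using norm_cmgf_ratio_le[OF t, of v] unfolding q_def c_def
      by (elim order_trans) (simp add: mult.commute)
    have R: "?R \<le> (exp t + 1) / ?r / exp (L_D t)"
    proof -
      have "?R = cmod (exp (Complex t v) - 1) / ?r / exp (L_D t)"
        unfolding norm_divide[of "cmgf (Complex t v)"] cmgf_of_real[OF t] norm_of_real
        by (simp only: cmgf_def norm_divide abs_exp_cancel)
      then show ?thesis
        using norm_exp_minus_1_le[of t v] by (simp only:) (intro divide_right_mono, auto)
    qed
    have "Complex t v = of_real t * (1 + \<i> * of_real (v / t))"
      using t by (simp add: complex_eq_iff)
    then have "?r = cmod (of_real t * (1 + \<i> * of_real (v / t)))"
      by (rule arg_cong)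
    then have "?r = t * cmod (1 + \<i> * of_real (v / t))"
      using t by (simp only: norm_mult norm_of_real abs_of_pos)
    then have a: "cmod (1 + \<i> * of_real (v / t)) = ?r / t"
      using t by simp
    have "cmod (indicator (- {-\<delta>..\<delta>}) v *\<^sub>R saddle_integrand t n m v) \<le> cmod (saddle_integrand t n m v)"
      by (auto simp: indicator_def)
    also have "\<dots> = ?R ^ n / (?r / t)"
      unfolding saddle_integrand_def norm_divide[of _ "1 + \<i> * of_real (v / t)"] a norm_mult norm_power by simp
    \<comment> \<open>One factor \<open>?R\<close> is not estimated by \<open>q\<close>: its decay
      \<open>1 / |z|\<close> together with that of the denominator makes the bound integrable in
      \<open>v\<close>.\<close>
    also have "?R ^ n = ?R ^ (n - 1) * ?R"
      using n by (metis Suc_diff_1 less_le_trans power_Suc2 zero_less_one)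
    also have "?R ^ (n - 1) * ?R / (?r / t) \<le> q ^ (n - 1) * ((exp t + 1) / ?r / exp (L_D t)) / (?r / t)"
      using Rq R q r t by (intro divide_right_mono mult_mono power_mono) (auto simp del: complex_norm)
    also have "\<dots> = D * q ^ (n - 1) * (1 / ?r\<^sup>2)"
      by (simp add: D_def power2_eq_square mult_ac del: complex_norm)
    also have "?r\<^sup>2 = t\<^sup>2 + v\<^sup>2"
      by (rule norm_complex_eq)
    finally show ?thesis .
  qed
  define C where "C = D * (\<integral>v. 1 / (t\<^sup>2 + v\<^sup>2) \<partial>lborel) / q"
  have "cmod (\<integral>v. indicator (- {-\<delta>..\<delta>}) v *\<^sub>R saddle_integrand t n m v \<partial>lborel) \<le> C * q ^ n"
    if n: "n \<ge> 1" for n m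
  proof -
    have "cmod (\<integral>v. indicator (- {-\<delta>..\<delta>}) v *\<^sub>R saddle_integrand t n m v \<partial>lborel)
        \<le> (\<integral>v. cmod (indicator (- {-\<delta>..\<delta>}) v *\<^sub>R saddle_integrand t n m v) \<partial>lborel)"
      by (rule integral_norm_bound)
    also have "\<dots> \<le> (\<integral>v. D * q ^ (n - 1) * (1 / (t\<^sup>2 + v\<^sup>2)) \<partial>lborel)"
      by (intro integral_mono integrable_norm integrable_mult_indicator integrable_saddle_integrand t n
          integrable_mult_right integrable_inverse_sum_squares bound) auto
    also have "\<dots> = D * q ^ (n - 1) * (\<integral>v. 1 / (t\<^sup>2 + v\<^sup>2) \<partial>lborel)"
      by (rule integral_mult_right_zero)
    also have "q ^ (n - 1) = q ^ n / q"
      using q n by (simp add: power_diff)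
    finally show ?thesis
      by (simp add: C_def mult_ac)
  qed
  then show ?thesis
    using q by blast
qed

text \<open>Laplace's method applies on the cutoff interval, as \<open>0 \<le> a n \<le> 1\<close>
  bounds the amplitudes uniformly. The rest of the line is exponentially small and is absorbed into
  the error.\<close>

lemma saddle_integrand_expansion:
  fixes a m :: "nat \<Rightarrow> real"
  assumes x: "1 / 2 < x" "x < 1" and a: "\<And>n. 0 \<le> a n" "\<And>n. a n \<le> 1" and m: "\<And>n. m n = real n * x + a n"
  shows "\<exists>C. \<forall>n>0. cmod (of_real (sqrt (real n * ell 2 x / (2 * pi))) *
      (\<integral>v. saddle_integrand (t_of x) n (m n) v \<partial>lborel) -
      (\<Sum>k\<le>p. laplace_coeff (ell 2 x) (phase_fps x) (amplitude_fps (t_of x) (a n)) k / of_nat n ^ k))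
      \<le> C / real n ^ (p + 1)"
proof -
  define t where "t = t_of x"
  define c where "c = ell 2 x"
  have t: "t > 0" unfolding t_def by (rule t_of_pos[OF x])
  have c: "c > 0" "c = tilted_variance t"
    using tilted_variance_pos[OF t] by (simp_all add: c_def ell_2_eq[OF x] t_def)
  obtain r where r: "r > 0" "ball (of_real t) r \<subseteq> cumulant_domain"
    using openE[OF open_cumulant_domain of_real_in_cumulant_domain[OF t]] by blast
  \<comment> \<open>Radius \<open>r\<close> stays inside the domain of the logarithm, and
    \<open>t / 2\<close> keeps \<open>|1 + w / t|\<close> at least \<open>1 / 2\<close>.\<close>
  define \<rho> where "\<rho> = min r (t / 2)"
  have \<rho>: "\<rho> > 0" "\<rho> \<le> t / 2" "\<rho> \<le> r"
    using r t by (auto simp: \<rho>_def)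
  have dom: "of_real t + w \<in> cumulant_domain" if "w \<in> ball 0 \<rho>" for w
    using that \<rho>(3) by (intro subsetD[OF r(2)]) (simp add: dist_norm)
  define h where "h w = cumulant (of_real t + w) - of_real (L_D t) - of_real x * w - of_real (c / 2) * w\<^sup>2" for w :: complex
  define g where "g n w = exp (- of_real (a n) * w) * inverse (1 + of_real (1 / t) * w)" for n and w :: complex
  have den: "1 / 2 \<le> cmod (1 + of_real (1 / t) * w)" if "w \<in> ball 0 \<rho>" for w
  proof -
    have "cmod (of_real (1 / t) * w) = cmod w / t"
      using t by (simp add: norm_mult norm_divide)
    also have "\<dots> \<le> 1 / 2"
      using that \<rho>(2) t by (simp add: field_simps)
    finally show ?thesis
      using norm_diff_ineq[of 1 "of_real (1 / t) * w"] by simp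
  qed
  have hol_h: "h holomorphic_on ball 0 \<rho>"
  proof -
    have "cumulant \<circ> (\<lambda>w. of_real t + w) holomorphic_on ball 0 \<rho>"
    proof (rule holomorphic_on_compose_gen[OF _ holomorphic_on_cumulant])
      show "(\<lambda>w. of_real t + w) holomorphic_on ball 0 \<rho>"
        by (intro holomorphic_intros)
      show "(\<lambda>w. of_real t + w) ` ball 0 \<rho> \<subseteq> cumulant_domain"
        by (rule image_subsetI) (rule dom)
    qed
    then show ?thesis
      unfolding h_def o_def by (intro holomorphic_intros)
  qed
  have fps_h: "h has_fps_expansion phase_fps x"
    unfolding h_def c_def t_def by (rule has_fps_expansion_phase[OF x])
  have nz: "1 + of_real (1 / t) * w \<noteq> 0" if "w \<in> ball 0 \<rho>" for w :: complex
    using den[OF that] by auto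
  have hol_g: "g n holomorphic_on ball 0 \<rho>" for n
    unfolding g_def by (intro holomorphic_intros nz)
  have fps_g: "g n has_fps_expansion amplitude_fps t (a n)" for n
    unfolding g_def by (rule has_fps_expansion_amplitude)
  have bound_g: "cmod (g n w) \<le> exp \<rho> * 2" if w: "w \<in> ball 0 \<rho>" for n w
  proof -
    have "- (a n * Re w) \<le> \<bar>a n\<bar> * \<bar>Re w\<bar>"
      by (metis abs_ge_minus_self abs_mult)
    also have "\<dots> \<le> 1 * cmod w"
      using a[of n] abs_Re_le_cmod[of w] by (intro mult_mono) auto
    also have "\<dots> \<le> \<rho>" using w by simp
    finally have "exp (- (a n * Re w)) \<le> exp \<rho>" by simp
    moreover have "inverse (cmod (1 + of_real (1 / t) * w)) \<le> inverse (1 / 2)"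
      using den[OF w] by (intro le_imp_inverse_le) auto
    ultimately show ?thesis
      unfolding g_def norm_mult norm_inverse norm_exp_eq_Re by (intro mult_mono) auto
  qed
  have phase0: "fps_nth (phase_fps x) j = 0" if "j < 3" for j
    using that by (simp add: phase_fps_def)
  have "\<exists>\<delta>>0. \<delta> < \<rho> \<and> (\<forall>p. \<exists>C. \<forall>n>0.
    cmod (of_real (sqrt (real n * c / (2 * pi))) *
      (\<integral>v. indicator {-\<delta>..\<delta>} v *\<^sub>R (exp (- (real n * c * v\<^sup>2 / 2)) *\<^sub>R
        (exp (of_nat n * h (\<i> * of_real v)) * g n (\<i> * of_real v))) \<partial>lborel) -
      (\<Sum>k\<le>p. laplace_coeff c (phase_fps x) (amplitude_fps t (a n)) k / of_nat n ^ k)) \<le> C / real n ^ (p + 1))"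
    by (rule laplace_expansion[OF \<rho>(1) c(1) hol_h fps_h phase0 hol_g fps_g bound_g])
  then obtain \<delta> where \<delta>: "\<delta> > 0" "\<delta> < \<rho>" and expansion: "\<forall>p. \<exists>C. \<forall>n>0.
    cmod (of_real (sqrt (real n * c / (2 * pi))) *
      (\<integral>v. indicator {-\<delta>..\<delta>} v *\<^sub>R (exp (- (real n * c * v\<^sup>2 / 2)) *\<^sub>R
        (exp (of_nat n * h (\<i> * of_real v)) * g n (\<i> * of_real v))) \<partial>lborel) -
      (\<Sum>k\<le>p. laplace_coeff c (phase_fps x) (amplitude_fps t (a n)) k / of_nat n ^ k)) \<le> C / real n ^ (p + 1)"
    by (elim exE conjE)
  have local: "indicator {-\<delta>..\<delta>} v *\<^sub>R (exp (- (real n * c * v\<^sup>2 / 2)) *\<^sub>R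
        (exp (of_nat n * h (\<i> * of_real v)) * g n (\<i> * of_real v))) =
      indicator {-\<delta>..\<delta>} v *\<^sub>R saddle_integrand t n (m n) v" for n v
  proof (cases "\<bar>v\<bar> \<le> \<delta>")
    case True
    have "\<i> * of_real v \<in> ball 0 \<rho>"
      using True \<delta> by (simp add: norm_mult)
    from dom[OF this] have "exp (cumulant (of_real t + \<i> * of_real v)) = cmgf (of_real t + \<i> * of_real v)"
      by (rule exp_cumulant)
    moreover have "of_real t + \<i> * of_real v = Complex t v"
      by (simp add: complex_eq_iff)
    ultimately have ratio: "cmgf (Complex t v) / cmgf (of_real t) =
        exp (cumulant (of_real t + \<i> * of_real v) - of_real (L_D t))"
      by (simp add: exp_diff cmgf_of_real[OF t] exp_of_real)
    define u where "u = \<i> * complex_of_real v"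
    define \<kappa> where "\<kappa> = cumulant (of_real t + u) - of_real (L_D t)"
    \<comment> \<open>Since \<open>u^2 = - v^2\<close>, the Gaussian restores the quadratic term
      taken out of \<open>h\<close>. The linear terms \<open>- n x u\<close> and
      \<open>- a u\<close> combine to \<open>- m u\<close>.\<close>
    have "of_real (- (real n * c * v\<^sup>2 / 2)) + of_nat n * h u + (- of_real (a n) * u)
        = of_nat n * \<kappa> + - (of_real (m n) * u)"
    proof -
      have "u\<^sup>2 = - of_real (v\<^sup>2)"
        by (simp add: u_def power_mult_distrib)
      then have "of_real (- (real n * c * v\<^sup>2 / 2)) = of_nat n * (of_real (c / 2) * u\<^sup>2)"
        by simp
      moreover have "N * (d * U) + N * (\<kappa> - X * u - d * U) + - A * u = N * \<kappa> + - ((N * X + A) * u)"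
        for N d U X A :: complex
        by (simp add: algebra_simps)
      ultimately show ?thesis
        unfolding h_def \<kappa>_def[symmetric] m by (simp only: of_real_add of_real_mult of_real_of_nat_eq)
    qed
    then have "exp (of_real (- (real n * c * v\<^sup>2 / 2))) * exp (of_nat n * h u) * exp (- of_real (a n) * u)
        = exp (of_nat n * \<kappa>) * exp (- (of_real (m n) * u))"
      by (simp only: exp_add[symmetric])
    then have "exp (- (real n * c * v\<^sup>2 / 2)) *\<^sub>R (exp (of_nat n * h u) * exp (- of_real (a n) * u))
        = exp \<kappa> ^ n * exp (- (of_real (m n) * u))"
      by (simp only: scaleR_conv_of_real exp_of_real exp_of_nat_mult mult.assoc)
    moreover have "saddle_integrand t n (m n) v = exp \<kappa> ^ n * exp (- (of_real (m n) * u)) / (1 + of_real (1 / t) * u)"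
    proof -
      have "\<i> * of_real (m n * v) = of_real (m n) * u" "\<i> * of_real (v / t) = of_real (1 / t) * u"
        by (simp_all add: u_def)
      then show ?thesis
        unfolding saddle_integrand_def ratio u_def[symmetric] \<kappa>_def[symmetric] by (simp only:)
    qed
    moreover have "e *\<^sub>R (y * (z * inverse d)) = e *\<^sub>R (y * z) / d" for e and y z d :: complex
      by (simp add: divide_inverse mult.assoc)
    ultimately have "exp (- (real n * c * v\<^sup>2 / 2)) *\<^sub>R (exp (of_nat n * h u) * g n u) = saddle_integrand t n (m n) v"
      unfolding g_def by (simp only:)
    then show ?thesis
      by (simp add: u_def)
  next
    case False
    then have "v \<notin> {-\<delta>..\<delta>}" by auto
    then show ?thesis by simp
  qed
  obtain C1 where C1: "\<And>n. n > 0 \<Longrightarrow> cmod (of_real (sqrt (real n * c / (2 * pi))) *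
      (\<integral>v. indicator {-\<delta>..\<delta>} v *\<^sub>R saddle_integrand t n (m n) v \<partial>lborel) -
      (\<Sum>k\<le>p. laplace_coeff c (phase_fps x) (amplitude_fps t (a n)) k / of_nat n ^ k)) \<le> C1 / real n ^ (p + 1)"
    using spec[OF expansion, of p] unfolding local by (elim exE) blast
  obtain C2 q where q: "0 < q" "q < 1" and C2: "\<And>n m. n \<ge> 1 \<Longrightarrow>
    cmod (\<integral>v. indicator (- {-\<delta>..\<delta>}) v *\<^sub>R saddle_integrand t n m v \<partial>lborel) \<le> C2 * q ^ n"
    using saddle_integrand_tail[OF t \<delta>(1)] by blast
  \<comment> \<open>The exponent is \<open>p + 2\<close> rather than \<open>p + 1\<close> because
    the normalising factor \<open>sqrt n\<close> will be estimated by \<open>n\<close>.\<close>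
  obtain C3 where C3: "\<And>n. real n ^ (p + 2) * q ^ n \<le> C3"
    using power_times_geometric_bounded[OF q] by blast
  have C2_nonneg: "C2 \<ge> 0"
    using order_trans[OF norm_ge_zero C2[of 1 0]] q by (simp add: zero_le_mult_iff)
  have "cmod (of_real (sqrt (real n * c / (2 * pi))) * (\<integral>v. saddle_integrand t n (m n) v \<partial>lborel) -
      (\<Sum>k\<le>p. laplace_coeff c (phase_fps x) (amplitude_fps t (a n)) k / of_nat n ^ k))
      \<le> (C1 + sqrt (c / (2 * pi)) * C2 * C3) / real n ^ (p + 1)" if n: "n > 0" for n
  proof -
    let ?s = "sqrt (real n * c / (2 * pi))"
    let ?f = "saddle_integrand t n (m n)"
    have f: "integrable lborel ?f"
      using n by (intro integrable_saddle_integrand t) auto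
    have "(\<integral>v. ?f v \<partial>lborel) = (\<integral>v. indicator {-\<delta>..\<delta>} v *\<^sub>R ?f v + indicator (- {-\<delta>..\<delta>}) v *\<^sub>R ?f v \<partial>lborel)"
      by (intro Bochner_Integration.integral_cong refl) (simp add: indicator_def)
    also have "\<dots> = (\<integral>v. indicator {-\<delta>..\<delta>} v *\<^sub>R ?f v \<partial>lborel) + (\<integral>v. indicator (- {-\<delta>..\<delta>}) v *\<^sub>R ?f v \<partial>lborel)"
      by (intro Bochner_Integration.integral_add integrable_mult_indicator f) auto
    finally have split: "of_real ?s * (\<integral>v. ?f v \<partial>lborel) - (\<Sum>k\<le>p. laplace_coeff c (phase_fps x) (amplitude_fps t (a n)) k / of_nat n ^ k)
      = (of_real ?s * (\<integral>v. indicator {-\<delta>..\<delta>} v *\<^sub>R ?f v \<partial>lborel) -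
         (\<Sum>k\<le>p. laplace_coeff c (phase_fps x) (amplitude_fps t (a n)) k / of_nat n ^ k)) +
        of_real ?s * (\<integral>v. indicator (- {-\<delta>..\<delta>}) v *\<^sub>R ?f v \<partial>lborel)"
      by (simp add: distrib_left)
    have "cmod (of_real ?s * (\<integral>v. indicator (- {-\<delta>..\<delta>}) v *\<^sub>R ?f v \<partial>lborel)) \<le> ?s * (C2 * q ^ n)"
      unfolding norm_mult using C2[of n "m n"] n c by (simp add: mult_left_mono)
    also have "?s * (C2 * q ^ n) \<le> sqrt (c / (2 * pi)) * real n * (C2 * q ^ n)"
    proof -
      have "?s = sqrt (c / (2 * pi)) * sqrt (real n)"
        by (simp flip: real_sqrt_mult)
      moreover have "real n * 1 \<le> real n * real n"
        using n by (intro mult_left_mono) auto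
      then have "sqrt (real n) \<le> real n"
        by (intro real_le_lsqrt) (auto simp: power2_eq_square)
      ultimately show ?thesis
        using c C2_nonneg q by (simp only:) (intro mult_right_mono mult_left_mono, auto)
    qed
    also have "\<dots> = sqrt (c / (2 * pi)) * C2 * (real n ^ (p + 2) * q ^ n) / real n ^ (p + 1)"
    proof -
      have "real n ^ (p + 2) = real n * real n ^ (p + 1)"
        by simp
      moreover have "real n ^ (p + 1) \<noteq> 0"
        using n by simp
      moreover have "s * k * (d * y) = s * d * (k * N * y) / N" if "N \<noteq> 0" for s k d y N :: real
        using that by simp
      ultimately show ?thesis
        by metis
    qed
    also have "\<dots> \<le> sqrt (c / (2 * pi)) * C2 * C3 / real n ^ (p + 1)"
      using C3[of n] C2_nonneg c by (intro divide_right_mono mult_left_mono) auto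
    finally have tail: "cmod (of_real ?s * (\<integral>v. indicator (- {-\<delta>..\<delta>}) v *\<^sub>R ?f v \<partial>lborel))
        \<le> sqrt (c / (2 * pi)) * C2 * C3 / real n ^ (p + 1)" .
    show ?thesis
      unfolding split add_divide_distrib
      by (rule order_trans[OF norm_triangle_ineq add_mono[OF C1[OF n] tail]])
  qed
  then show ?thesis
    unfolding c_def t_def by blast
qed

section \<open>From the integral back to the probability\<close>

lemma prob_eq_descent_tail:
  assumes "n > 0"
  shows "measure_pmf.prob (uniform_perm n) {\<pi>. real (descents n \<pi>) / real n \<ge> x} = descent_tail n \<lceil>real n * x\<rceil>"
proof -
  have "real (descents n \<pi>) / real n \<ge> x \<longleftrightarrow> \<lceil>real n * x\<rceil> \<le> int (descents n \<pi>)" for \<pi>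
    using assms by (simp add: ceiling_le_iff le_divide_eq mult.commute)
  then show ?thesis
    by (simp add: descent_tail_def)
qed

definition saddle_prefactor :: "nat \<Rightarrow> real \<Rightarrow> real" where
  "saddle_prefactor n x = exp (- real n * I_D x - ceil_frac (real n * x) * t_of x)
     / (sigma_of x * t_of x * sqrt (2 * pi * real n))"

lemma ell_2_pos:
  assumes x: "1 / 2 < x" "x < 1"
  shows "ell 2 x > 0"
  by (simp add: ell_2_eq[OF x] tilted_variance_pos t_of_pos[OF x])

lemma saddle_prefactor_pos:
  assumes x: "1 / 2 < x" "x < 1" and n: "n > 0"
  shows "saddle_prefactor n x > 0"
  using ell_2_pos[OF x] t_of_pos[OF x] n by (simp add: saddle_prefactor_def sigma_of_def)

text \<open>With \<open>m = n x + {n x}\<close> the value of the kernel at the saddle is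
  \<open>exp (- n I_D x - {n x} t) / t\<close>. Dividing by the prefactor leaves
  \<open>sigma * sqrt (2 pi n) / (2 pi)\<close>, exactly the Gaussian normalisation of the Laplace
  expansion.\<close>

lemma descent_prob_eq_saddle_integral:
  assumes x: "1 / 2 < x" "x < 1" and n: "n > 0"
  shows "of_real (measure_pmf.prob (uniform_perm n) {\<pi>. real (descents n \<pi>) / real n \<ge> x} / saddle_prefactor n x) =
    of_real (sqrt (real n * ell 2 x / (2 * pi))) *
      (\<integral>v. saddle_integrand (t_of x) n (of_int \<lceil>real n * x\<rceil>) v \<partial>lborel)"
proof -
  define t where "t = t_of x"
  define c where "c = ell 2 x"
  define m where "m = real_of_int \<lceil>real n * x\<rceil>"
  define e where "e = exp (- real n * I_D x - ceil_frac (real n * x) * t)"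
  define J where "J = (\<integral>v. saddle_integrand t n m v \<partial>lborel)"
  have t: "t > 0" unfolding t_def by (rule t_of_pos[OF x])
  have c: "c > 0" unfolding c_def by (rule ell_2_pos[OF x])
  have "real n * L_D t - m * t = - real n * I_D x - ceil_frac (real n * x) * t"
    unfolding I_D_eq[OF x] ceil_frac_def m_def t_def by (simp add: algebra_simps)
  then have kernel: "bromwich_kernel n m (Complex t v) = of_real (e / t) * saddle_integrand t n m v" for v
    using bromwich_kernel_eq_saddle_integrand[OF t, of n m v] by (simp only: e_def)
  have "of_real (measure_pmf.prob (uniform_perm n) {\<pi>. real (descents n \<pi>) / real n \<ge> x}) = bromwich n t m"
    unfolding prob_eq_descent_tail[OF n] m_def using n by (intro descent_tail_eq_bromwich t) auto
  also have "\<dots> = of_real (e / t / (2 * pi)) * J"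
    unfolding bromwich_def kernel J_def by simp
  finally have P: "of_real (measure_pmf.prob (uniform_perm n) {\<pi>. real (descents n \<pi>) / real n \<ge> x}) =
      of_real (e / t / (2 * pi)) * J" .
  have "saddle_prefactor n x = e / (sqrt c * t * sqrt (2 * pi * real n))"
    by (simp add: saddle_prefactor_def e_def sigma_of_def c_def t_def)
  moreover have "e / t / (2 * pi) / (e / (sqrt c * t * sqrt (2 * pi * real n))) = sqrt (real n * c / (2 * pi))"
  proof -
    have e0: "e > 0" by (simp add: e_def)
    have "e / t / (2 * pi) / (e / (sqrt c * t * sqrt (2 * pi * real n))) = sqrt c * sqrt (2 * pi * real n) / (2 * pi)"
      using t e0 by simp
    also have "\<dots> = sqrt (c * (2 * pi * real n)) / sqrt ((2 * pi)\<^sup>2)"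
      by (simp add: real_sqrt_mult)
    also have "\<dots> = sqrt (c * (2 * pi * real n) / (2 * pi)\<^sup>2)"
      by (rule real_sqrt_divide[symmetric])
    also have "c * (2 * pi * real n) / (2 * pi)\<^sup>2 = real n * c / (2 * pi)"
      by (simp add: power2_eq_square field_simps)
    finally show ?thesis .
  qed
  ultimately have "e / t / (2 * pi) / saddle_prefactor n x = sqrt (real n * c / (2 * pi))"
    by (simp only:)
  moreover have "of_real (measure_pmf.prob (uniform_perm n) {\<pi>. real (descents n \<pi>) / real n \<ge> x} / saddle_prefactor n x) =
      of_real (e / t / (2 * pi) / saddle_prefactor n x) * J"
    by (simp only: of_real_divide[of _ "saddle_prefactor n x"] P times_divide_eq_left)
  ultimately show ?thesis
    by (simp only: c_def t_def m_def J_def)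
qed

lemma descent_prob_expansion:
  assumes x: "1 / 2 < x" "x < 1"
  shows "\<exists>C. \<forall>n>0. cmod (of_real (measure_pmf.prob (uniform_perm n) {\<pi>. real (descents n \<pi>) / real n \<ge> x} / saddle_prefactor n x) -
      (\<Sum>k\<le>p. laplace_coeff (ell 2 x) (phase_fps x) (amplitude_fps (t_of x) (ceil_frac (real n * x))) k / of_nat n ^ k))
      \<le> C / real n ^ (p + 1)"
proof -
  have "0 \<le> ceil_frac y" "ceil_frac y \<le> 1" for y
    using ceiling_correct[of y] by (auto simp: ceil_frac_def)
  from saddle_integrand_expansion[OF x this, of "\<lambda>n. of_int \<lceil>real n * x\<rceil>" "\<lambda>n. real n * x" p]
  have "\<exists>C. \<forall>n>0. cmod (of_real (sqrt (real n * ell 2 x / (2 * pi))) *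
      (\<integral>v. saddle_integrand (t_of x) n (of_int \<lceil>real n * x\<rceil>) v \<partial>lborel) -
      (\<Sum>k\<le>p. laplace_coeff (ell 2 x) (phase_fps x) (amplitude_fps (t_of x) (ceil_frac (real n * x))) k / of_nat n ^ k))
      \<le> C / real n ^ (p + 1)"
    by (simp add: ceil_frac_def)
  then show ?thesis
    by (simp only: descent_prob_eq_saddle_integral[OF x] cong: imp_cong)
qed

section \<open>Formulas for the coefficients\<close>

text \<open>The formula is chosen before \<open>n\<close> and \<open>x\<close>. Working with complex
  values fits the Laplace coefficients and shows at the same time that they are real.\<close>

definition expressible :: "(nat \<Rightarrow> real \<Rightarrow> complex) \<Rightarrow> bool" where
  "expressible u \<longleftrightarrow> (\<exists>f. \<forall>n x. u n x = of_real (formula_value f n x))"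

lemma expressible_rat: "expressible (\<lambda>n x. of_real (of_rat r))"
  unfolding expressible_def by (intro exI[of _ "Const r"]) simp

lemma expressible_ceil_frac: "expressible (\<lambda>n x. of_real (ceil_frac (real n * x)))"
  unfolding expressible_def by (intro exI[of _ CeilFrac]) simp

lemma expressible_t_of: "expressible (\<lambda>n x. of_real (t_of x))"
  unfolding expressible_def by (intro exI[of _ Saddle]) simp

lemma expressible_ell:
  assumes "j > 0"
  shows "expressible (\<lambda>n x. of_real (ell j x))"
  unfolding expressible_def using assms by (intro exI[of _ "Deriv (j - 1)"]) simp

lemma expressible_add:
  assumes "expressible u" "expressible v"
  shows "expressible (\<lambda>n x. u n x + v n x)"
proof -
  obtain f g where "\<And>n x. u n x = of_real (formula_value f n x)" "\<And>n x. v n x = of_real (formula_value g n x)"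
    using assms by (auto simp: expressible_def)
  then show ?thesis
    unfolding expressible_def by (intro exI[of _ "Plus f g"]) simp
qed

lemma expressible_mult:
  assumes "expressible u" "expressible v"
  shows "expressible (\<lambda>n x. u n x * v n x)"
proof -
  obtain f g where "\<And>n x. u n x = of_real (formula_value f n x)" "\<And>n x. v n x = of_real (formula_value g n x)"
    using assms by (auto simp: expressible_def)
  then show ?thesis
    unfolding expressible_def by (intro exI[of _ "Times f g"]) simp
qed

lemma expressible_inverse:
  assumes "expressible u"
  shows "expressible (\<lambda>n x. inverse (u n x))"
proof -
  obtain f where "\<And>n x. u n x = of_real (formula_value f n x)"
    using assms by (auto simp: expressible_def)
  then show ?thesis
    unfolding expressible_def by (intro exI[of _ "Inverse f"]) simp
qed

lemma expressible_0: "expressible (\<lambda>n x. 0)"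
  using expressible_rat[of 0] by simp

lemma expressible_1: "expressible (\<lambda>n x. 1)"
  using expressible_rat[of 1] by simp

lemma expressible_minus: "expressible u \<Longrightarrow> expressible (\<lambda>n x. - u n x)"
  using expressible_mult[OF expressible_rat[of "-1"], of u] by simp

lemma expressible_power: "expressible u \<Longrightarrow> expressible (\<lambda>n x. u n x ^ j)"
  by (induction j) (auto intro: expressible_1 expressible_mult)

lemma expressible_sum: "(\<And>i. i \<in> I \<Longrightarrow> expressible (u i)) \<Longrightarrow> expressible (\<lambda>n x. \<Sum>i\<in>I. u i n x)"
  by (induction I rule: infinite_finite_induct) (auto intro: expressible_0 expressible_add)

definition expressible_fps :: "(nat \<Rightarrow> real \<Rightarrow> complex fps) \<Rightarrow> bool" where
  "expressible_fps U \<longleftrightarrow> (\<forall>j. expressible (\<lambda>n x. fps_nth (U n x) j))"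

lemma expressible_fps_mult: "expressible_fps U \<Longrightarrow> expressible_fps V \<Longrightarrow> expressible_fps (\<lambda>n x. U n x * V n x)"
  unfolding expressible_fps_def by (auto simp: fps_mult_nth intro!: expressible_sum expressible_mult)

lemma expressible_fps_1: "expressible_fps (\<lambda>n x. 1)"
  unfolding expressible_fps_def
proof
  show "expressible (\<lambda>n x. fps_nth 1 j)" for j
    by (cases "j = 0") (auto intro: expressible_0 expressible_1)
qed

lemma expressible_fps_power: "expressible_fps U \<Longrightarrow> expressible_fps (\<lambda>n x. U n x ^ q)"
  by (induction q) (auto intro: expressible_fps_1 expressible_fps_mult)

text \<open>The geometric series makes every coefficient of the amplitude visibly a polynomial in
  \<open>a\<close> and \<open>1 / t\<close>.\<close>

lemma fps_inverse_one_plus: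
  "inverse (1 + fps_const c * fps_X) = Abs_fps (\<lambda>j. (- c) ^ j)" for c :: complex
proof (rule fps_inverse_unique)
  show "(1 + fps_const c * fps_X) * Abs_fps (\<lambda>j. (- c) ^ j) = 1"
  proof (rule fps_ext)
    fix j
    have "(1 + fps_const c * fps_X) * Abs_fps (\<lambda>j. (- c) ^ j) =
        Abs_fps (\<lambda>j. (- c) ^ j) + fps_const c * (fps_X * Abs_fps (\<lambda>j. (- c) ^ j))"
      by (simp add: distrib_right mult.assoc)
    then show "fps_nth ((1 + fps_const c * fps_X) * Abs_fps (\<lambda>j. (- c) ^ j)) j = fps_nth 1 j"
      by (cases j) simp_all
  qed
qed

lemma of_rat_fact: "of_rat (fact n) = (fact n :: 'a :: field_char_0)"
  by (metis of_nat_fact of_rat_of_nat_eq)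

lemma expressible_amplitude:
  "expressible_fps (\<lambda>n x. amplitude_fps (t_of x) (ceil_frac (real n * x)))"
  unfolding amplitude_fps_def fps_inverse_one_plus
proof (rule expressible_fps_mult)
  have "fps_nth (fps_exp (- complex_of_real a)) j = (- of_real a) ^ j * of_real (of_rat (1 / fact j))" for a j
    by (simp add: of_rat_divide of_rat_fact)
  then show "expressible_fps (\<lambda>n x. fps_exp (- of_real (ceil_frac (real n * x))))"
    unfolding expressible_fps_def
    by (simp only:) (intro allI expressible_mult expressible_power expressible_minus
      expressible_ceil_frac expressible_rat)
  have "fps_nth (Abs_fps (\<lambda>j. (- complex_of_real (1 / t)) ^ j)) j = (- inverse (complex_of_real t)) ^ j" for t j
    by (simp add: inverse_eq_divide)
  then show "expressible_fps (\<lambda>n x. Abs_fps (\<lambda>j. (- of_real (1 / t_of x)) ^ j))"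
    unfolding expressible_fps_def
    by (simp only:) (intro allI expressible_power expressible_minus expressible_inverse expressible_t_of)
qed

text \<open>The coefficients below order three are 0, so \<open>L_D\<close> itself, for which there
  is no formula constructor, never occurs.\<close>

lemma expressible_phase: "expressible_fps (\<lambda>n x. phase_fps x)"
  unfolding expressible_fps_def
proof
  fix j
  have "fps_nth (phase_fps x) j = (if j < 3 then 0 else of_real (ell j x) * of_real (of_rat (1 / fact j)))" for x
    by (simp add: phase_fps_def of_rat_divide of_rat_fact)
  then show "expressible (\<lambda>n x. fps_nth (phase_fps x) j)"
    by (cases "j < 3")
      (simp_all only: if_True if_False expressible_0 expressible_mult expressible_ell expressible_rat)
qed

lemma expressible_laplace_coeff:
  "expressible (\<lambda>n x. laplace_coeff (ell 2 x) (phase_fps x) (amplitude_fps (t_of x) (ceil_frac (real n * x))) k)"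
proof -
  \<comment> \<open>The numerical factor is rational and becomes a \<open>Const\<close>; only the
    power of \<open>ell 2 x\<close> needs \<open>Inverse\<close>.\<close>
  have *: "of_real ((-1) ^ r * gauss_moment r / (fact q * c ^ r)) =
      of_real (of_rat ((-1) ^ r * (fact (2 * r) / (2 ^ r * fact r)) / fact q)) * inverse (complex_of_real c ^ r)" for r q c
    by (simp add: gauss_moment_def of_rat_divide of_rat_mult of_rat_power of_rat_fact of_rat_minus field_simps)
  have "expressible_fps (\<lambda>n x. phase_fps x ^ q * amplitude_fps (t_of x) (ceil_frac (real n * x)))" for q
    by (intro expressible_fps_mult expressible_fps_power expressible_phase expressible_amplitude)
  then have "expressible (\<lambda>n x. fps_nth (phase_fps x ^ q * amplitude_fps (t_of x) (ceil_frac (real n * x))) j)" for q j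
    by (simp add: expressible_fps_def)
  then show ?thesis
    unfolding laplace_coeff_def *
    by (intro expressible_sum expressible_mult expressible_inverse expressible_power expressible_ell expressible_rat) auto
qed

section \<open>The first two coefficients, and boundedness\<close>

lemma laplace_coeff_0: "laplace_coeff c H (amplitude_fps t a) 0 = 1"
  by (simp add: laplace_coeff_def gauss_moment_def amplitude_fps_def)

text \<open>Only \<open>q = 0, 1, 2\<close> contribute, through the coefficients of
  \<open>G\<close>, \<open>H G\<close>, \<open>H^2 G\<close> at orders 2, 4, 6 with Gaussian moments
  1, 3, 15. The quantities \<open>a\<close> and \<open>1 / t\<close> meet \<open>ell 3 x\<close>
  only through the linear coefficient \<open>- a - 1 / t\<close> of \<open>G\<close>.\<close>

lemma laplace_coeff_1:
  assumes x: "1 / 2 < x" "x < 1"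
  shows "laplace_coeff (ell 2 x) (phase_fps x) (amplitude_fps (t_of x) (ceil_frac (real n * x))) 1 = of_real (first_coeff n x)"
proof -
  define a where "a = ceil_frac (real n * x)"
  define t where "t = t_of x"
  define c where "c = ell 2 x"
  have t: "t > 0" unfolding t_def by (rule t_of_pos[OF x])
  have c: "c > 0" unfolding c_def by (rule ell_2_pos[OF x])
  define G where "G = amplitude_fps t a"
  have G: "fps_nth G j = (\<Sum>i=0..j. of_real ((- a) ^ i / fact i * (- 1 / t) ^ (j - i)))" for j
    unfolding G_def amplitude_fps_def fps_inverse_one_plus by (simp add: fps_mult_nth)
  have G0: "fps_nth G 0 = 1"
    by (simp add: G)
  have G1: "fps_nth G 1 = of_real (- a - 1 / t)"
    by (simp add: G)
  have G2: "fps_nth G 2 = of_real (a\<^sup>2 / 2 + a / t + 1 / t\<^sup>2)"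
    by (simp add: G numeral_2_eq_2 power_divide)
  let ?H = "phase_fps x"
  have H: "fps_nth ?H 0 = 0" "fps_nth ?H 1 = 0" "fps_nth ?H 2 = 0"
    "fps_nth ?H 3 = of_real (ell 3 x / 6)" "fps_nth ?H 4 = of_real (ell 4 x / 24)"
    by (simp_all add: phase_fps_def fact_numeral)
  have sum3: "(\<Sum>i=0..3. f i) = f 0 + f 1 + f 2 + f 3" for f :: "nat \<Rightarrow> complex"
    by (simp add: numeral_eq_Suc)
  have sum4: "(\<Sum>i=0..4. f i) = f 0 + f 1 + f 2 + f 3 + f 4" for f :: "nat \<Rightarrow> complex"
    by (simp add: numeral_eq_Suc)
  have sum6: "(\<Sum>i=0..6. f i) = f 0 + f 1 + f 2 + f 3 + f 4 + f 5 + f 6" for f :: "nat \<Rightarrow> complex"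
    by (simp add: numeral_eq_Suc)
  have HG: "fps_nth (?H * G) 3 = of_real (ell 3 x / 6)"
    "fps_nth (?H * G) 4 = of_real (ell 3 x / 6) * of_real (- a - 1 / t) + of_real (ell 4 x / 24)"
    unfolding fps_mult_nth sum3 sum4 H G0 G1 by (simp_all add: H G0 G1[unfolded One_nat_def])
  \<comment> \<open>\<open>H\<close> and \<open>H G\<close> both vanish to order three, so order 6
    of their product receives only the term 3 + 3.\<close>
  have "fps_nth (?H * G) j = 0" if "j < 3" for j
    using fps_nth_power_mult_eq_0[of ?H j 1 G] that by (simp add: phase_fps_def)
  then have HHG: "fps_nth (?H * (?H * G)) 6 = of_real (ell 3 x / 6) * of_real (ell 3 x / 6)"
    unfolding fps_mult_nth[of ?H "?H * G"] sum6 H by (simp add: HG(1) H H(2)[unfolded One_nat_def])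
  have gm: "gauss_moment 1 = 1" "gauss_moment 2 = 3" "gauss_moment 3 = 15"
    by (simp_all add: gauss_moment_def fact_numeral)
  have sum2: "(\<Sum>q\<le>2 * 1. f q) = f 0 + f 1 + f 2" for f :: "nat \<Rightarrow> complex"
    by (simp add: numeral_2_eq_2)
  have arith: "2 * 1 = (2 :: nat)" "2 * 2 = (4 :: nat)" "2 * 3 = (6 :: nat)"
    "1 + 0 = (1 :: nat)" "1 + 1 = (2 :: nat)" "1 + 2 = (3 :: nat)"
    by simp_all
  have powers: "?H ^ 0 * G = G" "?H ^ 1 * G = ?H * G" "?H\<^sup>2 * G = ?H * (?H * G)"
    by (simp_all add: power2_eq_square mult.assoc)
  have "laplace_coeff c ?H G 1 =
      fps_nth G 2 * of_real ((-1) ^ 1 * gauss_moment 1 / (fact 0 * c ^ 1)) +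
      fps_nth (?H * G) 4 * of_real ((-1) ^ 2 * gauss_moment 2 / (fact 1 * c ^ 2)) +
      fps_nth (?H * (?H * G)) 6 * of_real ((-1) ^ 3 * gauss_moment 3 / (fact 2 * c ^ 3))"
    unfolding laplace_coeff_def sum2 by (simp only: arith powers)
  also have "\<dots> = of_real ((a\<^sup>2 / 2 + a / t + 1 / t\<^sup>2) * (- 1 / c) +
      (ell 3 x / 6 * (- a - 1 / t) + ell 4 x / 24) * (3 / c\<^sup>2) +
      (ell 3 x / 6 * (ell 3 x / 6)) * (- 15 / (2 * c ^ 3)))"
    unfolding G2 HG HHG gm by simp
  also have "(a\<^sup>2 / 2 + a / t + 1 / t\<^sup>2) * (- 1 / c) +
      (ell 3 x / 6 * (- a - 1 / t) + ell 4 x / 24) * (3 / c\<^sup>2) +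
      (ell 3 x / 6 * (ell 3 x / 6)) * (- 15 / (2 * c ^ 3)) = first_coeff n x"
  proof -
    have s: "(sigma_of x)\<^sup>2 = c" "(sigma_of x) ^ 4 = c\<^sup>2"
    proof -
      show s2: "(sigma_of x)\<^sup>2 = c"
        using c by (simp add: sigma_of_def c_def)
      have "(sigma_of x) ^ 4 = ((sigma_of x)\<^sup>2)\<^sup>2"
        by (simp flip: power_mult)
      then show "(sigma_of x) ^ 4 = c\<^sup>2"
        by (simp only: s2)
    qed
    show ?thesis
      unfolding first_coeff_def Let_def s a_def[symmetric] t_def[symmetric]
      using c t by (simp add: field_simps power2_eq_square power3_eq_cube)
  qed
  finally show ?thesis
    by (simp only: G_def c_def a_def t_def)
qed

text \<open>The \<open>k\<close>-th term of the sum is the difference of the expansions of orders \<open>k\<close> and \<open>k - 1\<close>.\<close>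

lemma laplace_coeff_bounded:
  assumes x: "1 / 2 < x" "x < 1"
  shows "Bseq (\<lambda>n. laplace_coeff (ell 2 x) (phase_fps x) (amplitude_fps (t_of x) (ceil_frac (real n * x))) k)"
proof (cases "k = 0")
  case True
  then show ?thesis
    by (simp add: laplace_coeff_0)
next
  case False
  then obtain p where k: "k = Suc p"
    by (cases k) auto
  define d where "d n j = laplace_coeff (ell 2 x) (phase_fps x) (amplitude_fps (t_of x) (ceil_frac (real n * x))) j" for n j
  define P where "P n = complex_of_real (measure_pmf.prob (uniform_perm n) {\<pi>. real (descents n \<pi>) / real n \<ge> x} / saddle_prefactor n x)" for n
  obtain C where C: "cmod (P n - (\<Sum>j\<le>p. d n j / of_nat n ^ j)) \<le> C / real n ^ k" if "n > 0" for n
    using descent_prob_expansion[OF x, of p] unfolding P_def d_def k Suc_eq_plus1 by blast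
  obtain C' where C': "cmod (P n - (\<Sum>j\<le>k. d n j / of_nat n ^ j)) \<le> C' / real n ^ (k + 1)" if "n > 0" for n
    using descent_prob_expansion[OF x, of k] unfolding P_def d_def by blast
  have "cmod (d n k) \<le> C + C'" if n: "n > 0" for n
  proof -
    have C'0: "C' \<ge> 0"
    proof -
      have "0 \<le> C' / real n ^ (k + 1) * real n ^ (k + 1)"
        by (intro mult_nonneg_nonneg order_trans[OF norm_ge_zero C'[OF n]]) auto
      then show ?thesis
        using n by simp
    qed
    have "d n k / of_nat n ^ k = (P n - (\<Sum>j\<le>p. d n j / of_nat n ^ j)) - (P n - (\<Sum>j\<le>k. d n j / of_nat n ^ j))"
      by (simp add: k)
    then have "cmod (d n k / of_nat n ^ k) \<le> C / real n ^ k + C' / real n ^ (k + 1)"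
      by (simp only:) (rule order_trans[OF norm_triangle_ineq4 add_mono[OF C[OF n] C'[OF n]]])
    also have "C' / real n ^ (k + 1) \<le> C' / real n ^ k"
      using n C'0 by (intro divide_left_mono power_increasing mult_pos_pos) auto
    finally have "cmod (d n k) / real n ^ k \<le> (C + C') / real n ^ k"
      by (simp add: norm_divide norm_power add_divide_distrib)
    then show ?thesis
      using n by (simp add: divide_le_cancel)
  qed
  \<comment> \<open>The expansions say nothing at \<open>n = 0\<close>, so that single value is
    added to the bound.\<close>
  then have "cmod (d n k) \<le> max (C + C') (cmod (d 0 k))" for n
    by (cases "n = 0") (auto simp: le_max_iff_disj)
  then show ?thesis
    unfolding d_def[symmetric] by (rule BseqI')
qed

theorem theorem2p1:
  shows "\<exists>\<phi> :: nat \<Rightarrow> coeff_formula. \<forall>x :: real. 1 / 2 < x \<and> x < 1 \<longrightarrow>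
    (\<exists>!t. deriv L_D t = x) \<and>
    (\<forall>p :: nat. p \<ge> 1 \<longrightarrow>
      (\<exists>d :: nat \<Rightarrow> nat \<Rightarrow> real.
        (\<forall>k\<in>{1..p}. Bseq (\<lambda>n. d n k) \<and> (\<forall>n. d n k = formula_value (\<phi> k) n x)) \<and>
        (\<forall>n. d n 1 = first_coeff n x) \<and>
        (\<exists>r :: nat \<Rightarrow> real. r \<in> O(\<lambda>n. 1 / real n ^ (p + 1)) \<and>
          (\<forall>\<^sub>F n in sequentially.
            measure_pmf.prob (uniform_perm n) {\<pi>. real (descents n \<pi>) / real n \<ge> x} =
              exp (- real n * I_D x - ceil_frac (real n * x) * t_of x)
                / (sigma_of x * t_of x * sqrt (2 * pi * real n))
                * (1 + (\<Sum>k=1..p. d n k / real n ^ k) + r n)))))"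
proof -
  define \<delta> where "\<delta> n x k = laplace_coeff (ell 2 x) (phase_fps x) (amplitude_fps (t_of x) (ceil_frac (real n * x))) k"
    for n x k
  \<comment> \<open>The formulas are selected here, before \<open>x\<close> and \<open>p\<close> are
    fixed.\<close>
  have "\<forall>k. \<exists>f. \<forall>n x. \<delta> n x k = of_real (formula_value f n x)"
    unfolding \<delta>_def by (intro allI expressible_laplace_coeff[unfolded expressible_def])
  from choice[OF this] obtain \<phi> where "\<forall>k n x. \<delta> n x k = of_real (formula_value (\<phi> k) n x)"
    by (elim exE)
  then have \<phi>: "\<delta> n x k = of_real (formula_value (\<phi> k) n x)" for n x k
    by simp
  show ?thesis
  proof (rule exI[of _ \<phi>], intro allI impI conjI)
    fix x :: real
    assume "1 / 2 < x \<and> x < 1"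
    then have x: "1 / 2 < x" "x < 1" by auto
    show "\<exists>!t. deriv L_D t = x"
      by (rule ex1_deriv_L_D[OF x])
    fix p :: nat
    assume "p \<ge> 1"
    define d where "d n k = formula_value (\<phi> k) n x" for n k
    have d: "complex_of_real (d n k) = \<delta> n x k" for n k
      by (simp add: d_def \<phi>)
    define P where "P n = measure_pmf.prob (uniform_perm n) {\<pi>. real (descents n \<pi>) / real n \<ge> x}" for n
    \<comment> \<open>The remainder is defined by the required equation, which therefore holds
      exactly for every \<open>n > 0\<close>; only its order of magnitude needs the
      expansion.\<close>
    define r where "r n = P n / saddle_prefactor n x - (\<Sum>k\<le>p. d n k / real n ^ k)" for n
    have split: "(\<Sum>k\<le>p. d n k / real n ^ k) = 1 + (\<Sum>k=1..p. d n k / real n ^ k)" for n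
    proof -
      have "complex_of_real (d n 0) = 1"
        unfolding d \<delta>_def by (rule laplace_coeff_0)
      then have "d n 0 = 1" by simp
      moreover have "{..p} = insert 0 {1..p}" by auto
      ultimately show ?thesis by simp
    qed
    show "\<exists>d :: nat \<Rightarrow> nat \<Rightarrow> real.
        (\<forall>k\<in>{1..p}. Bseq (\<lambda>n. d n k) \<and> (\<forall>n. d n k = formula_value (\<phi> k) n x)) \<and>
        (\<forall>n. d n 1 = first_coeff n x) \<and>
        (\<exists>r :: nat \<Rightarrow> real. r \<in> O(\<lambda>n. 1 / real n ^ (p + 1)) \<and>
          (\<forall>\<^sub>F n in sequentially.
            measure_pmf.prob (uniform_perm n) {\<pi>. real (descents n \<pi>) / real n \<ge> x} =
              exp (- real n * I_D x - ceil_frac (real n * x) * t_of x)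
                / (sigma_of x * t_of x * sqrt (2 * pi * real n))
                * (1 + (\<Sum>k=1..p. d n k / real n ^ k) + r n)))"
    proof (rule exI[of _ d], intro conjI ballI allI)
      fix k
      have "Bseq (\<lambda>n. complex_of_real (d n k))"
        unfolding d \<delta>_def by (rule laplace_coeff_bounded[OF x])
      then show "Bseq (\<lambda>n. d n k)"
        by (simp add: Bseq_def)
    next
      fix k n show "d n k = formula_value (\<phi> k) n x"
        by (rule d_def)
    next
      fix n
      have "complex_of_real (d n 1) = of_real (first_coeff n x)"
        unfolding d \<delta>_def by (rule laplace_coeff_1[OF x])
      then show "d n 1 = first_coeff n x"
        by (simp only: of_real_eq_iff)
    next
      obtain C where C': "cmod (of_real (P n / saddle_prefactor n x) - (\<Sum>k\<le>p. \<delta> n x k / of_nat n ^ k)) \<le> C / real n ^ (p + 1)"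
        if "n > 0" for n
        using descent_prob_expansion[OF x, of p] unfolding P_def \<delta>_def by blast
      have r: "complex_of_real (r n) = of_real (P n / saddle_prefactor n x) - (\<Sum>k\<le>p. \<delta> n x k / of_nat n ^ k)" for n
        unfolding r_def d[symmetric] by simp
      have C: "\<bar>r n\<bar> \<le> C / real n ^ (p + 1)" if "n > 0" for n
        using C'[OF that] unfolding r[symmetric] norm_of_real .
      have "r \<in> O(\<lambda>n. 1 / real n ^ (p + 1))"
      proof (rule bigoI[of _ C])
        show "\<forall>\<^sub>F n in sequentially. norm (r n) \<le> C * norm (1 / real n ^ (p + 1))"
          using eventually_gt_at_top[of 0]
        proof eventually_elim
          case (elim n)
          show ?case
            using C[OF elim] by simp
        qed
      qed
      moreover have "\<forall>\<^sub>F n in sequentially.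
            measure_pmf.prob (uniform_perm n) {\<pi>. real (descents n \<pi>) / real n \<ge> x} =
              exp (- real n * I_D x - ceil_frac (real n * x) * t_of x)
                / (sigma_of x * t_of x * sqrt (2 * pi * real n))
                * (1 + (\<Sum>k=1..p. d n k / real n ^ k) + r n)"
        using eventually_gt_at_top[of 0]
      proof eventually_elim
        case (elim n)
        have "saddle_prefactor n x \<noteq> 0"
          using saddle_prefactor_pos[OF x elim] by simp
        moreover have "P n / saddle_prefactor n x = 1 + (\<Sum>k=1..p. d n k / real n ^ k) + r n"
          using split[of n] r_def[of n] by linarith
        ultimately have "P n = saddle_prefactor n x * (1 + (\<Sum>k=1..p. d n k / real n ^ k) + r n)"
          by (metis nonzero_mult_div_cancel_left times_divide_eq_right)
        then show ?case
          by (simp only: P_def saddle_prefactor_def)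
      qed
      ultimately show "\<exists>r :: nat \<Rightarrow> real. r \<in> O(\<lambda>n. 1 / real n ^ (p + 1)) \<and>
          (\<forall>\<^sub>F n in sequentially.
            measure_pmf.prob (uniform_perm n) {\<pi>. real (descents n \<pi>) / real n \<ge> x} =
              exp (- real n * I_D x - ceil_frac (real n * x) * t_of x)
                / (sigma_of x * t_of x * sqrt (2 * pi * real n))
                * (1 + (\<Sum>k=1..p. d n k / real n ^ k) + r n))"
        by blast
    qed
  qed
qed

end
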